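(* Let $T$ be one of the following operators on $\mathbb{R}^d$: a dyadic martingale transform, a Haar shift operator, or the dyadic maximal operator $\mathcal{M}_\mathscr{D}$. Then there exists $0<r<1$ such that for each $f\in L^\infty_c(\mathbb{R}^d)$ there is a sparse family $\mathcal{S}\subset\mathscr{D}$ (with sparseness parameter independent of $f$) such that $$Tf(x)\lesssim \sum_{Q\in\mathcal{S}} \mathsf{P}_Q^r(\mathcal{M}_Q f)\,\mathbf{1}_Q(x),\qquad x\in\mathbb{R}^d,$$ with implicit constant independent of $f$.
   Context: $\mathscr{D}$ is the standard dyadic grid on $\mathbb{R}^d$, $\mathscr{D}_k$ the dyadic cubes of side length $2^{-k}$, $\mathscr{D}(Q)$ the dyadic subcubes of $Q$ (including $Q$), $\mathscr{D}_\ell(Q)$ those with side length $2^{-\ell}\ell(Q)$, and $\langle f\rangle_Q=\frac1{|Q|}\int_Q f$. $\mathcal{M}_\mathscr{D} f(x)=\sup_{x\in Q\in\mathscr{D}}|\langle f\rangle_Q|$ and $\mathcal{M}_Q f(x)=\sup_{x\in R\in\mathscr{D}(Q)}|\langle f\rangle_R|$. For a set $\Omega$ of positive finite measure and measurable $g$, $\mathsf{P}^r_\Omega(g):=\inf\{\lambda\in\mathbb{R}: |\{x\in\Omega: g(x)>\lambda\}|\le r|\Omega|\}$. A family $\mathcal{S}$ of cubes is $\eta$-sparse ($0<\eta<1$) if for each $Q\in\mathcal{S}$ there is $E_Q\subset Q$ with $|E_Q|\ge\eta|Q|$ and the $E_Q$ pairwise disjoint. A dyadic martingale transform is $Tf=\sum_k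 \sigma_k\,(\mathsf{E}_kf-\mathsf{E}_{k-1}f)$ where $\mathsf{E}_kf=\sum_{Q\in\mathscr{D}_k}\langle f\rangle_Q\mathbf{1}_Q$ and each $\sigma_k$ is $\sigma(\mathscr{D}_{k-1})$-measurable with $\sup_k\|\sigma_k\|_\infty\le1$. Given a Haar basis $\{h_Q\}_{Q\in\mathscr{D}}$ of $L^2(\mathbb{R}^d)$ (each $h_Q$ supported on $Q$, constant on the dyadic children of $Q$, mean zero, $L^2$-normalized), a Haar shift of complexity $(t,s)$ is $\mathrm{Sh} f=\sum_{Q\in\mathscr{D}}\sum_{T\in\mathscr{D}_t(Q)}\sum_{S\in\mathscr{D}_s(Q)}\alpha^Q_{TS}\langle f,h_T\rangle h_S$ with $\sup_{Q,T,S}|\alpha^Q_{TS}|<\infty$. *)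

theory Defs
  imports "HOL-Analysis.Analysis"
begin

definition dcube :: "int \<Rightarrow> ('n::finite \<Rightarrow> int) \<Rightarrow> (real^'n) set" where
  "dcube k j = {x. \<forall>i. real_of_int (j i) \<le> 2 powr real_of_int k * x$i
                   \<and> 2 powr real_of_int k * x$i < real_of_int (j i) + 1}"

definition dlevel :: "int \<Rightarrow> (real^'n::finite) set set" where
  "dlevel k = range (dcube k)"

definition dyadic :: "(real^'n::finite) set set" where
  "dyadic = (\<Union>k. dlevel k)"

definition dcubes_in :: "(real^'n::finite) set \<Rightarrow> (real^'n) set set" where
  "dcubes_in Q = {R \<in> dyadic. R \<subseteq> Q}"

definition dsub :: "nat \<Rightarrow> (real^'n::finite) set \<Rightarrow> (real^'n) set set" where
  "dsub l Q = {R. \<exists>k j. Q = dcube k j \<and> R \<in> dlevel (k + int l) \<and> R \<subseteq> Q}"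

definition cube_at :: "int \<Rightarrow> real^'n::finite \<Rightarrow> (real^'n) set" where
  "cube_at k x = dcube k (\<lambda>i. \<lfloor>2 powr real_of_int k * x$i\<rfloor>)"

definition avg :: "(real^'n::finite \<Rightarrow> real) \<Rightarrow> (real^'n) set \<Rightarrow> real" where
  "avg f Q = set_lebesgue_integral lborel Q f / measure lborel Q"

definition dyadic_max :: "(real^'n::finite \<Rightarrow> real) \<Rightarrow> real^'n \<Rightarrow> real" where
  "dyadic_max f x = (SUP Q\<in>{Q\<in>dyadic. x \<in> Q}. \<bar>avg f Q\<bar>)"

definition local_max :: "(real^'n::finite) set \<Rightarrow> (real^'n \<Rightarrow> real) \<Rightarrow> real^'n \<Rightarrow> real" where
  "local_max Q f x = (SUP R\<in>{R\<in>dcubes_in Q. x \<in> R}. \<bar>avg f R\<bar>)"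

definition Pr :: "real \<Rightarrow> (real^'n::finite) set \<Rightarrow> (real^'n \<Rightarrow> real) \<Rightarrow> real" where
  "Pr r \<Omega> g = Inf {c. measure lborel {x\<in>\<Omega>. g x > c} \<le> r * measure lborel \<Omega>}"

definition sparse :: "real \<Rightarrow> (real^'n::finite) set set \<Rightarrow> bool" where
  "sparse \<eta> S \<longleftrightarrow> 0 < \<eta> \<and> \<eta> < 1 \<and>
     (\<exists>E. (\<forall>Q\<in>S. E Q \<subseteq> Q \<and> E Q \<in> sets lborel \<and> \<eta> * measure lborel Q \<le> measure lborel (E Q))
          \<and> disjoint_family_on E S)"

definition Linf_c :: "(real^'n::finite \<Rightarrow> real) \<Rightarrow> bool" where
  "Linf_c f \<longleftrightarrow> f \<in> borel_measurable lborel \<and> (\<exists>B. AE x in lborel. \<bar>f x\<bar> \<le> B)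
     \<and> (\<exists>K. compact K \<and> (AE x in lborel. x \<notin> K \<longrightarrow> f x = 0))"

definition cond_exp :: "int \<Rightarrow> (real^'n::finite \<Rightarrow> real) \<Rightarrow> real^'n \<Rightarrow> real" where
  "cond_exp k f x = avg f (cube_at k x)"

text \<open>Admissible multiplier sequence: sigma_k is sigma(D_(k-1))-measurable, |sigma_k| <= 1.\<close>
definition mt_multiplier :: "(int \<Rightarrow> real^'n::finite \<Rightarrow> real) \<Rightarrow> bool" where
  "mt_multiplier \<sigma> \<longleftrightarrow> (\<forall>k. (\<forall>Q\<in>dlevel (k - 1). \<forall>x\<in>Q. \<forall>y\<in>Q. \<sigma> k x = \<sigma> k y)
                           \<and> (\<forall>x. \<bar>\<sigma> k x\<bar> \<le> 1))"

definition mart_transform :: "(int \<Rightarrow> real^'n::finite \<Rightarrow> real) \<Rightarrow> (real^'n \<Rightarrow> real) \<Rightarrow> real^'n \<Rightarrow> real" where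
  "mart_transform \<sigma> f x = lim (\<lambda>N::nat. \<Sum>k\<in>{- int N..int N}. \<sigma> k x * (cond_exp k f x - cond_exp (k - 1) f x))"

definition haar_function :: "(real^'n::finite) set \<Rightarrow> (real^'n \<Rightarrow> real) \<Rightarrow> bool" where
  "haar_function Q h \<longleftrightarrow> (\<forall>x. x \<notin> Q \<longrightarrow> h x = 0)
     \<and> (\<forall>R\<in>dsub 1 Q. \<forall>x\<in>R. \<forall>y\<in>R. h x = h y)
     \<and> set_lebesgue_integral lborel Q h = 0
     \<and> integral\<^sup>L lborel (\<lambda>x. (h x)\<^sup>2) = 1"

definition haar_system :: "((real^'n::finite) set \<Rightarrow> real^'n \<Rightarrow> real) \<Rightarrow> bool" where
  "haar_system h \<longleftrightarrow> (\<forall>Q\<in>dyadic. haar_function Q (h Q))"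

text \<open>Haar shift of complexity (t,s). Only cubes Q containing x contribute at x,
  so the sum over Q in D_k reduces to Q = cube_at k x; the sum over levels is taken
  as the pointwise limit of partial sums over -N..N.\<close>
definition haar_shift :: "((real^'n::finite) set \<Rightarrow> real^'n \<Rightarrow> real) \<Rightarrow> nat \<Rightarrow> nat
    \<Rightarrow> ((real^'n) set \<Rightarrow> (real^'n) set \<Rightarrow> (real^'n) set \<Rightarrow> real)
    \<Rightarrow> (real^'n \<Rightarrow> real) \<Rightarrow> real^'n \<Rightarrow> real" where
  "haar_shift h t s \<alpha> f x = lim (\<lambda>N::nat. \<Sum>k\<in>{- int N..int N}.
      \<Sum>T\<in>dsub t (cube_at k x). \<Sum>S\<in>dsub s (cube_at k x).
        \<alpha> (cube_at k x) T S * integral\<^sup>L lborel (\<lambda>y. f y * h T y) * h S x)"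

definition sparse_sum :: "real \<Rightarrow> (real^'n::finite) set set \<Rightarrow> (real^'n \<Rightarrow> real) \<Rightarrow> real^'n \<Rightarrow> ennreal" where
  "sparse_sum r S f x = (\<Sum>\<^sub>\<infinity>Q\<in>S. ennreal (Pr r Q (local_max Q f)) * indicator Q x)"

end

theory Submission
  imports Defs
begin

text \<open>
  All three operators are controlled by one stopping-time argument. Write \<open>\<lambda>\<close> for the percentile
  of \<open>M\<^sub>Q f\<close> on a cube \<open>Q\<close>. The dyadic subcubes of \<open>Q\<close> carrying an average of size more than
  \<open>\<lambda>\<close> cover at most the fraction \<open>r\<close> of \<open>Q\<close>, and so do, up to a constant factor, their ancestors
  a bounded number of generations up. Keeping only the terms of the operator attached to the
  remaining cubes gives a martingale on \<open>Q\<close> with square norm at most a constant times \<open>\<lambda>\<^sup>2 |Q|\<close>,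
  since the martingale of \<open>f\<close> stopped there is bounded by \<open>\<lambda>\<close>. By Kolmogorov's inequality its
  partial sums exceed a multiple of \<open>\<lambda>\<close> only on cubes covering at most a quarter of \<open>Q\<close>. Outside
  the two bad sets, of total measure at most half of \<open>|Q|\<close>, the partial sums of the operator are
  at most a multiple of \<open>\<lambda>\<close>, and one restarts in the maximal bad cubes. Starting from the
  cubes at the origin that cover the support of \<open>f\<close>, and adding their dyadic ancestors, yields the
  sparse family. The bound on partial sums holds at every point; almost everywhere is only needed
  for the convergence of the partial sums, which again follows from Kolmogorov's inequality.
\<close>

section \<open>Dyadic cubes\<close>

text \<open>The percentile says nothing about integrals of \<open>f\<close> over \<open>Q\<close>;
  it only bounds averages over cubes outside a small set. Hence a term is kept only if every average
  that it can see is at most the percentile, and orthogonality alone then supplies the square norm.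
  The term attached to a cube \<open>P\<close> looks at averages down to \<open>w + 1\<close>
  generations below \<open>P\<close> and is constant only \<open>u\<close> generations below
  \<open>P\<close>. The first depth dictates \<open>r\<close>: passing to the ancestors costs a
  factor 2^(d(w+1)), and at most a quarter of the volume may be lost, so \<open>r\<close> is 1 / (4
  * 2^(d(w+1))). The second depth means that, where a branch stops, the values of the last
  \<open>u\<close> terms are not yet visible in the martingale there; they are estimated one at a
  time. Martingales are functions on cubes rather than on points. Orthogonality and the maximal
  inequality thus become finite sums over children, and measure theory enters through the volumes of
  unions of cubes. No single dyadic cube need contain the support, which may cross the coordinate
  hyperplanes. The averages over the large cubes around it need not vanish, so these cubes must
  belong to the family too.\<close>

lemma mem_dcube_iff: "x \<in> dcube k j \<longleftrightarrow> (\<forall>i. \<lfloor>2 powr real_of_int k * x$i\<rfloor> = j i)"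
  unfolding dcube_def by (simp add: floor_eq_iff)

lemma mem_cube_at: "x \<in> cube_at k x"
  unfolding cube_at_def by (simp add: mem_dcube_iff)

lemma cube_at_eqI: "y \<in> cube_at k x \<Longrightarrow> cube_at k y = cube_at k x"
  unfolding cube_at_def by (simp add: mem_dcube_iff)

lemma cube_at_dlevel: "cube_at k x \<in> dlevel k"
  unfolding cube_at_def dlevel_def by auto

lemma dlevel_cube_at: "Q \<in> dlevel k \<Longrightarrow> x \<in> Q \<Longrightarrow> Q = cube_at k x"
proof -
  assume "Q \<in> dlevel k" and x: "x \<in> Q"
  then obtain j where j: "Q = dcube k j" by (auto simp: dlevel_def)
  with x have "(\<lambda>i. \<lfloor>2 powr real_of_int k * x$i\<rfloor>) = j" by (auto simp: mem_dcube_iff)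
  then show ?thesis by (simp add: j cube_at_def)
qed

lemma cube_at_mono: "k \<le> l \<Longrightarrow> cube_at l x \<subseteq> cube_at k x"
proof (induction l rule: int_ge_induct)
  case (step l)
  have "cube_at (l+1) x \<subseteq> cube_at l x"
  proof
    fix y assume "y \<in> cube_at (l+1) x"
    then have e: "\<lfloor>2 powr real_of_int (l+1) * y$i\<rfloor> = \<lfloor>2 powr real_of_int (l+1) * x$i\<rfloor>" for i
      by (simp add: cube_at_def mem_dcube_iff)
    \<comment> \<open>Passing to the parent halves the integer index of a cube, rounding
      down.\<close>
    have half: "\<lfloor>2 powr real_of_int l * z\<rfloor> = \<lfloor>2 powr real_of_int (l+1) * z\<rfloor> div 2" for z :: real
    proof -
      have "2 powr real_of_int l * z = (2 powr real_of_int (l+1) * z) / 2"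
        by (simp only: of_int_add powr_add) simp
      then show ?thesis using floor_divide_real_eq_div[of 2 "2 powr real_of_int (l+1) * z"]
        by (simp only:) simp
    qed
    show "y \<in> cube_at l x" using e by (simp add: cube_at_def mem_dcube_iff half)
  qed
  with step show ?case by blast
qed simp

lemma dcube_nonempty: "dcube k j \<noteq> {}"
proof -
  have "(\<chi> i. real_of_int (j i) / 2 powr real_of_int k) \<in> dcube k j"
    by (simp add: dcube_def)
  then show ?thesis by blast
qed

lemma dlevel_nonempty: "Q \<in> dlevel k \<Longrightarrow> Q \<noteq> {}"
  by (auto simp: dlevel_def dcube_nonempty)

lemma dlevel_obtain: assumes "Q \<in> dlevel k" obtains x where "x \<in> Q" "Q = cube_at k x"
  using dlevel_nonempty[OF assms] dlevel_cube_at[OF assms] by blast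

lemma dcube_measurable: "dcube k j \<in> sets borel"
  unfolding dcube_def by measurable

lemma dlevel_borel: "Q \<in> dlevel k \<Longrightarrow> Q \<in> sets borel"
  by (auto simp: dlevel_def dcube_measurable)

text \<open>The half-open cube is squeezed between an open and a closed box of equal volume.\<close>

lemma emeasure_dcube:
  "emeasure lborel (dcube k j :: (real^'n::finite) set) = ennreal ((2 powr - real_of_int k) ^ CARD('n))"
proof -
  define c where "c = 2 powr real_of_int k"
  have c: "c > 0" by (simp add: c_def)
  define l u :: "real^'n" where "l = (\<chi> i. real_of_int (j i) / c)" and "u = (\<chi> i. (real_of_int (j i) + 1) / c)"
  have lu: "u \<bullet> b - l \<bullet> b = 1 / c" "l \<bullet> b \<le> u \<bullet> b" if "b \<in> Basis" for b
    using that c by (auto simp: Basis_vec_def l_def u_def inner_axis add_divide_distrib)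
  have m: "(\<Prod>b\<in>Basis. (u - l) \<bullet> b) = (2 powr - real_of_int k) ^ CARD('n)"
    using lu by (simp add: inner_diff_left c_def powr_minus divide_inverse)
  have s1: "box l u \<subseteq> dcube k j" using c
    by (auto simp: mem_box_cart l_def u_def dcube_def field_simps c_def[symmetric] less_imp_le)
  have s2: "dcube k j \<subseteq> cbox l u" using c
    by (auto simp: mem_box_cart l_def u_def dcube_def field_simps c_def[symmetric] less_imp_le)
  have "emeasure lborel (dcube k j) \<le> emeasure lborel (cbox l u)"
    by (rule emeasure_mono[OF s2]) simp
  moreover have "emeasure lborel (box l u) \<le> emeasure lborel (dcube k j)"
    by (rule emeasure_mono[OF s1]) (simp add: dcube_measurable)
  moreover have "emeasure lborel (cbox l u) = emeasure lborel (box l u)"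
    using lu by (simp add: emeasure_lborel_box_eq emeasure_lborel_cbox_eq)
  moreover have "emeasure lborel (box l u) = ennreal ((2 powr - real_of_int k) ^ CARD('n))"
    using lu m by (simp add: emeasure_lborel_box_eq)
  ultimately show ?thesis by (metis antisym)
qed

lemma measure_dlevel:
  fixes Q :: "(real^'n::finite) set"
  assumes "Q \<in> dlevel k"
  shows "measure lborel Q = (2 powr - real_of_int k) ^ CARD('n)"
proof -
  have "emeasure lborel Q = ennreal ((2 powr - real_of_int k) ^ CARD('n))"
    using assms emeasure_dcube by (auto simp: dlevel_def)
  then show ?thesis by (simp add: measure_def)
qed

lemma dlevel_fmeasurable:
  fixes Q :: "(real^'n::finite) set"
  assumes "Q \<in> dlevel k"
  shows "Q \<in> fmeasurable lborel"
proof -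
  obtain j where "Q = dcube k j" using assms by (auto simp: dlevel_def)
  then show ?thesis using dlevel_borel[OF assms] by (intro fmeasurableI) (auto simp: emeasure_dcube)
qed

text \<open>The volume determines the side length.\<close>

lemma dlevel_unique:
  fixes Q :: "(real^'n::finite) set"
  assumes "Q \<in> dlevel k" "Q \<in> dlevel l"
  shows "k = l"
proof -
  have "(2 powr - real_of_int k) ^ CARD('n) = (2 powr - real_of_int l) ^ CARD('n)"
    using assms measure_dlevel by metis
  then have "2 powr - real_of_int k = 2 powr - real_of_int l"
    by (subst (asm) power_eq_iff_eq_base) auto
  then show ?thesis by (simp add: powr_inj)
qed

lemma dyadic_iff: "Q \<in> dyadic \<longleftrightarrow> (\<exists>k. Q \<in> dlevel k)"
  by (auto simp: dyadic_def)

lemma cube_at_dyadic: "cube_at k x \<in> dyadic"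
  using cube_at_dlevel dyadic_iff by blast

lemma dyadic_fmeasurable: "Q \<in> dyadic \<Longrightarrow> Q \<in> fmeasurable lborel"
  using dyadic_iff dlevel_fmeasurable by blast

lemma dyadic_borel: "Q \<in> dyadic \<Longrightarrow> Q \<in> sets borel"
  using dyadic_iff dlevel_borel by blast

lemma measure_dyadic_pos:
  fixes Q :: "(real^'n::finite) set"
  shows "Q \<in> dyadic \<Longrightarrow> measure lborel Q > 0"
  using measure_dlevel[of Q] by (auto simp: dyadic_iff)

text \<open>A cube of given level is determined by any of its points, and its lower corner has
  rational coordinates.\<close>

lemma countable_dyadic: "countable (dyadic :: (real^'n::finite) set set)"
proof -
  have "countable (dlevel k :: (real^'n) set set)" for k :: int
  proof -
    have "dlevel k \<subseteq> (\<lambda>x. cube_at k x) ` {x :: real^'n. \<forall>i. x$i \<in> \<rat>}"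
    proof
      fix Q :: "(real^'n) set" assume Q: "Q \<in> dlevel k"
      then obtain j where j: "Q = dcube k j" by (auto simp: dlevel_def)
      \<comment> \<open>An integer power in place of \<open>powr\<close> makes the rationality
        visible.\<close>
      define x :: "real^'n" where "x = (\<chi> i. real_of_int (j i) * 2 powi (- k))"
      have "x \<in> Q" by (simp add: j x_def dcube_def powr_real_of_int' power_int_minus field_simps)
      moreover have "\<forall>i. x$i \<in> \<rat>" by (simp add: x_def power_int_def)
      ultimately show "Q \<in> (\<lambda>x. cube_at k x) ` {x. \<forall>i. x$i \<in> \<rat>}"
        using dlevel_cube_at[OF Q] by blast
    qed
    moreover have "countable {x :: real^'n. \<forall>i. x$i \<in> \<rat>}"
    proof -
      have "countable (PiE (UNIV :: 'n set) (\<lambda>i. \<rat> :: real set))"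
        by (intro countable_PiE) (auto simp: countable_rat)
      then have "countable (vec_lambda ` PiE (UNIV :: 'n set) (\<lambda>i. \<rat> :: real set))" by simp
      moreover have "{x :: real^'n. \<forall>i. x$i \<in> \<rat>} \<subseteq> vec_lambda ` PiE (UNIV :: 'n set) (\<lambda>i. \<rat> :: real set)"
        by (auto intro!: image_eqI[where x = "vec_nth _"])
      ultimately show ?thesis by (meson countable_subset countable_image)
    qed
    ultimately show ?thesis by (meson countable_subset countable_image)
  qed
  then show ?thesis unfolding dyadic_def by auto
qed

lemma Union_dyadic_borel: "G \<subseteq> dyadic \<Longrightarrow> \<Union>G \<in> sets borel"
  using countable_subset[OF _ countable_dyadic] dyadic_borel
  by (metis sets.countable_Union subset_iff)

lemma dlevel_subset_level:
  fixes Q :: "(real^'n::finite) set"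
  assumes "Q \<in> dlevel k" "R \<in> dlevel l" "R \<subseteq> Q" shows "k \<le> l"
proof -
  have "measure lborel R \<le> measure lborel Q"
    using assms dlevel_fmeasurable by (metis fmeasurableD measure_mono_fmeasurable)
  then have "(2 powr - real_of_int l) ^ CARD('n) \<le> (2 powr - real_of_int k) ^ CARD('n)"
    using assms measure_dlevel by metis
  then have "2 powr - real_of_int l \<le> 2 powr - real_of_int k"
    by (subst (asm) power_mono_iff) auto
  then show ?thesis by simp
qed

lemma dyadic_nested:
  assumes "Q \<in> dlevel k" "R \<in> dlevel l" "x \<in> Q" "x \<in> R" "k \<le> l" shows "R \<subseteq> Q"
  using assms dlevel_cube_at cube_at_mono by metis

section \<open>Generations of descendants\<close>

text \<open>The existential over representations of \<open>Q\<close> in \<open>dsub\<close>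
  collapses because the level of a cube is unique.\<close>

lemma dsub_iff:
  fixes Q :: "(real^'n::finite) set"
  assumes "Q \<in> dlevel k"
  shows "R \<in> dsub i Q \<longleftrightarrow> R \<in> dlevel (k + int i) \<and> R \<subseteq> Q"
proof
  assume "R \<in> dsub i Q"
  then obtain k' j where *: "Q = dcube k' j" "R \<in> dlevel (k' + int i)" "R \<subseteq> Q" by (auto simp: dsub_def)
  then have "Q \<in> dlevel k'" by (auto simp: dlevel_def)
  then have "k' = k" using assms dlevel_unique by blast
  then show "R \<in> dlevel (k + int i) \<and> R \<subseteq> Q" using * by auto
next
  assume "R \<in> dlevel (k + int i) \<and> R \<subseteq> Q"
  then show "R \<in> dsub i Q" using assms by (auto simp: dsub_def dlevel_def)
qed

lemma dsub_dyadic: "R \<in> dsub i Q \<Longrightarrow> R \<in> dyadic"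
  by (auto simp: dsub_def dyadic_iff)

lemma dsub_subset: "R \<in> dsub i Q \<Longrightarrow> R \<subseteq> Q"
  by (auto simp: dsub_def)

lemma cube_at_dsub: "cube_at (k + int i) x \<in> dsub i (cube_at k x)"
  by (simp add: dsub_iff[OF cube_at_dlevel] cube_at_dlevel cube_at_mono)

lemma dsub_disjoint:
  fixes Q :: "(real^'n::finite) set"
  assumes "Q \<in> dyadic" "R \<in> dsub i Q" "R' \<in> dsub i Q" "x \<in> R" "x \<in> R'" shows "R = R'"
  using assms by (metis dyadic_iff dsub_iff dlevel_cube_at)

lemma dsub_0: fixes Q :: "(real^'n::finite) set"
  assumes "Q \<in> dyadic" shows "dsub 0 Q = {Q}"
proof -
  obtain k where k: "Q \<in> dlevel k" using assms by (auto simp: dyadic_iff)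
  have "R = Q" if "R \<in> dlevel k" "R \<subseteq> Q" for R
  proof -
    obtain x where "x \<in> R" using dlevel_nonempty \<open>R \<in> dlevel k\<close> by blast
    then show ?thesis using that k dlevel_cube_at by (metis subsetD)
  qed
  then have "R \<in> dsub 0 Q \<longleftrightarrow> R = Q" for R using k dsub_iff[OF k, of R 0] by auto
  then show ?thesis by blast
qed

lemma Union_dsub: fixes Q :: "(real^'n::finite) set"
  assumes "Q \<in> dyadic" shows "\<Union>(dsub i Q) = Q"
proof -
  obtain k where k: "Q \<in> dlevel k" using assms by (auto simp: dyadic_iff)
  have "x \<in> \<Union>(dsub i Q)" if "x \<in> Q" for x
    using cube_at_dsub[of k i x] mem_cube_at[of x] dlevel_cube_at[OF k that] by auto
  then show ?thesis using dsub_subset by blast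
qed

lemma measure_dsub: fixes Q :: "(real^'n::finite) set"
  assumes "Q \<in> dyadic" "R \<in> dsub i Q"
  shows "measure lborel Q = (2 ^ CARD('n)) ^ i * measure lborel R"
proof -
  obtain k where k: "Q \<in> dlevel k" using assms by (auto simp: dyadic_iff)
  have e: "2 powr - real_of_int k = 2 ^ i * 2 powr - real_of_int (k + int i)"
    by (simp add: powr_realpow[symmetric] powr_add[symmetric])
  have "R \<in> dlevel (k + int i)" using assms(2) dsub_iff[OF k] by blast
  then have R: "measure lborel R = (2 powr - real_of_int (k + int i)) ^ CARD('n)" by (rule measure_dlevel)
  have "measure lborel Q = (2 ^ i * 2 powr - real_of_int (k + int i)) ^ CARD('n)"
    unfolding measure_dlevel[OF k] by (simp only: e)
  then show ?thesis unfolding R by (simp only: power_mult_distrib flip: power_mult) (simp only: mult.commute)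
qed

text \<open>Counting by volume: descendants of one generation are disjoint, have equal volume and
  fill \<open>Q\<close>. The bound is proved for finite subfamilies, which gives finiteness of the
  whole generation.\<close>

lemma finite_card_dsub: fixes Q :: "(real^'n::finite) set"
  assumes "Q \<in> dyadic"
  shows "finite (dsub i Q)" "card (dsub i Q) = (2 ^ CARD('n)) ^ i"
proof -
  have fm: "R \<in> fmeasurable lborel" if "R \<in> dsub i Q" for R
    using that dsub_dyadic dyadic_fmeasurable by blast
  have sum: "measure lborel (\<Union>F) * (2 ^ CARD('n)) ^ i = card F * measure lborel Q" if F: "F \<subseteq> dsub i Q" "finite F" for F
  proof -
    have "measure lborel (\<Union>F) = (\<Sum>R\<in>F. measure lborel R)"
    proof (rule measure_Union')
      show "pairwise disjnt F" using F assms dsub_disjoint unfolding pairwise_def disjnt_def by blast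
    qed (use F fm in auto)
    also have "\<dots> * (2 ^ CARD('n)) ^ i = (\<Sum>R\<in>F. measure lborel Q)"
      unfolding sum_distrib_right using F measure_dsub[OF assms] by (intro sum.cong) (auto simp: mult.commute)
    finally show ?thesis by simp
  qed
  have pos: "measure lborel Q > 0" using assms measure_dyadic_pos by blast
  have bd: "card F \<le> (2 ^ CARD('n)) ^ i" if F: "F \<subseteq> dsub i Q" "finite F" for F
  proof -
    have "measure lborel (\<Union>F) \<le> measure lborel Q"
    proof (rule measure_mono_fmeasurable)
      show "\<Union>F \<in> sets lborel" using F fmeasurableD[OF fm] by (intro sets.finite_Union) auto
    qed (use F dsub_subset assms dyadic_fmeasurable in blast)+
    then have "card F * measure lborel Q \<le> (2 ^ CARD('n)) ^ i * measure lborel Q"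
      unfolding sum[OF F, symmetric] by (simp add: mult.commute)
    then have "real (card F) \<le> (2 ^ CARD('n)) ^ i" using pos by simp
    then show ?thesis by (metis of_nat_le_iff of_nat_numeral of_nat_power)
  qed
  show fin: "finite (dsub i Q)" using bd finite_if_finite_subsets_card_bdd by blast
  have "measure lborel Q * (2 ^ CARD('n)) ^ i = card (dsub i Q) * measure lborel Q"
    using sum[OF subset_refl fin] Union_dsub[OF assms] by simp
  then have "(2 ^ CARD('n)) ^ i = real (card (dsub i Q))" using pos by simp
  then show "card (dsub i Q) = (2 ^ CARD('n)) ^ i" by (metis of_nat_eq_iff of_nat_numeral of_nat_power)
qed

lemma measure_sum_dsub: fixes Q :: "(real^'n::finite) set"
  assumes "Q \<in> dyadic" "X \<in> sets borel"
  shows "(\<Sum>R\<in>dsub i Q. measure lborel (R \<inter> X)) = measure lborel (Q \<inter> X)"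
proof -
  have "Q \<inter> X = \<Union>((\<lambda>R. R \<inter> X) ` dsub i Q)" using Union_dsub[OF assms(1), of i] by blast
  moreover have "measure lborel (\<Union>((\<lambda>R. R \<inter> X) ` dsub i Q)) = (\<Sum>R\<in>dsub i Q. measure lborel (R \<inter> X))"
  proof (rule measure_UNION')
    show "pairwise (\<lambda>A B. disjnt (A \<inter> X) (B \<inter> X)) (dsub i Q)"
      using assms dsub_disjoint unfolding pairwise_def disjnt_def by blast
    show "R \<inter> X \<in> fmeasurable lborel" if "R \<in> dsub i Q" for R
      using fmeasurable_Int_fmeasurable[OF dyadic_fmeasurable[OF dsub_dyadic[OF that]]] assms(2) by simp
  qed (use assms finite_card_dsub in auto)
  ultimately show ?thesis by simp
qed

lemma dsub_dsub: fixes Q :: "(real^'n::finite) set"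
  assumes "Q \<in> dyadic"
  shows "R \<in> dsub (i + j) Q \<longleftrightarrow> (\<exists>P\<in>dsub i Q. R \<in> dsub j P)"
proof -
  obtain k where k: "Q \<in> dlevel k" using assms by (auto simp: dyadic_iff)
  show ?thesis
  proof
    assume R: "R \<in> dsub (i + j) Q"
    then obtain x where x: "x \<in> R" "R = cube_at (k + int (i + j)) x"
      using dlevel_obtain k dsub_iff by metis
    then have "Q = cube_at k x" using R k dlevel_cube_at dsub_subset by blast
    then have "cube_at (k + int i) x \<in> dsub i Q" "R \<in> dsub j (cube_at (k + int i) x)"
      using cube_at_dsub[of k i x] cube_at_dsub[of "k + int i" j x] x by (auto simp: add.assoc)
    then show "\<exists>P\<in>dsub i Q. R \<in> dsub j P" by blast
  next
    assume "\<exists>P\<in>dsub i Q. R \<in> dsub j P"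
    then obtain P where P: "P \<in> dsub i Q" "R \<in> dsub j P" by blast
    then have "P \<in> dlevel (k + int i)" using k dsub_iff by blast
    then have "R \<in> dlevel (k + int i + int j)" "R \<subseteq> Q" using P dsub_iff dsub_subset by blast+
    then show "R \<in> dsub (i + j) Q" using k dsub_iff by (simp add: add.assoc dsub_iff)
  qed
qed

lemma sum_dsub_add: fixes Q :: "(real^'n::finite) set" and g :: "_ \<Rightarrow> real"
  assumes "Q \<in> dyadic"
  shows "(\<Sum>R\<in>dsub (i + j) Q. g R) = (\<Sum>P\<in>dsub i Q. \<Sum>R\<in>dsub j P. g R)"
proof -
  have "dsub (i + j) Q = (\<Union>P\<in>dsub i Q. dsub j P)" using dsub_dsub[OF assms] by blast
  moreover have "sum g (\<Union>P\<in>dsub i Q. dsub j P) = (\<Sum>P\<in>dsub i Q. \<Sum>R\<in>dsub j P. g R)"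
  proof (rule sum.UNION_disjoint)
    show "\<forall>P\<in>dsub i Q. \<forall>P'\<in>dsub i Q. P \<noteq> P' \<longrightarrow> dsub j P \<inter> dsub j P' = {}"
    proof (intro ballI impI)
      fix P P' assume P: "P \<in> dsub i Q" "P' \<in> dsub i Q" "P \<noteq> P'"
      show "dsub j P \<inter> dsub j P' = {}"
      proof (rule ccontr)
        assume "dsub j P \<inter> dsub j P' \<noteq> {}"
        then obtain R where R: "R \<in> dsub j P" "R \<in> dsub j P'" by blast
        then obtain x where "x \<in> R" using dsub_dyadic dyadic_iff dlevel_nonempty by (metis ex_in_conv)
        then show False using R P dsub_subset dsub_disjoint[OF assms] by (metis subsetD)
      qed
    qed
  qed (use assms finite_card_dsub dsub_dyadic in blast)+
  ultimately show ?thesis by simp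
qed

lemma dsub_of_subset: fixes Q :: "(real^'n::finite) set"
  assumes "Q \<in> dyadic" "R \<in> dyadic" "R \<subseteq> Q" shows "\<exists>i. R \<in> dsub i Q"
proof -
  obtain k l where kl: "Q \<in> dlevel k" "R \<in> dlevel l" using assms by (auto simp: dyadic_iff)
  then have "k \<le> l" using assms dlevel_subset_level by blast
  then have "R \<in> dsub (nat (l - k)) Q" using kl assms by (simp add: dsub_iff)
  then show ?thesis by blast
qed

section \<open>Martingales on the dyadic tree\<close>

text \<open>A martingale is encoded by its constant values on cubes. Siblings have equal volume, so
  the mean value property is an unweighted sum.\<close>

definition cmart :: "((real^'n::finite) set \<Rightarrow> real) \<Rightarrow> bool" where
  "cmart F \<longleftrightarrow> (\<forall>Q\<in>dyadic. (\<Sum>R\<in>dsub 1 Q. F R - F Q) = 0)"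

text \<open>The squared L^2 norm of the martingale difference from \<open>Q\<close> to its
  children.\<close>

definition energy :: "((real^'n::finite) set \<Rightarrow> real) \<Rightarrow> (real^'n) set \<Rightarrow> real" where
  "energy F Q = (\<Sum>R\<in>dsub 1 Q. measure lborel R * (F R - F Q)\<^sup>2)"

lemma energy_nonneg: "energy F Q \<ge> 0"
  unfolding energy_def by (intro sum_nonneg) auto

lemma sum_measure_dsub: fixes Q :: "(real^'n::finite) set"
  assumes "Q \<in> dyadic"
  shows "(\<Sum>R\<in>dsub i Q. measure lborel R) = measure lborel Q"
  using measure_sum_dsub[OF assms, of UNIV i] by simp

lemma pythagoras: fixes Q :: "(real^'n::finite) set"
  assumes "cmart F" "Q \<in> dyadic"
  shows "(\<Sum>R\<in>dsub 1 Q. measure lborel R * (F R)\<^sup>2) = measure lborel Q * (F Q)\<^sup>2 + energy F Q"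
proof -
  have mR: "measure lborel R = measure lborel Q / 2 ^ CARD('n)" if "R \<in> dsub 1 Q" for R
    using measure_dsub[OF assms(2) that] by simp
  \<comment> \<open>Orthogonality to constants: equal volumes allow weights to be put into the
    cancellation of \<open>cmart\<close>.\<close>
  have z: "(\<Sum>R\<in>dsub 1 Q. measure lborel R * (F R - F Q)) = 0"
  proof -
    have "(\<Sum>R\<in>dsub 1 Q. measure lborel R * (F R - F Q)) = (\<Sum>R\<in>dsub 1 Q. measure lborel Q / 2 ^ CARD('n) * (F R - F Q))"
      using mR by (intro sum.cong) auto
    also have "\<dots> = 0" using assms unfolding sum_distrib_left[symmetric] cmart_def by simp
    finally show ?thesis .
  qed
  have "(\<Sum>R\<in>dsub 1 Q. measure lborel R * (F R)\<^sup>2)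
      = (\<Sum>R\<in>dsub 1 Q. measure lborel R * (F R - F Q)\<^sup>2 + 2 * F Q * (measure lborel R * (F R - F Q)) + (F Q)\<^sup>2 * measure lborel R)"
    by (intro sum.cong) (auto simp: power2_eq_square algebra_simps)
  also have "\<dots> = energy F Q + 2 * F Q * 0 + (F Q)\<^sup>2 * measure lborel Q"
    unfolding sum.distrib sum_distrib_left[symmetric] z sum_measure_dsub[OF assms(2)] energy_def ..
  finally show ?thesis by simp
qed

lemma sum_sq_cmart: fixes Q :: "(real^'n::finite) set"
  assumes "cmart F" "Q \<in> dyadic"
  shows "(\<Sum>R\<in>dsub n Q. measure lborel R * (F R)\<^sup>2)
       = measure lborel Q * (F Q)\<^sup>2 + (\<Sum>i<n. \<Sum>P\<in>dsub i Q. energy F P)"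
proof (induction n)
  case 0
  then show ?case using dsub_0[OF assms(2)] by simp
next
  case (Suc n)
  have "(\<Sum>R\<in>dsub (n + 1) Q. measure lborel R * (F R)\<^sup>2)
      = (\<Sum>P\<in>dsub n Q. measure lborel P * (F P)\<^sup>2 + energy F P)"
    unfolding sum_dsub_add[OF assms(2)] using pythagoras[OF assms(1)] dsub_dyadic by (intro sum.cong) auto
  then show ?case using Suc by (simp add: sum.distrib)
qed

text \<open>Induction on the depth replaces the selection of maximal cubes: either \<open>Q\<close> itself lies in
  \<open>G\<close>, or the superadditive bound \<open>\<phi>\<close> is applied to the children of \<open>Q\<close>.\<close>

lemma tree_maximal:
  fixes G :: "(real^'n::finite) set set"
  assumes G: "G \<subseteq> dyadic"
    and ge: "\<And>n R. R \<in> G \<Longrightarrow> measure lborel R \<le> \<phi> n R"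
    and nonneg: "\<And>n R. R \<in> dyadic \<Longrightarrow> 0 \<le> \<phi> n R"
    and step: "\<And>n R. R \<in> dyadic \<Longrightarrow> (\<Sum>P\<in>dsub 1 R. \<phi> n P) \<le> \<phi> (Suc n) R"
    and Q: "Q \<in> dyadic"
  shows "measure lborel (\<Union>{R\<in>G. \<exists>i\<le>n. R \<in> dsub i Q}) \<le> \<phi> n Q"
  using Q
proof (induction n arbitrary: Q)
  have bor: "\<Union>{R\<in>G. \<exists>i\<le>n. R \<in> dsub i Q} \<in> sets lborel" for n and Q :: "(real^'n) set"
    unfolding sets_lborel by (intro Union_dyadic_borel) (use G in auto)
  have big: "measure lborel (\<Union>{R\<in>G. \<exists>i\<le>n. R \<in> dsub i Q}) \<le> \<phi> n Q" if "Q \<in> G" for n Q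
  proof -
    have "measure lborel (\<Union>{R\<in>G. \<exists>i\<le>n. R \<in> dsub i Q}) \<le> measure lborel Q"
    proof (rule measure_mono_fmeasurable[OF _ bor])
      show "Q \<in> fmeasurable lborel" using that G dyadic_fmeasurable by blast
    qed (use dsub_subset in blast)
    then show ?thesis using ge[OF that, of n] by linarith
  qed
  case 0
  show ?case
  proof (cases "Q \<in> G")
    case False
    then have "{R\<in>G. \<exists>i\<le>0. R \<in> dsub i Q} = {}" using dsub_0[OF 0] by auto
    then show ?thesis using nonneg[OF 0] by (simp only:) simp
  qed (use big in blast)
  case (Suc n)
  show ?case
  proof (cases "Q \<in> G")
    case False
    have "\<Union>{R\<in>G. \<exists>i\<le>Suc n. R \<in> dsub i Q} \<subseteq> (\<Union>P\<in>dsub 1 Q. \<Union>{R\<in>G. \<exists>i\<le>n. R \<in> dsub i P})"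
    proof
      fix x assume "x \<in> \<Union>{R\<in>G. \<exists>i\<le>Suc n. R \<in> dsub i Q}"
      then obtain R i where R: "x \<in> R" "R \<in> G" "i \<le> Suc n" "R \<in> dsub i Q" by blast
      with False obtain j where "i = 1 + j" using dsub_0[OF Suc.prems] by (cases i) auto
      then obtain P where "P \<in> dsub 1 Q" "R \<in> dsub j P" using dsub_dsub[OF Suc.prems] R by blast
      then show "x \<in> (\<Union>P\<in>dsub 1 Q. \<Union>{R\<in>G. \<exists>i\<le>n. R \<in> dsub i P})"
        using R \<open>i = 1 + j\<close> by auto
    qed
    then have "measure lborel (\<Union>{R\<in>G. \<exists>i\<le>Suc n. R \<in> dsub i Q})
        \<le> measure lborel (\<Union>P\<in>dsub 1 Q. \<Union>{R\<in>G. \<exists>i\<le>n. R \<in> dsub i P})"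
    proof (rule measure_mono_fmeasurable[OF _ bor])
      have "(\<Union>P\<in>dsub 1 Q. \<Union>{R\<in>G. \<exists>i\<le>n. R \<in> dsub i P}) \<in> sets lborel"
        using bor finite_card_dsub[OF Suc.prems] by (intro sets.finite_UN) auto
      moreover have "(\<Union>P\<in>dsub 1 Q. \<Union>{R\<in>G. \<exists>i\<le>n. R \<in> dsub i P}) \<subseteq> Q"
        using dsub_subset by blast
      ultimately show "(\<Union>P\<in>dsub 1 Q. \<Union>{R\<in>G. \<exists>i\<le>n. R \<in> dsub i P}) \<in> fmeasurable lborel"
        using dyadic_fmeasurable[OF Suc.prems] fmeasurableI2 by blast
    qed
    also have "\<dots> \<le> (\<Sum>P\<in>dsub 1 Q. measure lborel (\<Union>{R\<in>G. \<exists>i\<le>n. R \<in> dsub i P}))"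
      using bor finite_card_dsub[OF Suc.prems] by (intro measure_UNION_le) auto
    also have "\<dots> \<le> (\<Sum>P\<in>dsub 1 Q. \<phi> n P)"
      using Suc.IH dsub_dyadic by (intro sum_mono) blast
    also have "\<dots> \<le> \<phi> (Suc n) Q" by (rule step[OF Suc.prems])
    finally show ?thesis .
  qed (use big in blast)
qed

text \<open>Every dyadic subcube of \<open>Q\<close> has finite depth, so a bound uniform in the
  depth passes to the full union by continuity of measure along increasing sets.\<close>

lemma tree_maximal_limit:
  fixes G :: "(real^'n::finite) set set"
  assumes G: "G \<subseteq> dyadic"
    and ge: "\<And>n R. R \<in> G \<Longrightarrow> measure lborel R \<le> \<phi> n R"
    and nonneg: "\<And>n R. R \<in> dyadic \<Longrightarrow> 0 \<le> \<phi> n R"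
    and step: "\<And>n R. R \<in> dyadic \<Longrightarrow> (\<Sum>P\<in>dsub 1 R. \<phi> n P) \<le> \<phi> (Suc n) R"
    and Q: "Q \<in> dyadic" and c: "\<And>n. \<phi> n Q \<le> c"
  shows "measure lborel (\<Union>{R\<in>G. R \<subseteq> Q}) \<le> c"
proof -
  define A where "A n = \<Union>{R\<in>G. \<exists>i\<le>n. R \<in> dsub i Q}" for n
  have e: "(\<Union>n. A n) = \<Union>{R\<in>G. R \<subseteq> Q}"
    using dsub_of_subset[OF Q] dsub_subset G unfolding A_def by fast
  have bor: "\<Union>{R\<in>G. R \<subseteq> Q} \<in> sets lborel"
    unfolding sets_lborel by (intro Union_dyadic_borel) (use G in auto)
  have "\<Union>{R\<in>G. R \<subseteq> Q} \<in> fmeasurable lborel"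
    by (rule fmeasurableI2[OF dyadic_fmeasurable[OF Q] _ bor]) blast
  then have fin: "emeasure lborel (\<Union>n. A n) \<noteq> \<infinity>" unfolding e by (auto simp: fmeasurable_def)
  have "A n \<in> sets lborel" for n
    unfolding sets_lborel A_def by (intro Union_dyadic_borel) (use G in auto)
  moreover have "incseq A" unfolding A_def
    by (intro incseq_SucI Union_mono Collect_mono) (meson le_SucI)
  ultimately have "(\<lambda>n. measure lborel (A n)) \<longlonglongrightarrow> measure lborel (\<Union>n. A n)"
    using fin by (intro Lim_measure_incseq) auto
  moreover have "measure lborel (A n) \<le> c" for n
  proof -
    have "measure lborel (A n) \<le> \<phi> n Q" unfolding A_def by (rule tree_maximal) (fact G ge nonneg step Q)+
    then show ?thesis using c[of n] by linarith
  qed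
  ultimately show ?thesis unfolding e by (intro LIMSEQ_le_const2) auto
qed

text \<open>The weak type bound for cubes in which \<Omega> has a fixed relative density. The
  potential \<open>c * measure lborel (R \<inter> \<Omega>)\<close> is additive over
  children.\<close>

lemma dyadic_weak_type:
  fixes G :: "(real^'n::finite) set set"
  assumes "G \<subseteq> dyadic" "Q \<in> dyadic" "\<Omega> \<in> sets borel" "0 \<le> c"
    and "\<And>R. R \<in> G \<Longrightarrow> measure lborel R \<le> c * measure lborel (R \<inter> \<Omega>)"
  shows "measure lborel (\<Union>{R\<in>G. R \<subseteq> Q}) \<le> c * measure lborel (Q \<inter> \<Omega>)"
proof (rule tree_maximal_limit[where \<phi> = "\<lambda>n R. c * measure lborel (R \<inter> \<Omega>)"])
  fix R :: "(real^'n) set" assume "R \<in> dyadic"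
  then show "(\<Sum>P\<in>dsub 1 R. c * measure lborel (P \<inter> \<Omega>)) \<le> c * measure lborel (R \<inter> \<Omega>)"
    using measure_sum_dsub[OF _ assms(3)] by (simp only: sum_distrib_left[symmetric] order_refl)
qed (use assms in auto)

text \<open>The potential at depth \<open>n\<close> is the second moment of \<open>a\<close> on the
  \<open>n\<close>-th generation below \<open>R\<close>, divided by \<open>K\<^sup>2\<close>. By
  orthogonality it is at least its value at depth zero, hence at least the volume of
  \<open>R\<close> when \<open>a\<close> exceeds \<open>K\<close> there.\<close>

lemma kolmogorov:
  fixes a :: "(real^'n::finite) set \<Rightarrow> real"
  assumes a: "cmart a" and Q: "Q \<in> dyadic" and K: "K > 0"
    and M: "\<And>n. (\<Sum>R\<in>dsub n Q. measure lborel R * (a R)\<^sup>2) \<le> M"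
  shows "measure lborel (\<Union>{R\<in>dyadic. \<bar>a R\<bar> > K \<and> R \<subseteq> Q}) \<le> M / K\<^sup>2"
proof -
  define \<phi> where "\<phi> n R = (\<Sum>P\<in>dsub n R. measure lborel P * (a P)\<^sup>2) / K\<^sup>2" for n R
  have "measure lborel (\<Union>{R\<in>{R\<in>dyadic. \<bar>a R\<bar> > K}. R \<subseteq> Q}) \<le> M / K\<^sup>2"
  proof (rule tree_maximal_limit[where \<phi> = \<phi>])
    fix n and R :: "(real^'n) set" assume R: "R \<in> {R\<in>dyadic. \<bar>a R\<bar> > K}"
    have "measure lborel R * K\<^sup>2 \<le> measure lborel R * (a R)\<^sup>2"
      using R K power_mono[of K "\<bar>a R\<bar>" 2] by (intro mult_left_mono) auto
    also have "\<dots> \<le> (\<Sum>P\<in>dsub n R. measure lborel P * (a P)\<^sup>2)"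
      using R sum_sq_cmart[OF a, of R n] by (auto intro!: sum_nonneg energy_nonneg)
    finally show "measure lborel R \<le> \<phi> n R" using K by (simp add: \<phi>_def pos_le_divide_eq)
  next
    fix n and R :: "(real^'n) set" assume R: "R \<in> dyadic"
    show "(\<Sum>P\<in>dsub 1 R. \<phi> n P) \<le> \<phi> (Suc n) R"
      using sum_dsub_add[OF R, of "\<lambda>P. measure lborel P * (a P)\<^sup>2" 1 n]
      by (simp add: \<phi>_def sum_divide_distrib)
  qed (use Q M K in \<open>auto simp: \<phi>_def divide_right_mono intro!: sum_nonneg divide_nonneg_nonneg\<close>)
  moreover have "{R\<in>{R\<in>dyadic. \<bar>a R\<bar> > K}. R \<subseteq> Q} = {R\<in>dyadic. \<bar>a R\<bar> > K \<and> R \<subseteq> Q}" by auto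
  ultimately show ?thesis by simp
qed

text \<open>The right-hand side is the potential of the depth induction: by \<open>pythagoras\<close> it decreases by
  \<open>energy F Q\<close> when passing from \<open>Q\<close> to its children.\<close>

lemma energy_stopped:
  fixes F :: "(real^'n::finite) set \<Rightarrow> real"
  assumes F: "cmart F" and \<mu>: "0 \<le> \<mu>"
    and anc: "\<And>T P. T \<in> G \<Longrightarrow> P \<in> dyadic \<Longrightarrow> T \<subseteq> P \<Longrightarrow> P \<subseteq> Q0 \<Longrightarrow> P \<in> G"
    and bd: "\<And>T R. T \<in> G \<Longrightarrow> R \<in> dsub 1 T \<Longrightarrow> \<bar>F R\<bar> \<le> \<mu>"
    and Q: "Q \<in> dyadic" "Q \<subseteq> Q0" "\<bar>F Q\<bar> \<le> \<mu>"
  shows "(\<Sum>i<n. \<Sum>P\<in>dsub i Q. if P \<in> G then energy F P else 0) \<le> measure lborel Q * (\<mu>\<^sup>2 - (F Q)\<^sup>2)"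
  using Q
proof (induction n arbitrary: Q)
  have base: "0 \<le> measure lborel Q * (\<mu>\<^sup>2 - (F Q)\<^sup>2)" if "\<bar>F Q\<bar> \<le> \<mu>" for Q
    using power_mono[OF that, of 2] by simp
  case 0
  then show ?case using base by simp
  case (Suc n)
  show ?case
  proof (cases "Q \<in> G")
    case True
    have "(\<Sum>i<Suc n. \<Sum>P\<in>dsub i Q. if P \<in> G then energy F P else 0)
        = energy F Q + (\<Sum>i<n. \<Sum>P\<in>dsub (1 + i) Q. if P \<in> G then energy F P else 0)"
      using True dsub_0[OF Suc.prems(1)] unfolding sum.lessThan_Suc_shift by simp
    also have "(\<Sum>i<n. \<Sum>P\<in>dsub (1 + i) Q. if P \<in> G then energy F P else 0)
       = (\<Sum>R\<in>dsub 1 Q. \<Sum>i<n. \<Sum>P\<in>dsub i R. if P \<in> G then energy F P else 0)"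
      unfolding sum_dsub_add[OF Suc.prems(1)] by (rule sum.swap)
    \<comment> \<open>\<open>bd\<close> controls \<open>F\<close> on the children of a cube of
      \<open>G\<close> even if they lie outside \<open>G\<close>, so the induction hypothesis
      applies to all of them.\<close>
    also have "\<dots> \<le> (\<Sum>R\<in>dsub 1 Q. measure lborel R * (\<mu>\<^sup>2 - (F R)\<^sup>2))"
      using bd[OF True] Suc.prems dsub_dyadic dsub_subset by (intro sum_mono Suc.IH) blast+
    also have "\<dots> = \<mu>\<^sup>2 * measure lborel Q - (measure lborel Q * (F Q)\<^sup>2 + energy F Q)"
      unfolding pythagoras[OF F Suc.prems(1), symmetric]
      unfolding sum_measure_dsub[OF Suc.prems(1), of 1, symmetric]
        sum_distrib_left sum_subtractf[symmetric] by (intro sum.cong) (auto simp: algebra_simps)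
    finally show ?thesis by (simp add: algebra_simps)
  next
    case False
    \<comment> \<open>Upward closure: if \<open>Q\<close> is outside \<open>G\<close>, so is
      everything below it, and the left-hand side vanishes.\<close>
    have "(if P \<in> G then energy F P else 0) = 0" if "P \<in> dsub i Q" for P i
      using anc False Suc.prems dsub_subset[OF that] by auto
    then show ?thesis using base[OF Suc.prems(3)] by simp
  qed
qed

text \<open>Both are meaningful for dyadic cubes only.\<close>

definition lev :: "(real^'n::finite) set \<Rightarrow> int" where "lev Q = (THE k. Q \<in> dlevel k)"
definition pt :: "(real^'n::finite) set \<Rightarrow> real^'n" where "pt Q = (SOME x. x \<in> Q)"

lemma lev_eq: "Q \<in> dlevel k \<Longrightarrow> lev Q = k"
  unfolding lev_def using dlevel_unique by blast

lemma lev_cube_at: "lev (cube_at k x) = k"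
  using lev_eq cube_at_dlevel by blast

lemma pt_in: "Q \<in> dlevel k \<Longrightarrow> pt Q \<in> Q"
  unfolding pt_def using dlevel_nonempty some_in_eq by blast

lemma cube_at_pt: "k \<le> n \<Longrightarrow> cube_at k (pt (cube_at n x)) = cube_at k x"
  using pt_in[OF cube_at_dlevel, of n x] cube_at_mono[of k n x] cube_at_eqI by blast

text \<open>The martingale with increments \<open>b\<close> that starts from zero at level
  \<open>l\<close>: the sum along the branch that ends in \<open>R\<close>. At levels up to
  \<open>l\<close> the index set is empty and the value is 0.\<close>

definition asum :: "((real^'n::finite) set \<Rightarrow> real) \<Rightarrow> int \<Rightarrow> (real^'n) set \<Rightarrow> real" where
  "asum b l R = (\<Sum>k\<in>{l<..lev R}. b (cube_at k (pt R)))"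

lemma asum_cube_at: "asum b l (cube_at n x) = (\<Sum>k\<in>{l<..n}. b (cube_at k x))"
  unfolding asum_def lev_cube_at by (intro sum.cong) (auto simp: cube_at_pt)

lemma asum_child:
  fixes P :: "(real^'n::finite) set"
  assumes P: "P \<in> dlevel n" and R: "R \<in> dsub 1 P"
  shows "asum b l R = asum b l P + (if l \<le> n then b R else 0)"
proof -
  have Rl: "R \<in> dlevel (n + 1)" "R \<subseteq> P" using assms by (auto simp: dsub_iff)
  obtain x where x: "x \<in> R" "R = cube_at (n + 1) x" using dlevel_obtain[OF Rl(1)] by blast
  have Px: "P = cube_at n x" using dlevel_cube_at[OF P] x Rl by blast
  have "{l<..n + 1} = (if l \<le> n then insert (n + 1) {l<..n} else {})" "\<not> l \<le> n \<Longrightarrow> {l<..n} = {}" by auto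
  then show ?thesis using x Px by (auto simp: asum_cube_at)
qed

lemma cmart_asum:
  fixes b :: "(real^'n::finite) set \<Rightarrow> real"
  assumes "\<And>Q. Q \<in> dyadic \<Longrightarrow> (\<Sum>R\<in>dsub 1 Q. b R) = 0"
  shows "cmart (asum b l)"
  unfolding cmart_def
proof
  fix Q :: "(real^'n) set" assume Q: "Q \<in> dyadic"
  then obtain n where n: "Q \<in> dlevel n" by (auto simp: dyadic_iff)
  show "(\<Sum>R\<in>dsub 1 Q. asum b l R - asum b l Q) = 0"
    using asum_child[OF n, of _ b l] assms[OF Q] by (cases "l \<le> n") auto
qed

lemma energy_asum:
  fixes P :: "(real^'n::finite) set"
  assumes P: "P \<in> dlevel n"
  shows "energy (asum b l) P = (if l \<le> n then \<Sum>R\<in>dsub 1 P. measure lborel R * (b R)\<^sup>2 else 0)"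
  unfolding energy_def using asum_child[OF P, of _ b l] by auto

section \<open>Averages and percentiles\<close>

text \<open>Boundedness of the averages makes the real-valued supremum a genuine one, so exceeding
  \<open>c\<close> strictly is witnessed by a single cube.\<close>

lemma superlevel_local_max:
  assumes B: "\<And>R. R \<in> dyadic \<Longrightarrow> \<bar>avg f R\<bar> \<le> B" and Q: "Q \<in> dyadic"
  shows "{x\<in>Q. local_max Q f x > c} = \<Union>{R\<in>dyadic. \<bar>avg f R\<bar> > c \<and> R \<subseteq> Q}"
proof -
  have iff: "c < local_max Q f x \<longleftrightarrow> (\<exists>R\<in>{R\<in>dcubes_in Q. x \<in> R}. c < \<bar>avg f R\<bar>)" if "x \<in> Q" for x
    unfolding local_max_def
  proof (rule less_cSUP_iff)
    show "{R \<in> dcubes_in Q. x \<in> R} \<noteq> {}" using that Q by (auto simp: dcubes_in_def)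
    show "bdd_above ((\<lambda>R. \<bar>avg f R\<bar>) ` {R \<in> dcubes_in Q. x \<in> R})"
      using B by (auto simp: dcubes_in_def intro!: bdd_aboveI2)
  qed
  show ?thesis using iff by (auto simp: dcubes_in_def)
qed

text \<open>The infimum that defines the percentile is attained: the superlevel sets at
  \<open>l + 1 / real (Suc n)\<close> increase to the one at \<open>l\<close>, and measure is
  continuous from below.\<close>

lemma measure_superlevel_Pr:
  fixes Q :: "(real^'n::finite) set"
  assumes B: "\<And>R. R \<in> dyadic \<Longrightarrow> \<bar>avg f R\<bar> \<le> B" and Q: "Q \<in> dyadic" and r: "0 < r" "r < 1"
  shows "measure lborel (\<Union>{R\<in>dyadic. \<bar>avg f R\<bar> > Pr r Q (local_max Q f) \<and> R \<subseteq> Q}) \<le> r * measure lborel Q"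
proof -
  define U where "U c = \<Union>{R\<in>dyadic. \<bar>avg f R\<bar> > c \<and> R \<subseteq> Q}" for c
  define X where "X = {c. measure lborel (U c) \<le> r * measure lborel Q}"
  define l where "l = Pr r Q (local_max Q f)"
  have "{x\<in>Q. local_max Q f x > c} = U c" for c
    unfolding U_def by (rule superlevel_local_max) (use B Q in auto)
  then have l: "l = Inf X" by (simp only: l_def Pr_def X_def)
  have bor: "U c \<in> sets lborel" for c
    unfolding U_def sets_lborel by (rule Union_dyadic_borel) auto
  have fm: "U c \<in> fmeasurable lborel" for c
    by (rule fmeasurableI2[OF dyadic_fmeasurable[OF Q] _ bor]) (auto simp: U_def)
  have anti: "measure lborel (U d) \<le> measure lborel (U c)" if "c \<le> d" for c d
  proof (rule measure_mono_fmeasurable[OF _ bor fm])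
    show "U d \<subseteq> U c" unfolding U_def using that by fastforce
  qed
  have pos: "measure lborel Q > 0" using Q measure_dyadic_pos by blast
  have "{R\<in>dyadic. \<bar>avg f R\<bar> > B \<and> R \<subseteq> Q} = {}" using B by force
  then have "U B = {}" unfolding U_def by (simp only:) simp
  then have ne: "B \<in> X" unfolding X_def using r pos by simp
  have bdd: "bdd_below X"
  proof (rule bdd_belowI)
    fix c assume c: "c \<in> X"
    show "0 \<le> c"
    proof (rule ccontr)
      assume "\<not> 0 \<le> c"
      \<comment> \<open>At a negative level \<open>Q\<close> itself is among the cubes, so the
        superlevel set is all of \<open>Q\<close>, which \<open>r < 1\<close> excludes.\<close>
      then have "U c = Q" unfolding U_def using Q by (auto intro: order_less_le_trans[OF _ abs_ge_zero])
      then show False using c r pos by (simp add: X_def)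
    qed
  qed
  have le: "measure lborel (U c) \<le> r * measure lborel Q" if lc: "l < c" for c
  proof -
    obtain d where "d \<in> X" "d < c" using lc cInf_less_iff[of X c] ne bdd unfolding l by (metis empty_iff)
    then show ?thesis using anti[of d c] by (simp add: X_def)
  qed
  define A where "A n = U (l + 1 / real (Suc n))" for n
  have inc: "incseq A"
  proof (rule incseq_SucI)
    fix n
    have "1 / real (Suc (Suc n)) \<le> 1 / real (Suc n)" by (simp add: field_simps)
    then show "A n \<subseteq> A (Suc n)" unfolding A_def U_def by fastforce
  qed
  have un: "(\<Union>n. A n) = U l"
  proof
    show "(\<Union>n. A n) \<subseteq> U l"
    proof
      fix x assume "x \<in> (\<Union>n. A n)"
      then obtain n R where R: "R \<in> dyadic" "\<bar>avg f R\<bar> > l + 1 / real (Suc n)" "R \<subseteq> Q" "x \<in> R"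
        by (auto simp: A_def U_def)
      have "l < l + 1 / real (Suc n)" by simp
      with R have "l < \<bar>avg f R\<bar>" by linarith
      then show "x \<in> U l" using R by (auto simp: U_def)
    qed
    show "U l \<subseteq> (\<Union>n. A n)"
    proof
      fix x assume "x \<in> U l"
      then obtain R where R: "R \<in> dyadic" "\<bar>avg f R\<bar> > l" "R \<subseteq> Q" "x \<in> R" by (auto simp: U_def)
      obtain n where "1 / real (Suc n) < \<bar>avg f R\<bar> - l"
        using reals_Archimedean[of "\<bar>avg f R\<bar> - l"] R by (auto simp: inverse_eq_divide)
      then have "l + 1 / real (Suc n) < \<bar>avg f R\<bar>" by linarith
      then show "x \<in> (\<Union>n. A n)" unfolding A_def U_def using R by blast
    qed
  qed
  have "(\<lambda>n. measure lborel (A n)) \<longlonglongrightarrow> measure lborel (\<Union>n. A n)"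
  proof (rule Lim_measure_incseq[OF _ inc])
    show "emeasure lborel (\<Union>n. A n) \<noteq> \<infinity>" unfolding un using fm[of l] by (auto simp: fmeasurable_def)
  qed (use bor in \<open>auto simp: A_def\<close>)
  moreover have "measure lborel (A n) \<le> r * measure lborel Q" for n
    unfolding A_def by (rule le) simp
  ultimately have "measure lborel (U l) \<le> r * measure lborel Q"
    unfolding un by (intro LIMSEQ_le_const2) auto
  then show ?thesis by (simp only: U_def l_def)
qed

lemma cmart_avg:
  fixes f :: "real^'n::finite \<Rightarrow> real"
  assumes int: "\<And>Q. Q \<in> dyadic \<Longrightarrow> set_integrable lborel Q f"
  shows "cmart (avg f)"
  unfolding cmart_def
proof
  fix Q :: "(real^'n) set" assume Q: "Q \<in> dyadic"
  have pos: "measure lborel Q > 0" using Q measure_dyadic_pos by blast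
  have mR: "measure lborel R = measure lborel Q / 2 ^ CARD('n)" if "R \<in> dsub 1 Q" for R
    using measure_dsub[OF Q that] by simp
  have "set_lebesgue_integral lborel Q f = set_lebesgue_integral lborel (\<Union>R\<in>dsub 1 Q. R) f"
    using Union_dsub[OF Q, of 1] by simp
  also have "\<dots> = (\<Sum>R\<in>dsub 1 Q. set_lebesgue_integral lborel R f)"
  proof (rule set_integral_finite_Union)
    show "disjoint_family_on (\<lambda>R. R) (dsub 1 Q)"
      using dsub_disjoint[OF Q] unfolding disjoint_family_on_def by blast
    show "set_integrable lborel R f" "R \<in> sets lborel" if "R \<in> dsub 1 Q" for R
      using int dsub_dyadic[OF that] dyadic_borel by auto
  qed (use finite_card_dsub[OF Q] in auto)
  also have "\<dots> = (\<Sum>R\<in>dsub 1 Q. avg f R * (measure lborel Q / 2 ^ CARD('n)))"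
    using mR pos by (intro sum.cong) (auto simp: avg_def)
  finally have "avg f Q * 2 ^ CARD('n) = (\<Sum>R\<in>dsub 1 Q. avg f R)"
    using pos by (simp add: avg_def[of f Q] sum_divide_distrib[symmetric] sum_distrib_right[symmetric] field_simps)
  then show "(\<Sum>R\<in>dsub 1 Q. avg f R - avg f Q) = 0"
    using finite_card_dsub(2)[OF Q, of 1] by (simp add: sum_subtractf mult.commute)
qed

lemma Linf_c_set_integrable:
  fixes f :: "real^'n::finite \<Rightarrow> real"
  assumes "Linf_c f" "Q \<in> dyadic" shows "set_integrable lborel Q f"
proof -
  obtain B where "AE x in lborel. \<bar>f x\<bar> \<le> B" using assms by (auto simp: Linf_c_def)
  then show ?thesis unfolding set_integrable_def
    using assms dyadic_fmeasurable[of Q]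
    by (intro integrableI_bounded_set_indicator[where B = B]) (auto simp: Linf_c_def fmeasurable_def)
qed

lemma Linf_c_avg_bounded:
  fixes f :: "real^'n::finite \<Rightarrow> real"
  assumes f: "Linf_c f"
  obtains B where "\<And>Q. Q \<in> dyadic \<Longrightarrow> \<bar>avg f Q\<bar> \<le> B"
proof -
  obtain B where B: "AE x in lborel. \<bar>f x\<bar> \<le> B" using f by (auto simp: Linf_c_def)
  have "\<bar>avg f Q\<bar> \<le> B" if Q: "Q \<in> dyadic" for Q
  proof -
    have fm: "Q \<in> fmeasurable lborel" using Q dyadic_fmeasurable by blast
    have pos: "measure lborel Q > 0" using Q measure_dyadic_pos by blast
    have "\<bar>set_lebesgue_integral lborel Q f\<bar> \<le> (\<integral>x. indicator Q x * B \<partial>lborel)"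
      unfolding set_lebesgue_integral_def
    proof (rule order_trans[OF integral_abs_bound], rule integral_mono_AE)
      show "integrable lborel (\<lambda>x. \<bar>indicator Q x *\<^sub>R f x\<bar>)"
        using Linf_c_set_integrable[OF f Q] by (simp add: set_integrable_def)
      show "integrable lborel (\<lambda>x. indicator Q x * B)" using fm by (auto simp: fmeasurable_def)
      show "AE x in lborel. \<bar>indicator Q x *\<^sub>R f x\<bar> \<le> indicator Q x * B"
        using B by eventually_elim (auto simp: indicator_def)
    qed
    also have "\<dots> = measure lborel Q * B" using fm by (auto simp: fmeasurable_def)
    finally show ?thesis using pos by (simp add: avg_def field_simps abs_divide)
  qed
  then show ?thesis using that by blast
qed

lemma avg_eq_0:
  assumes "AE x in lborel. x \<notin> K \<longrightarrow> f x = 0" "Q \<inter> K = {}"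
  shows "avg f Q = 0"
proof -
  have "AE x in lborel. indicator Q x *\<^sub>R f x = 0" using assms(1)
    by eventually_elim (use assms(2) in \<open>auto simp: indicator_def\<close>)
  then have "set_lebesgue_integral lborel Q f = 0"
    unfolding set_lebesgue_integral_def by (rule integral_eq_zero_AE)
  then show ?thesis by (simp add: avg_def)
qed

section \<open>Stopped operators\<close>

lemma dsub_ancestor_unique:
  fixes P :: "(real^'n::finite) set"
  assumes "P \<in> dyadic" "P' \<in> dyadic" "R \<in> dsub i P" "R \<in> dsub i P'"
  shows "P = P'"
proof -
  obtain k k' where k: "P \<in> dlevel k" "P' \<in> dlevel k'" using assms by (auto simp: dyadic_iff)
  then have R: "R \<in> dlevel (k + int i)" "R \<in> dlevel (k' + int i)" "R \<subseteq> P" "R \<subseteq> P'"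
    using assms dsub_iff by blast+
  then have "k = k'" using dlevel_unique by fastforce
  moreover obtain x where "x \<in> R" using R dlevel_nonempty by blast
  ultimately show ?thesis using k R dlevel_cube_at by (metis subsetD)
qed

lemma between_cube_at:
  fixes P :: "(real^'n::finite) set"
  assumes "P \<in> dyadic" "cube_at n x \<subseteq> P" "P \<subseteq> cube_at l x"
  obtains i where "P = cube_at i x" "l \<le> i" "i \<le> n"
proof -
  obtain i where i: "P \<in> dlevel i" using assms by (auto simp: dyadic_iff)
  then have "P = cube_at i x" using dlevel_cube_at assms mem_cube_at by blast
  then show ?thesis using that dlevel_subset_level[OF cube_at_dlevel cube_at_dlevel] assms by blast
qed

text \<open>What the three operators share. \<open>F\<close> stands for the averages of
  \<open>f\<close>, and \<open>b R\<close> is the value on \<open>R\<close> of the term attached to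
  the \<open>u\<close>-th ancestor of \<open>R\<close>. By \<open>b_energy\<close> the term attached
  to \<open>Q\<close> is controlled by the differences of \<open>F\<close> that start
  \<open>w\<close> generations below \<open>Q\<close>, hence by averages down to generation
  \<open>w + 1\<close>. The threshold \<open>L\<close> stands for the percentile.\<close>

locale dyadic_operator =
  fixes F b L :: "(real^'n::finite) set \<Rightarrow> real" and u w :: nat and C B :: real
  assumes cmart_F: "cmart F"
    and F_bounded: "Q \<in> dyadic \<Longrightarrow> \<bar>F Q\<bar> \<le> B"
    and u_pos: "1 \<le> u" and C_nonneg: "0 \<le> C"
    and cancel: "Q \<in> dyadic \<Longrightarrow> (\<Sum>R\<in>dsub 1 Q. b R) = 0"
    and b_energy: "Q \<in> dyadic \<Longrightarrow>
      (\<Sum>R\<in>dsub u Q. measure lborel R * (b R)\<^sup>2) \<le> C * (\<Sum>T\<in>dsub w Q. energy F T)"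
    and L_superlevel: "Q \<in> dyadic \<Longrightarrow>
      measure lborel (\<Union>{R\<in>dyadic. \<bar>F R\<bar> > L Q \<and> R \<subseteq> Q}) \<le> measure lborel Q / (4 * (2 ^ CARD('n)) ^ (w + 1))"
begin

text \<open>The size of one term relative to the averages it sees: differences of \<open>F\<close>
  are at most twice the bound, and a cube has \<open>(2 ^ CARD('n)) ^ u\<close> times the volume of
  its \<open>u\<close>-th generation descendants.\<close>

definition jump_const :: real where "jump_const = 2 * sqrt (C * (2 ^ CARD('n)) ^ u)"
text \<open>Its square is at least \<open>4 * C\<close>, so that Kolmogorov's inequality loses at
  most a quarter of the volume; the summand 1 keeps it positive when \<open>C = 0\<close>.\<close>

definition max_const :: real where "max_const = 2 * sqrt C + 1"

lemma jump_const_nonneg: "0 \<le> jump_const" using C_nonneg by (simp add: jump_const_def)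
lemma max_const_pos: "0 < max_const" using C_nonneg by (simp add: max_const_def add_nonneg_pos)

text \<open>A pointwise bound from the square norm: a single summand is at most the whole sum in
  \<open>b_energy\<close>.\<close>

lemma b_bound:
  assumes P: "P \<in> dyadic" and bd: "\<And>i R. i \<le> w + 1 \<Longrightarrow> R \<in> dsub i P \<Longrightarrow> \<bar>F R\<bar> \<le> \<mu>"
    and R: "R \<in> dsub u P"
  shows "\<bar>b R\<bar> \<le> jump_const * \<mu>"
proof -
  have \<mu>: "0 \<le> \<mu>" using bd[of 0 P] dsub_0[OF P] by force
  have e: "energy F T \<le> measure lborel T * (2 * \<mu>)\<^sup>2" if T: "T \<in> dsub w P" for T
  proof -
    have Td: "T \<in> dyadic" using T dsub_dyadic by blast
    have "energy F T \<le> (\<Sum>R\<in>dsub 1 T. measure lborel R * (2 * \<mu>)\<^sup>2)"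
      unfolding energy_def
    proof (intro sum_mono mult_left_mono)
      fix R assume "R \<in> dsub 1 T"
      then have "R \<in> dsub (w + 1) P" using T dsub_dsub[OF P] by blast
      then have "\<bar>F R - F T\<bar> \<le> 2 * \<mu>" using bd[of w T] bd[of "w + 1" R] T by simp
      then show "(F R - F T)\<^sup>2 \<le> (2 * \<mu>)\<^sup>2" using \<mu> by (metis abs_le_square_iff abs_of_nonneg mult_nonneg_nonneg zero_le_numeral)
    qed simp
    then show ?thesis using sum_measure_dsub[OF Td, of 1] by (simp add: sum_distrib_right[symmetric])
  qed
  have Rp: "measure lborel R > 0" using R dsub_dyadic measure_dyadic_pos by blast
  have "measure lborel R * (b R)\<^sup>2 \<le> (\<Sum>R\<in>dsub u P. measure lborel R * (b R)\<^sup>2)"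
    using R finite_card_dsub[OF P] by (intro member_le_sum) auto
  also have "\<dots> \<le> C * (\<Sum>T\<in>dsub w P. energy F T)" by (rule b_energy[OF P])
  also have "\<dots> \<le> C * (\<Sum>T\<in>dsub w P. measure lborel T * (2 * \<mu>)\<^sup>2)"
    by (intro mult_left_mono sum_mono e C_nonneg)
  also have "\<dots> = measure lborel R * (4 * (C * (2 ^ CARD('n)) ^ u) * \<mu>\<^sup>2)"
    unfolding sum_distrib_right[symmetric] sum_measure_dsub[OF P] measure_dsub[OF P R]
    by (simp add: power2_eq_square)
  finally have "(b R)\<^sup>2 \<le> 4 * (C * (2 ^ CARD('n)) ^ u) * \<mu>\<^sup>2" using Rp by simp
  also have "\<dots> = (jump_const * \<mu>)\<^sup>2" using C_nonneg by (simp add: jump_const_def power_mult_distrib)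
  finally have "\<bar>b R\<bar> \<le> \<bar>jump_const * \<mu>\<bar>" using abs_le_square_iff by blast
  then show ?thesis using \<mu> jump_const_nonneg by simp
qed

text \<open>The values of \<open>b\<close> on the \<open>u\<close>-th generation below \<open>P\<close> belong to the term
  of the operator attached to \<open>P\<close>; stopping keeps exactly the terms attached to \<open>\<G>\<close>.\<close>

definition stopped :: "(real^'n) set set \<Rightarrow> (real^'n) set \<Rightarrow> real" where
  "stopped \<G> R = (if \<exists>P\<in>\<G>. R \<in> dsub u P then b R else 0)"

text \<open>A tree with root \<open>Q\<close>, closed under ancestors inside \<open>Q\<close>, all
  of whose attached terms see only averages of size at most \<mu>.\<close>

definition admissible :: "(real^'n) set \<Rightarrow> (real^'n) set set \<Rightarrow> real \<Rightarrow> bool" where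
  "admissible Q \<G> \<mu> \<longleftrightarrow> Q \<in> \<G> \<and> \<G> \<subseteq> {P\<in>dyadic. P \<subseteq> Q}
     \<and> (\<forall>P\<in>\<G>. \<forall>P'\<in>dyadic. P \<subseteq> P' \<longrightarrow> P' \<subseteq> Q \<longrightarrow> P' \<in> \<G>)
     \<and> (\<forall>P\<in>\<G>. \<forall>i\<le>w + 1. \<forall>R\<in>dsub i P. \<bar>F R\<bar> \<le> \<mu>)"

lemma stopped_eq:
  assumes "\<G> \<subseteq> dyadic" "P \<in> dyadic" "R \<in> dsub u P"
  shows "stopped \<G> R = (if P \<in> \<G> then b R else 0)"
  using assms dsub_ancestor_unique unfolding stopped_def by (metis subsetD)

text \<open>Stopping never separates siblings: as \<open>1 \<le> u\<close>, they share their
  \<open>u\<close>-th ancestor, so all of their values are kept or none.\<close>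

lemma stopped_cancel:
  assumes \<G>: "\<G> \<subseteq> dyadic" and Q: "Q \<in> dyadic"
  shows "(\<Sum>R\<in>dsub 1 Q. stopped \<G> R) = 0"
proof (cases "\<exists>R\<in>dsub 1 Q. \<exists>P\<in>\<G>. R \<in> dsub u P")
  case True
  then obtain R P where R: "R \<in> dsub 1 Q" and P: "P \<in> \<G>" and "R \<in> dsub ((u - 1) + 1) P"
    using u_pos by auto
  then obtain P' where P': "P' \<in> dsub (u - 1) P" "R \<in> dsub 1 P'" using dsub_dsub \<G> by blast
  then have "P' = Q" using dsub_ancestor_unique Q R dsub_dyadic by blast
  then have "R' \<in> dsub u P" if "R' \<in> dsub 1 Q" for R'
    using that P' dsub_dsub[of P R' "u - 1" 1] \<G> P u_pos by auto
  then have "stopped \<G> R' = b R'" if "R' \<in> dsub 1 Q" for R' using that P unfolding stopped_def by auto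
  then show ?thesis using cancel[OF Q] by simp
next
  case False
  then show ?thesis unfolding stopped_def by (intro sum.neutral) auto
qed

text \<open>The square norm of the stopped increments from generation \<open>i\<close> to generation
  \<open>i + 1\<close> below \<open>Q\<close>.\<close>

definition lenergy :: "(real^'n) set set \<Rightarrow> (real^'n) set \<Rightarrow> nat \<Rightarrow> real" where
  "lenergy \<G> Q i = (\<Sum>P\<in>dsub i Q. \<Sum>R\<in>dsub 1 P. measure lborel R * (stopped \<G> R)\<^sup>2)"

lemma lenergy_nonneg: "0 \<le> lenergy \<G> Q i"
  unfolding lenergy_def by (intro sum_nonneg) auto

text \<open>A term attached to a cube inside \<open>Q\<close> takes its values at least
  \<open>u\<close> generations below \<open>Q\<close>.\<close>

lemma lenergy_small:
  assumes Q: "Q \<in> dyadic" and \<G>: "\<G> \<subseteq> {P\<in>dyadic. P \<subseteq> Q}" and i: "i + 1 < u"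
  shows "lenergy \<G> Q i = 0"
proof -
  obtain k where k: "Q \<in> dlevel k" using Q by (auto simp: dyadic_iff)
  have "stopped \<G> R = 0" if "R \<in> dsub (i + 1) Q" for R
  proof -
    have "R \<notin> dsub u P" if P: "P \<in> \<G>" for P
    proof
      assume Ru: "R \<in> dsub u P"
      obtain l where l: "P \<in> dlevel l" using P \<G> by (auto simp: dyadic_iff)
      have "k \<le> l" using dlevel_subset_level[OF k l] P \<G> by blast
      moreover have "R \<in> dlevel (l + int u)" "R \<in> dlevel (k + int (i + 1))"
        using Ru l \<open>R \<in> dsub (i + 1) Q\<close> k dsub_iff by blast+
      then have "l + int u = k + int (i + 1)" using dlevel_unique by blast
      ultimately show False using i by linarith
    qed
    then show ?thesis unfolding stopped_def by auto
  qed
  moreover have "lenergy \<G> Q i = (\<Sum>R\<in>dsub (i + 1) Q. measure lborel R * (stopped \<G> R)\<^sup>2)"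
    unfolding lenergy_def by (rule sum_dsub_add[OF Q, symmetric])
  ultimately show ?thesis by simp
qed

text \<open>Increments into generation \<open>i + 1\<close> come from terms attached to generation
  \<open>i + 1 - u\<close>, which \<open>b_energy\<close> pays for with the energy of
  \<open>F\<close> at generation \<open>i + 1 - u + w\<close>. Each generation is charged at most
  once, and the total is bounded by \<open>energy_stopped\<close>.\<close>

lemma sum_lenergy:
  assumes Q: "Q \<in> dyadic" and adm: "admissible Q \<G> \<mu>"
  shows "(\<Sum>i<n. lenergy \<G> Q i) \<le> C * \<mu>\<^sup>2 * measure lborel Q"
proof -
  have \<G>: "\<G> \<subseteq> {P\<in>dyadic. P \<subseteq> Q}" using adm by (auto simp: admissible_def)
  \<comment> \<open>All generations from 0 to \<open>w\<close> below the tree are taken, not just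
    the \<open>w\<close>-th one, to keep \<open>G\<close> closed under ancestors. Children of cubes
    in \<open>G\<close> are at most \<open>w + 1\<close> generations below the tree, where
    \<open>admissible\<close> still bounds \<open>F\<close>.\<close>
  define G where "G = {T. \<exists>P\<in>\<G>. \<exists>i\<le>w. T \<in> dsub i P}"
  define g where "g m = (\<Sum>T\<in>dsub m Q. if T \<in> G then energy F T else 0)" for m
  have g0: "0 \<le> g m" for m unfolding g_def by (intro sum_nonneg) (auto intro: energy_nonneg)
  have FQ: "\<bar>F Q\<bar> \<le> \<mu>" using adm dsub_0[OF Q] by (fastforce simp: admissible_def)
  have gsum: "(\<Sum>i<m. g i) \<le> \<mu>\<^sup>2 * measure lborel Q" for m
  proof -
    have "(\<Sum>i<m. g i) \<le> measure lborel Q * (\<mu>\<^sup>2 - (F Q)\<^sup>2)"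
      unfolding g_def
    proof (rule energy_stopped[OF cmart_F, where ?Q0.0 = Q])
      show "P \<in> G" if TG: "T \<in> G" and P: "P \<in> dyadic" "T \<subseteq> P" "P \<subseteq> Q" for T P
      proof -
        obtain P0 i where P0: "P0 \<in> \<G>" "i \<le> w" "T \<in> dsub i P0" using TG unfolding G_def by blast
        then have P0d: "P0 \<in> dyadic" using \<G> by blast
        obtain k l where kl: "P0 \<in> dlevel k" "P \<in> dlevel l" using P0d P by (auto simp: dyadic_iff)
        obtain t where t: "t \<in> T" using dlevel_nonempty P0 kl dsub_iff by (metis all_not_in_conv)
        have Tl: "T \<in> dlevel (k + int i)" "T \<subseteq> P0" using P0 kl dsub_iff by blast+
        show ?thesis
        proof (cases "k \<le> l")
          case True
          then have "P \<subseteq> P0" using dyadic_nested[OF kl(1) kl(2)] t Tl P by blast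
          moreover have "l \<le> k + int i" using dlevel_subset_level[OF kl(2) Tl(1) P(2)] .
          ultimately have "P \<in> dsub (nat (l - k)) P0" "nat (l - k) \<le> w"
            using kl True P0 by (auto simp: dsub_iff)
          then show ?thesis using P0 by (auto simp: G_def)
        next
          case False
          then have "P0 \<subseteq> P" using dyadic_nested[OF kl(2) kl(1)] t Tl P by (metis linear subsetD)
          then have "P \<in> \<G>" using adm P0 P by (auto simp: admissible_def)
          then show ?thesis using dsub_0[OF P(1)] by (auto simp: G_def intro!: bexI[of _ P] exI[of _ 0])
        qed
      qed
      show "\<bar>F R\<bar> \<le> \<mu>" if TG: "T \<in> G" "R \<in> dsub 1 T" for T R
      proof -
        obtain P0 i where P0: "P0 \<in> \<G>" "i \<le> w" "T \<in> dsub i P0" using TG unfolding G_def by blast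
        then have "R \<in> dsub (i + 1) P0" using TG dsub_dsub \<G> by blast
        moreover have "i + 1 \<le> w + 1" using P0 by simp
        ultimately show ?thesis using adm P0(1) unfolding admissible_def by blast
      qed
    qed (use FQ Q in auto)
    also have "\<dots> \<le> \<mu>\<^sup>2 * measure lborel Q" by (simp add: algebra_simps)
    finally show ?thesis .
  qed
  have le: "lenergy \<G> Q i \<le> (if u \<le> i + 1 then C * g (i + 1 - u + w) else 0)" for i
  proof (cases "u \<le> i + 1")
    case True
    define m where "m = i + 1 - u"
    then have m: "i + 1 = m + u" using True by simp
    have "lenergy \<G> Q i = (\<Sum>R\<in>dsub (i + 1) Q. measure lborel R * (stopped \<G> R)\<^sup>2)"
      unfolding lenergy_def by (rule sum_dsub_add[OF Q, symmetric])
    also have "\<dots> = (\<Sum>P\<in>dsub m Q. \<Sum>R\<in>dsub u P. measure lborel R * (stopped \<G> R)\<^sup>2)"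
      unfolding m by (rule sum_dsub_add[OF Q])
    also have "\<dots> \<le> (\<Sum>P\<in>dsub m Q. C * (\<Sum>T\<in>dsub w P. if T \<in> G then energy F T else 0))"
    proof (rule sum_mono)
      fix P assume "P \<in> dsub m Q"
      then have P: "P \<in> dyadic" using dsub_dyadic by blast
      have st: "stopped \<G> R = (if P \<in> \<G> then b R else 0)" if "R \<in> dsub u P" for R
        using stopped_eq P \<G> that by blast
      show "(\<Sum>R\<in>dsub u P. measure lborel R * (stopped \<G> R)\<^sup>2) \<le> C * (\<Sum>T\<in>dsub w P. if T \<in> G then energy F T else 0)"
      proof (cases "P \<in> \<G>")
        case True
        then have "T \<in> G" if "T \<in> dsub w P" for T using that by (auto simp: G_def)
        then show ?thesis using b_energy[OF P] st True by simp
      next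
        case False
        then show ?thesis using st C_nonneg
          by (auto intro!: mult_nonneg_nonneg sum_nonneg intro: energy_nonneg)
      qed
    qed
    also have "\<dots> = C * g (m + w)" unfolding sum_distrib_left[symmetric] g_def sum_dsub_add[OF Q] ..
    finally show ?thesis using True by (simp add: m_def)
  qed (use lenergy_small[OF Q \<G>] in simp)
  have "(\<Sum>i<n. lenergy \<G> Q i) \<le> (\<Sum>i<n. if u \<le> i + 1 then C * g (i + 1 - u + w) else 0)"
    by (intro sum_mono le)
  also have "\<dots> = (\<Sum>i\<in>{i\<in>{..<n}. u \<le> i + 1}. C * g (i + 1 - u + w))"
    by (rule sum.inter_filter[symmetric]) simp
  also have "\<dots> = (\<Sum>j\<in>(\<lambda>i. i + 1 - u + w) ` {i\<in>{..<n}. u \<le> i + 1}. C * g j)"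
    by (subst sum.reindex) (auto simp: inj_on_def)
  also have "\<dots> \<le> (\<Sum>j<n + w + 1. C * g j)"
    using g0 C_nonneg by (intro sum_mono2) auto
  also have "\<dots> \<le> C * (\<mu>\<^sup>2 * measure lborel Q)"
    unfolding sum_distrib_left[symmetric] by (intro mult_left_mono gsum C_nonneg)
  finally show ?thesis by simp
qed

text \<open>Starting the path sums at level \<open>k + int m\<close> discards the first
  \<open>m\<close> layers. The choice \<open>m = 0\<close> serves the stopping cubes, large
  \<open>m\<close> the tails in the convergence proof.\<close>

lemma asum_stopped_sq:
  assumes Q: "Q \<in> dlevel k" and \<G>: "\<G> \<subseteq> dyadic"
  shows "(\<Sum>R\<in>dsub n Q. measure lborel R * (asum (stopped \<G>) (k + int m) R)\<^sup>2)
      = (\<Sum>i<n. if m \<le> i then lenergy \<G> Q i else 0)"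
proof -
  have Qd: "Q \<in> dyadic" using Q by (auto simp: dyadic_iff)
  have "asum (stopped \<G>) (k + int m) Q = 0" unfolding asum_def lev_eq[OF Q] by simp
  moreover have "(\<Sum>P\<in>dsub i Q. energy (asum (stopped \<G>) (k + int m)) P) = (if m \<le> i then lenergy \<G> Q i else 0)" for i
  proof -
    have "energy (asum (stopped \<G>) (k + int m)) P = (if m \<le> i then \<Sum>R\<in>dsub 1 P. measure lborel R * (stopped \<G> R)\<^sup>2 else 0)"
      if "P \<in> dsub i Q" for P
      using energy_asum[of P "k + int i"] that Q by (simp add: dsub_iff)
    then show ?thesis unfolding lenergy_def by simp
  qed
  ultimately show ?thesis
    using sum_sq_cmart[OF cmart_asum[OF stopped_cancel[OF \<G>]] Qd] by simp
qed

section \<open>Stopping cubes inside a given cube\<close>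

text \<open>Such a cube fills at least the fraction \<open>1 / (2 ^ CARD('n)) ^ (w + 1)\<close> of
  \<open>Q\<close>, four times what the superlevel set may occupy.\<close>

lemma F_le_L:
  assumes Q: "Q \<in> dyadic" and R: "R \<in> dsub i Q" "i \<le> w + 1"
  shows "\<bar>F R\<bar> \<le> L Q"
proof (rule ccontr)
  let ?U = "\<Union>{R\<in>dyadic. \<bar>F R\<bar> > L Q \<and> R \<subseteq> Q}"
  assume "\<not> ?thesis"
  then have sub: "R \<subseteq> ?U" using R dsub_dyadic dsub_subset by fastforce
  have bor: "?U \<in> sets lborel" unfolding sets_lborel by (rule Union_dyadic_borel) auto
  have "?U \<in> fmeasurable lborel"
    by (rule fmeasurableI2[OF dyadic_fmeasurable[OF Q] _ bor]) auto
  then have "measure lborel R \<le> measure lborel ?U"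
    using sub R dyadic_borel[OF dsub_dyadic[OF R(1)]] by (intro measure_mono_fmeasurable) auto
  also have "\<dots> \<le> measure lborel Q / (4 * (2 ^ CARD('n)) ^ (w + 1))" by (rule L_superlevel[OF Q])
  also have "\<dots> = measure lborel R * (2 ^ CARD('n)) ^ i / (4 * (2 ^ CARD('n)) ^ (w + 1))"
    unfolding measure_dsub[OF Q R(1)] by simp
  also have "\<dots> \<le> measure lborel R * (2 ^ CARD('n)) ^ (w + 1) / (4 * (2 ^ CARD('n)) ^ (w + 1))"
    by (intro divide_right_mono mult_left_mono power_increasing R) auto
  also have "\<dots> = measure lborel R / 4" by simp
  finally show False using measure_dyadic_pos[of R] R dsub_dyadic by fastforce
qed

lemma L_nonneg: "Q \<in> dyadic \<Longrightarrow> 0 \<le> L Q"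
  using F_le_L[of Q Q 0] dsub_0[of Q] by force

text \<open>A term attached to \<open>P\<close> sees averages of \<open>f\<close> up to \<open>w + 1\<close> generations below \<open>P\<close>, so
  \<open>P\<close> is already bad if a cube that close below it has a large average.\<close>

definition near :: "(real^'n) set \<Rightarrow> (real^'n) set set" where
  "near Q = {P\<in>dyadic. P \<subseteq> Q \<and> (\<exists>i\<le>w + 1. \<exists>R\<in>dsub i P. \<bar>F R\<bar> > L Q)}"

text \<open>Everything below a cube of \<open>near Q\<close> is discarded as well, which makes the
  remaining tree closed under ancestors.\<close>

definition good :: "(real^'n) set \<Rightarrow> (real^'n) set set" where
  "good Q = {P\<in>dyadic. P \<subseteq> Q \<and> (\<forall>P'\<in>near Q. \<not> P \<subseteq> P')}"

text \<open>All bad cubes are collected, not only the maximal ones; the first one met along a branch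
  takes over the role of the maximal one.\<close>

definition stop :: "(real^'n) set \<Rightarrow> (real^'n) set set" where
  "stop Q = near Q \<union> {R\<in>dyadic. R \<subseteq> Q \<and> \<bar>asum (stopped (good Q)) (lev Q) R\<bar> > max_const * L Q}"

lemma stop_subset: "R \<in> stop Q \<Longrightarrow> R \<in> dyadic \<and> R \<subseteq> Q"
  by (auto simp: stop_def near_def)

text \<open>A cube of \<open>near Q\<close> contains a cube of the superlevel set at most
  \<open>w + 1\<close> generations below, so that set has a fixed density in it. The factor lost in
  the weak type bound is the one built into \<open>L_superlevel\<close>.\<close>

lemma measure_near:
  assumes Q: "Q \<in> dyadic"
  shows "measure lborel (\<Union>(near Q)) \<le> measure lborel Q / 4"
proof -
  define \<Omega> where "\<Omega> = \<Union>{R\<in>dyadic. \<bar>F R\<bar> > L Q \<and> R \<subseteq> Q}"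
  have bor: "\<Omega> \<in> sets borel" unfolding \<Omega>_def by (rule Union_dyadic_borel) auto
  have fm: "\<Omega> \<in> fmeasurable lborel"
    by (rule fmeasurableI2[OF dyadic_fmeasurable[OF Q]]) (use bor in \<open>auto simp: \<Omega>_def\<close>)
  have "measure lborel (\<Union>{P\<in>near Q. P \<subseteq> Q}) \<le> (2 ^ CARD('n)) ^ (w + 1) * measure lborel (Q \<inter> \<Omega>)"
  proof (rule dyadic_weak_type[OF _ Q bor])
    fix P assume P: "P \<in> near Q"
    then obtain i R where R: "i \<le> w + 1" "R \<in> dsub i P" "\<bar>F R\<bar> > L Q" and Pd: "P \<in> dyadic" "P \<subseteq> Q"
      by (auto simp: near_def)
    have Rd: "R \<in> dyadic" "R \<subseteq> P" using dsub_dyadic[OF R(2)] dsub_subset[OF R(2)] by auto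
    then have "R \<subseteq> P \<inter> \<Omega>" using R Pd unfolding \<Omega>_def by blast
    then have le: "measure lborel R \<le> measure lborel (P \<inter> \<Omega>)"
      using fm bor dyadic_borel[OF Rd(1)] fmeasurable_Int_fmeasurable[OF dyadic_fmeasurable[OF Pd(1)], of \<Omega>]
      by (intro measure_mono_fmeasurable) auto
    have "measure lborel P = (2 ^ CARD('n)) ^ i * measure lborel R"
      by (rule measure_dsub[OF Pd(1) R(2)])
    also have "\<dots> \<le> (2 ^ CARD('n)) ^ (w + 1) * measure lborel (P \<inter> \<Omega>)"
      by (intro mult_mono power_increasing R le) auto
    finally show "measure lborel P \<le> (2 ^ CARD('n)) ^ (w + 1) * measure lborel (P \<inter> \<Omega>)" .
  qed (auto simp: near_def)
  also have "Q \<inter> \<Omega> = \<Omega>" by (auto simp: \<Omega>_def)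
  also have "(2 ^ CARD('n)) ^ (w + 1) * measure lborel \<Omega>
      \<le> (2 ^ CARD('n)) ^ (w + 1) * (measure lborel Q / (4 * (2 ^ CARD('n)) ^ (w + 1)))"
    unfolding \<Omega>_def by (intro mult_left_mono L_superlevel Q) auto
  also have "\<dots> = measure lborel Q / 4" by simp
  finally show ?thesis by (simp add: near_def conj_commute cong: conj_cong)
qed

lemma not_near_self: "Q \<in> dyadic \<Longrightarrow> Q \<notin> near Q"
  using F_le_L by (force simp: near_def)

lemma good_F_le: "P \<in> good Q \<Longrightarrow> i \<le> w + 1 \<Longrightarrow> R \<in> dsub i P \<Longrightarrow> \<bar>F R\<bar> \<le> L Q"
  unfolding good_def near_def by (smt (verit, best) mem_Collect_eq subset_refl)

lemma admissible_good:
  assumes Q: "Q \<in> dyadic"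
  shows "admissible Q (good Q) (L Q)"
proof -
  have "Q \<in> good Q"
    using Q not_near_self[OF Q] unfolding good_def by (auto simp: near_def)
  moreover have "P' \<in> good Q" if "P \<in> good Q" "P' \<in> dyadic" "P \<subseteq> P'" "P' \<subseteq> Q" for P P'
    using that unfolding good_def by blast
  moreover have "good Q \<subseteq> {P\<in>dyadic. P \<subseteq> Q}" by (auto simp: good_def)
  ultimately show ?thesis unfolding admissible_def using good_F_le by meson
qed

lemma measure_asum_superlevel:
  assumes Q: "Q \<in> dlevel k" and adm: "admissible Q \<G> \<mu>" and K: "0 < K"
  shows "measure lborel (\<Union>{R\<in>dyadic. \<bar>asum (stopped \<G>) k R\<bar> > K \<and> R \<subseteq> Q}) \<le> C * \<mu>\<^sup>2 * measure lborel Q / K\<^sup>2"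
proof (rule kolmogorov[OF cmart_asum[OF stopped_cancel] _ K])
  have Qd: "Q \<in> dyadic" using Q by (auto simp: dyadic_iff)
  then show "Q \<in> dyadic" .
  show G: "\<G> \<subseteq> dyadic" using adm by (auto simp: admissible_def)
  show "(\<Sum>R\<in>dsub n Q. measure lborel R * (asum (stopped \<G>) k R)\<^sup>2) \<le> C * \<mu>\<^sup>2 * measure lborel Q" for n
    using asum_stopped_sq[OF Q G, where m = 0 and n = n] sum_lenergy[OF Qd adm, of n] by simp
qed

lemma measure_stop:
  assumes Q: "Q \<in> dyadic"
  shows "measure lborel (\<Union>(stop Q)) \<le> measure lborel Q / 2"
proof -
  obtain k where k: "Q \<in> dlevel k" using Q by (auto simp: dyadic_iff)
  define S where "S = {R\<in>dyadic. R \<subseteq> Q \<and> \<bar>asum (stopped (good Q)) (lev Q) R\<bar> > max_const * L Q}"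
  have S_eq: "S = {R\<in>dyadic. \<bar>asum (stopped (good Q)) k R\<bar> > max_const * L Q \<and> R \<subseteq> Q}"
    unfolding S_def lev_eq[OF k] by auto
  note bound = measure_asum_superlevel[OF k admissible_good[OF Q]]
  have "measure lborel (\<Union>S) \<le> measure lborel Q / 4"
  proof (cases "L Q = 0")
    case False
    then have L: "0 < L Q" using L_nonneg[OF Q] by simp
    have "max_const\<^sup>2 = 4 * C + 4 * sqrt C + 1" using C_nonneg
      by (simp add: max_const_def power2_eq_square algebra_simps)
    then have "4 * C \<le> max_const\<^sup>2" using C_nonneg by simp
    then have "C / max_const\<^sup>2 \<le> 1 / 4" using max_const_pos by (simp add: pos_divide_le_eq)
    then have "C / max_const\<^sup>2 * measure lborel Q \<le> 1 / 4 * measure lborel Q" by (rule mult_right_mono) simp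
    moreover have "C * (L Q)\<^sup>2 * measure lborel Q / (max_const * L Q)\<^sup>2 = C / max_const\<^sup>2 * measure lborel Q"
      using L by (simp add: power_mult_distrib)
    moreover have "measure lborel (\<Union>S) \<le> C * (L Q)\<^sup>2 * measure lborel Q / (max_const * L Q)\<^sup>2"
      unfolding S_eq by (rule bound) (use L max_const_pos in simp)
    ultimately show ?thesis by linarith
  next
    case True
    \<comment> \<open>Kolmogorov's inequality has no content at threshold 0. But with
      \<open>L Q = 0\<close> it gives measure zero at every positive threshold, while a single cube
      in \<open>S\<close> has positive volume.\<close>
    have "S = {}"
    proof (rule ccontr)
      assume "S \<noteq> {}"
      then obtain R where R: "R \<in> S" by blast
      define K where "K = \<bar>asum (stopped (good Q)) k R\<bar> / 2"
      have K: "0 < K" using R True unfolding K_def S_eq by auto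
      let ?U = "\<Union>{R\<in>dyadic. \<bar>asum (stopped (good Q)) k R\<bar> > K \<and> R \<subseteq> Q}"
      have "R \<subseteq> ?U" using R K unfolding K_def S_eq by auto
      moreover have bor: "?U \<in> sets lborel" unfolding sets_lborel by (rule Union_dyadic_borel) auto
      moreover have "?U \<in> fmeasurable lborel"
        by (rule fmeasurableI2[OF dyadic_fmeasurable[OF Q] _ bor]) auto
      ultimately have "measure lborel R \<le> measure lborel ?U"
        using R dyadic_borel by (intro measure_mono_fmeasurable) (auto simp: S_eq)
      then have "measure lborel R \<le> 0" using bound[OF K] True by simp
      then show False using measure_dyadic_pos[of R] R by (simp add: S_eq)
    qed
    then show ?thesis by simp
  qed
  moreover have "measure lborel (\<Union>(stop Q)) \<le> measure lborel (\<Union>(near Q)) + measure lborel (\<Union>S)"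
  proof -
    have "\<Union>(near Q) \<in> sets lborel" unfolding sets_lborel
      by (rule Union_dyadic_borel) (auto simp: near_def)
    moreover have "\<Union>S \<in> sets lborel" unfolding sets_lborel
      by (rule Union_dyadic_borel) (auto simp: S_def)
    moreover have "\<Union>(stop Q) = \<Union>(near Q) \<union> \<Union>S" unfolding stop_def S_def by blast
    ultimately show ?thesis using measure_Un_le by metis
  qed
  ultimately show ?thesis using measure_near[OF Q] by simp
qed

lemma stopped_bound:
  assumes Q: "Q \<in> dyadic"
  shows "\<bar>stopped (good Q) R\<bar> \<le> jump_const * L Q"
proof (cases "\<exists>P\<in>good Q. R \<in> dsub u P")
  case True
  then obtain P where P: "P \<in> good Q" "R \<in> dsub u P" by blast
  have "\<bar>b R\<bar> \<le> jump_const * L Q"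
  proof (rule b_bound[OF _ _ P(2)])
    show "P \<in> dyadic" using P by (simp add: good_def)
  qed (use P good_F_le in blast)
  then show ?thesis using True by (simp add: stopped_def)
next
  case False
  then show ?thesis using L_nonneg[OF Q] jump_const_nonneg by (simp add: stopped_def)
qed

section \<open>Estimates along one branch\<close>

text \<open>While the branch stays in the tree down to level \<open>n\<close>, stopping alters
  nothing up to level \<open>n + int u\<close>, except that values belonging to terms attached above
  level \<open>l\<close> are dropped.\<close>

lemma stopped_cube_at:
  assumes \<G>: "\<G> \<subseteq> {P\<in>dyadic. P \<subseteq> cube_at l x}"
    and in_\<G>: "\<And>i. l \<le> i \<Longrightarrow> i \<le> n \<Longrightarrow> cube_at i x \<in> \<G>"
    and m: "m \<le> n + int u"
  shows "stopped \<G> (cube_at m x) = (if l + int u \<le> m then b (cube_at m x) else 0)"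
proof -
  have R: "cube_at m x \<in> dsub u (cube_at (m - int u) x)"
    using cube_at_dsub[of "m - int u" u x] by simp
  have e: "stopped \<G> (cube_at m x) = (if cube_at (m - int u) x \<in> \<G> then b (cube_at m x) else 0)"
    using stopped_eq[OF _ cube_at_dyadic R] \<G> by blast
  moreover have "cube_at (m - int u) x \<in> \<G> \<longleftrightarrow> l + int u \<le> m"
  proof
    assume "cube_at (m - int u) x \<in> \<G>"
    then have "cube_at (m - int u) x \<subseteq> cube_at l x" using \<G> by blast
    then show "l + int u \<le> m" using dlevel_subset_level[OF cube_at_dlevel[of l x] cube_at_dlevel[of "m - int u" x]] by simp
  qed (use in_\<G>[of "m - int u"] m in auto)
  ultimately show ?thesis by simp
qed

lemma sum_stopped_cube_at:
  assumes \<G>: "\<G> \<subseteq> {P\<in>dyadic. P \<subseteq> cube_at l x}"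
    and in_\<G>: "\<And>i. l \<le> i \<Longrightarrow> i \<le> n \<Longrightarrow> cube_at i x \<in> \<G>"
  shows "(\<Sum>k\<in>{l..n}. b (cube_at (k + int u) x)) = (\<Sum>m\<in>{l<..n + int u}. stopped \<G> (cube_at m x))"
proof -
  have "(\<Sum>m\<in>{l<..n + int u}. stopped \<G> (cube_at m x))
      = (\<Sum>m\<in>{l<..n + int u}. if l + int u \<le> m then b (cube_at m x) else 0)"
    by (intro sum.cong refl stopped_cube_at[OF \<G> in_\<G>]) auto
  also have "\<dots> = (\<Sum>m\<in>{m\<in>{l<..n + int u}. l + int u \<le> m}. b (cube_at m x))"
    by (rule sum.inter_filter[symmetric]) simp
  also have "{m\<in>{l<..n + int u}. l + int u \<le> m} = (\<lambda>k. k + int u) ` {l..n}"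
    using u_pos by (auto simp: image_iff intro!: bexI[of _ "_ - int u"])
  also have "(\<Sum>m\<in>(\<lambda>k. k + int u) ` {l..n}. b (cube_at m x)) = (\<Sum>k\<in>{l..n}. b (cube_at (k + int u) x))"
    by (subst sum.reindex) (auto simp: inj_on_def)
  finally show ?thesis by simp
qed

text \<open>That the cube at level \<open>n\<close> is not in \<open>stop\<close> bounds the path
  sum down to level \<open>n\<close> only, whereas terms attached down to level \<open>n\<close>
  take values down to level \<open>n + int u\<close>. The missing \<open>u\<close> increments are
  bounded singly by \<open>jump_const\<close>.\<close>

lemma local_sum:
  assumes n: "l \<le> n" and free: "\<And>i. l \<le> i \<Longrightarrow> i \<le> n \<Longrightarrow> cube_at i x \<notin> stop (cube_at l x)"
  shows "\<bar>\<Sum>k\<in>{l..n}. b (cube_at (k + int u) x)\<bar> \<le> (max_const + real u * jump_const) * L (cube_at l x)"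
proof -
  let ?Q = "cube_at l x"
  let ?st = "stopped (good ?Q)"
  have Q: "?Q \<in> dyadic" by (rule cube_at_dyadic)
  have good: "cube_at i x \<in> good ?Q" if i: "l \<le> i" "i \<le> n" for i
  proof -
    have "False" if P': "P' \<in> near ?Q" "cube_at i x \<subseteq> P'" for P'
    proof -
      have "P' \<in> dyadic" "P' \<subseteq> ?Q" using P' by (auto simp: near_def)
      then obtain j where "P' = cube_at j x" "l \<le> j" "j \<le> i" using between_cube_at P' by metis
      then show False using free[of j] P' i by (simp add: stop_def)
    qed
    then show ?thesis using cube_at_mono[OF i(1)] cube_at_dyadic unfolding good_def by blast
  qed
  have "(\<Sum>k\<in>{l..n}. b (cube_at (k + int u) x)) = (\<Sum>m\<in>{l<..n + int u}. ?st (cube_at m x))"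
    by (rule sum_stopped_cube_at) (use good in \<open>auto simp: good_def\<close>)
  also have "{l<..n + int u} = {l<..n} \<union> {n<..n + int u}" using n by auto
  also have "(\<Sum>m\<in>\<dots>. ?st (cube_at m x)) = asum ?st l (cube_at n x) + (\<Sum>m\<in>{n<..n + int u}. ?st (cube_at m x))"
    unfolding asum_cube_at by (rule sum.union_disjoint) auto
  finally have eq: "(\<Sum>k\<in>{l..n}. b (cube_at (k + int u) x))
      = asum ?st l (cube_at n x) + (\<Sum>m\<in>{n<..n + int u}. ?st (cube_at m x))" .
  have "\<bar>asum ?st l (cube_at n x)\<bar> \<le> max_const * L ?Q"
    using free[of n] n cube_at_mono[OF n, of x] cube_at_dyadic[of n x] by (auto simp: stop_def lev_cube_at not_less)
  moreover have "\<bar>\<Sum>m\<in>{n<..n + int u}. ?st (cube_at m x)\<bar> \<le> real u * (jump_const * L ?Q)"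
  proof -
    have "\<bar>\<Sum>m\<in>{n<..n + int u}. ?st (cube_at m x)\<bar> \<le> (\<Sum>m\<in>{n<..n + int u}. \<bar>?st (cube_at m x)\<bar>)"
      by (rule sum_abs)
    also have "\<dots> \<le> of_nat (card {n<..n + int u}) * (jump_const * L ?Q)"
      by (intro sum_bounded_above stopped_bound Q)
    finally show ?thesis by simp
  qed
  ultimately show ?thesis unfolding eq by (simp add: algebra_simps)
qed

lemma F_le_L_free:
  assumes n: "l \<le> n" and free: "cube_at n x \<notin> stop (cube_at l x)"
  shows "\<bar>F (cube_at n x)\<bar> \<le> L (cube_at l x)"
proof (rule ccontr)
  assume "\<not> ?thesis"
  then have "cube_at n x \<in> near (cube_at l x)"
    using cube_at_mono[OF n, of x] cube_at_dyadic[of n x] dsub_0[OF cube_at_dyadic, of n x]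
    by (auto simp: near_def intro!: exI[of _ 0])
  then show False using free by (simp add: stop_def)
qed

text \<open>The layers have summable square norms, so Kolmogorov's inequality for the path sums
  started at level \<open>k + int m\<close> makes the oscillation after that level small off a set
  whose measure tends to 0 with growing \<open>m\<close>.\<close>

lemma AE_convergent:
  assumes Q: "Q \<in> dlevel k"
  shows "AE x in lborel. x \<in> Q \<longrightarrow> convergent (\<lambda>n. \<Sum>j\<in>{k..k + int n}. b (cube_at (j + int u) x))"
proof -
  have Qd: "Q \<in> dyadic" using Q by (auto simp: dyadic_iff)
  \<comment> \<open>Nothing is stopped here: the global bound \<open>B\<close> makes the tree of all
    subcubes admissible. Only convergence is extracted, so \<open>B\<close> enters no final
    constant.\<close>
  define \<G> where "\<G> = {P\<in>dyadic. P \<subseteq> Q}"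
  have \<G>: "\<G> \<subseteq> dyadic" by (auto simp: \<G>_def)
  have adm: "admissible Q \<G> B"
    unfolding admissible_def \<G>_def using Qd F_bounded dsub_dyadic by blast
  define e where "e = lenergy \<G> Q"
  have summ: "summable e"
    unfolding e_def using sum_lenergy[OF Qd adm]
    by (intro summableI_nonneg_bounded[where x = "C * B\<^sup>2 * measure lborel Q"] lenergy_nonneg)
  define T where "T m = (\<Sum>i. e (i + m))" for m
  have T0: "T \<longlonglongrightarrow> 0" unfolding T_def by (rule suminf_exist_split2[OF summ])
  define Z where "Z K m = \<Union>{R\<in>dyadic. \<bar>asum (stopped \<G>) (k + int m) R\<bar> > K \<and> R \<subseteq> Q}" for K m
  have Zbor: "Z K m \<in> sets lborel" for K m
    unfolding Z_def sets_lborel by (rule Union_dyadic_borel) auto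
  have Zfm: "Z K m \<in> fmeasurable lborel" for K m
    by (rule fmeasurableI2[OF dyadic_fmeasurable[OF Qd] _ Zbor]) (auto simp: Z_def)
  have Zm: "measure lborel (Z K m) \<le> T m / K\<^sup>2" if K: "0 < K" for K m
    unfolding Z_def
  proof (rule kolmogorov[OF cmart_asum[OF stopped_cancel[OF \<G>]] Qd K])
    fix n
    have "(\<Sum>i<n. if m \<le> i then e i else 0) = (\<Sum>i\<in>{i\<in>{..<n}. m \<le> i}. e i)"
      by (rule sum.inter_filter[symmetric]) simp
    also have "\<dots> \<le> (\<Sum>i\<in>{m..<m + n}. e i)"
      by (rule sum_mono2) (auto simp: e_def lenergy_nonneg)
    also have "\<dots> = (\<Sum>i<n. e (i + m))"
      using sum.shift_bounds_nat_ivl[of e 0 m n] by (simp add: add.commute atLeast0LessThan)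
    also have "\<dots> \<le> T m" unfolding T_def
      by (rule sum_le_suminf) (use summ in \<open>auto simp: e_def lenergy_nonneg summable_iff_shift\<close>)
    finally show "(\<Sum>R\<in>dsub n Q. measure lborel R * (asum (stopped \<G>) (k + int m) R)\<^sup>2) \<le> T m"
      unfolding asum_stopped_sq[OF Q \<G>] e_def .
  qed
  have null: "(\<Inter>m. Z K m) \<in> null_sets lborel" if K: "0 < K" for K
  proof -
    have bor: "(\<Inter>m. Z K m) \<in> sets lborel" using Zbor by (intro sets.countable_INT) auto
    have fm: "(\<Inter>m. Z K m) \<in> fmeasurable lborel"
      by (rule fmeasurableI2[OF Zfm[of K 0] _ bor]) auto
    have "measure lborel (\<Inter>m. Z K m) \<le> T m / K\<^sup>2" for m
    proof -
      have "measure lborel (\<Inter>m. Z K m) \<le> measure lborel (Z K m)"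
        by (rule measure_mono_fmeasurable[OF _ bor Zfm]) auto
      then show ?thesis using Zm[OF K, of m] by linarith
    qed
    moreover have "(\<lambda>m. T m / K\<^sup>2) \<longlonglongrightarrow> 0" using tendsto_divide[OF T0 tendsto_const, of "K\<^sup>2"] K by simp
    ultimately have "measure lborel (\<Inter>m. Z K m) \<le> 0" by (intro LIMSEQ_le_const) auto
    then have "measure lborel (\<Inter>m. Z K m) = 0" using measure_nonneg by (rule antisym)
    then show ?thesis using fm by (auto simp: null_sets_def fmeasurable_def emeasure_eq_ennreal_measure)
  qed
  \<comment> \<open>Outside \<open>N\<close>, for each \<open>j\<close> there is a level after which
    the path sums move by at most \<open>1 / real (Suc j)\<close>.\<close>
  define N where "N = (\<Union>j::nat. \<Inter>m. Z (1 / real (Suc j)) m)"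
  have "N \<in> null_sets lborel" unfolding N_def by (intro null_sets_UN null) simp
  moreover have "convergent (\<lambda>n. \<Sum>j\<in>{k..k + int n}. b (cube_at (j + int u) x))"
    if x: "x \<in> Q" "x \<notin> N" for x
  proof -
    have Qx: "Q = cube_at k x" by (rule dlevel_cube_at[OF Q x(1)])
    define Y where "Y n = (\<Sum>m\<in>{k<..k + int n}. stopped \<G> (cube_at m x))" for n :: nat
    have "Cauchy Y"
    proof (rule metric_CauchyI)
      fix \<epsilon> :: real assume "0 < \<epsilon>"
      then obtain j where j: "1 / real (Suc j) < \<epsilon> / 2" using reals_Archimedean[of "\<epsilon> / 2"] by (auto simp: inverse_eq_divide)
      obtain m where m: "x \<notin> Z (1 / real (Suc j)) m" using x unfolding N_def by blast
      have small: "dist (Y m) (Y n) < \<epsilon> / 2" if n: "m \<le> n" for n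
      proof -
        have "cube_at (k + int n) x \<in> dyadic" "cube_at (k + int n) x \<subseteq> Q" "x \<in> cube_at (k + int n) x"
          unfolding Qx by (auto simp: cube_at_dyadic mem_cube_at cube_at_mono del: subsetI)
        then have "\<not> \<bar>asum (stopped \<G>) (k + int m) (cube_at (k + int n) x)\<bar> > 1 / real (Suc j)"
          using m unfolding Z_def by blast
        moreover have "Y n = Y m + asum (stopped \<G>) (k + int m) (cube_at (k + int n) x)"
        proof -
          have "{k<..k + int n} = {k<..k + int m} \<union> {k + int m<..k + int n}" using n by auto
          then show ?thesis unfolding Y_def asum_cube_at
            by (simp only:) (rule sum.union_disjoint, auto)
        qed
        ultimately show ?thesis using j by (simp add: dist_real_def)
      qed
      have "dist (Y i) (Y n) < \<epsilon>" if "m \<le> i" "m \<le> n" for i n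
        using small[OF that(1)] small[OF that(2)] unfolding dist_real_def by linarith
      then show "\<exists>M. \<forall>i\<ge>M. \<forall>n\<ge>M. dist (Y i) (Y n) < \<epsilon>" by blast
    qed
    \<comment> \<open>\<open>Y\<close> counts the levels of the values, the operator those of the
      attached cubes; they differ by \<open>u\<close>.\<close>
    then have "convergent (\<lambda>n. Y (n + u))"
      using Cauchy_convergent convergent_ignore_initial_segment by blast
    moreover have "Y (n + u) = (\<Sum>j\<in>{k..k + int n}. b (cube_at (j + int u) x))" for n
    proof -
      have "(\<Sum>j\<in>{k..k + int n}. b (cube_at (j + int u) x)) = (\<Sum>m\<in>{k<..(k + int n) + int u}. stopped \<G> (cube_at m x))"
        by (rule sum_stopped_cube_at) (use cube_at_dyadic cube_at_mono[of k _ x] in \<open>auto simp: \<G>_def Qx del: subsetI\<close>)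
      then show ?thesis by (simp add: Y_def add.assoc)
    qed
    ultimately show ?thesis by simp
  qed
  ultimately show ?thesis by (intro AE_I'[where N = N]) auto
qed

end

section \<open>The sparse family\<close>

lemma cube_at_subset_level: "cube_at m y \<subseteq> cube_at k x \<Longrightarrow> k \<le> m"
  using dlevel_subset_level cube_at_dlevel by blast

text \<open>The union of the level-\<open>l\<close> cubes having the origin in their closure, one per orthant; by
  \<open>corner_rigid\<close> they have no common dyadic ancestor.\<close>

definition corner :: "int \<Rightarrow> (real^'n::finite) set" where
  "corner l = {y. \<forall>i. \<lfloor>2 powr real_of_int l * y$i\<rfloor> \<in> {-1, 0}}"

lemma mem_cube_at_iff:
  "y \<in> cube_at k x \<longleftrightarrow> (\<forall>i. \<lfloor>2 powr real_of_int k * y$i\<rfloor> = \<lfloor>2 powr real_of_int k * x$i\<rfloor>)"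
  unfolding cube_at_def by (simp add: mem_dcube_iff)

lemma corner_cube_at: "y \<in> corner l \<Longrightarrow> y \<in> cube_at l x \<Longrightarrow> x \<in> corner l"
  unfolding corner_def mem_cube_at_iff by auto

text \<open>A dyadic cube never crosses a coordinate hyperplane, so points in a common cube have the
  same sign pattern, and the pattern determines the corner cube.\<close>

lemma corner_rigid:
  assumes "y \<in> corner l" "z \<in> corner l" "z \<in> cube_at k y"
  shows "cube_at l z = cube_at l y"
proof -
  have "\<lfloor>2 powr real_of_int l * z$i\<rfloor> = \<lfloor>2 powr real_of_int l * y$i\<rfloor>" for i
  proof -
    have neg: "\<lfloor>2 powr real_of_int m * t\<rfloor> < 0 \<longleftrightarrow> t < 0" for m and t :: real
      by (simp add: floor_less_zero mult_less_0_iff)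
    have "\<lfloor>2 powr real_of_int k * z$i\<rfloor> = \<lfloor>2 powr real_of_int k * y$i\<rfloor>"
      using assms(3) by (simp add: mem_cube_at_iff)
    then have "\<lfloor>2 powr real_of_int l * z$i\<rfloor> < 0 \<longleftrightarrow> \<lfloor>2 powr real_of_int l * y$i\<rfloor> < 0"
      using neg by metis
    moreover have "\<lfloor>2 powr real_of_int l * z$i\<rfloor> \<in> {-1, 0}" "\<lfloor>2 powr real_of_int l * y$i\<rfloor> \<in> {-1, 0}"
      using assms by (auto simp: corner_def)
    ultimately show ?thesis by (auto simp del: floor_less_zero)
  qed
  then show ?thesis by (intro cube_at_eqI) (simp add: mem_cube_at_iff)
qed

lemma compact_subset_corner:
  fixes K :: "(real^'n::finite) set"
  assumes "compact K" obtains l where "K \<subseteq> corner l"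
proof -
  obtain r where r: "\<And>x. x \<in> K \<Longrightarrow> norm x \<le> r" using assms compact_imp_bounded bounded_iff by metis
  obtain m :: nat where m: "\<bar>r\<bar> < 2 ^ m" using real_arch_pow[of 2 "\<bar>r\<bar>"] by auto
  have "K \<subseteq> corner (- int m)"
  proof
    fix x assume "x \<in> K"
    then have "\<bar>x$i\<bar> < 2 ^ m" for i using r[of x] component_le_norm_cart[of x i] m by linarith
    then have "-1 \<le> x$i / 2 ^ m \<and> x$i / 2 ^ m < 1" for i
      by (simp add: abs_less_iff field_simps) (metis less_eq_real_def minus_less_iff)
    then have "\<lfloor>x$i / 2 ^ m\<rfloor> \<in> {-1, 0}" for i
      by (cases "x$i / 2 ^ m < 0") (auto simp: floor_eq_iff)
    then show "x \<in> corner (- int m)"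
      by (simp add: corner_def powr_minus powr_realpow divide_inverse mult.commute)
  qed
  then show ?thesis using that by blast
qed

context dyadic_operator
begin

text \<open>The smallest stopping cube of level at most \<open>l + n\<close> that contains \<open>x\<close>.\<close>

primrec cur :: "int \<Rightarrow> real^'n \<Rightarrow> nat \<Rightarrow> (real^'n) set" where
  "cur l x 0 = cube_at l x"
| "cur l x (Suc n) = (if cube_at (l + int (Suc n)) x \<in> stop (cur l x n)
     then cube_at (l + int (Suc n)) x else cur l x n)"

lemma self_notin_stop: assumes Q: "Q \<in> dyadic" shows "Q \<notin> stop Q"
proof
  assume "Q \<in> stop Q"
  then have "\<Union>(stop Q) = Q" using stop_subset by blast
  then show False using measure_stop[OF Q] measure_dyadic_pos[OF Q] by simp
qed

lemma cur_cube_at: "\<exists>i\<le>n. cur l x n = cube_at (l + int i) x"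
  by (induction n) (auto intro: le_SucI)

lemma cur_cong:
  "y \<in> cube_at (l + int n) x \<Longrightarrow> cur l y n = cur l x n"
proof (induction n)
  case 0
  then show ?case using cube_at_eqI by simp
next
  case (Suc n)
  have "y \<in> cube_at (l + int n) x" using Suc.prems cube_at_mono[of "l + int n" "l + int (Suc n)" x] by auto
  then show ?case using Suc cube_at_eqI[OF Suc.prems] by simp
qed

definition chain_const :: real where "chain_const = max_const + real u * jump_const"

lemma chain_const_pos: "0 < chain_const" using jump_const_nonneg max_const_pos by (simp add: chain_const_def add_pos_nonneg)

text \<open>The invariant behind \<open>chain_bound\<close>: the current stopping cube will pay for
  the levels from its own on, so it is left out of the sum, and the coarser levels are paid for by
  the earlier stopping cubes. Sums run over the set of cubes because \<open>cur\<close> repeats a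
  cube until the next stop.\<close>

lemma cur_start:
  "\<exists>i\<le>n. cur l x n = cube_at (l + int i) x \<and> cur l x i = cur l x n
     \<and> (\<forall>j. i \<le> j \<longrightarrow> j \<le> n \<longrightarrow> cube_at (l + int j) x \<notin> stop (cur l x n))
     \<and> \<bar>\<Sum>k\<in>{l..<l + int i}. b (cube_at (k + int u) x)\<bar> \<le> chain_const * (\<Sum>Q\<in>cur l x ` {..n} - {cur l x n}. L Q)"
proof (induction n)
  case 0
  show ?case using self_notin_stop[OF cube_at_dyadic] by simp
next
  case (Suc n)
  then obtain i where i: "i \<le> n" "cur l x n = cube_at (l + int i) x" "cur l x i = cur l x n"
    and free: "\<And>j. i \<le> j \<Longrightarrow> j \<le> n \<Longrightarrow> cube_at (l + int j) x \<notin> stop (cur l x n)"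
    and bd: "\<bar>\<Sum>k\<in>{l..<l + int i}. b (cube_at (k + int u) x)\<bar> \<le> chain_const * (\<Sum>Q\<in>cur l x ` {..n} - {cur l x n}. L Q)"
    by blast
  show ?case
  proof (cases "cube_at (l + int (Suc n)) x \<in> stop (cur l x n)")
    case False
    then have e: "cur l x (Suc n) = cur l x n" by simp
    then have "cur l x ` {..Suc n} = cur l x ` {..n}" by (auto simp: atMost_Suc)
    moreover have "cube_at (l + int j) x \<notin> stop (cur l x n)" if "i \<le> j" "j \<le> Suc n" for j
      using that False free[of j] by (cases "j = Suc n") auto
    ultimately show ?thesis using i bd e by (intro exI[of _ i]) auto
  next
    case True
    then have e: "cur l x (Suc n) = cube_at (l + int (Suc n)) x" by simp
    \<comment> \<open>The new cube has a level that the chain has not reached before, so it differs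
      from all earlier cubes.\<close>
    have C: "cur l x ` {..Suc n} - {cur l x (Suc n)} = cur l x ` {..n}"
    proof -
      have "cur l x j \<noteq> cube_at (l + int (Suc n)) x" if "j \<le> n" for j
      proof -
        obtain i where "i \<le> j" "cur l x j = cube_at (l + int i) x" using cur_cube_at by blast
        then show ?thesis using that lev_cube_at[of "l + int i" x] lev_cube_at[of "l + int (Suc n)" x] by auto
      qed
      then show ?thesis unfolding e atMost_Suc by auto
    qed
    have "{l..<l + int (Suc n)} = {l..<l + int i} \<union> {l + int i..l + int n}" using i by auto
    then have "(\<Sum>k\<in>{l..<l + int (Suc n)}. b (cube_at (k + int u) x))
        = (\<Sum>k\<in>{l..<l + int i}. b (cube_at (k + int u) x)) + (\<Sum>k\<in>{l + int i..l + int n}. b (cube_at (k + int u) x))"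
      by (simp only:) (rule sum.union_disjoint, auto)
    moreover have "\<bar>\<Sum>k\<in>{l + int i..l + int n}. b (cube_at (k + int u) x)\<bar> \<le> chain_const * L (cube_at (l + int i) x)"
    proof (rule local_sum[folded chain_const_def])
      fix j assume j: "l + int i \<le> j" "j \<le> l + int n"
      then show "cube_at j x \<notin> stop (cube_at (l + int i) x)"
        using free[of "nat (j - l)"] i(2) by (auto simp: le_nat_iff nat_le_iff)
    qed (use i in simp)
    moreover have "chain_const * (\<Sum>Q\<in>cur l x ` {..n} - {cur l x n}. L Q) + chain_const * L (cube_at (l + int i) x)
        = chain_const * (\<Sum>Q\<in>cur l x ` {..n}. L Q)"
      using sum.remove[of "cur l x ` {..n}" "cur l x n" L, OF _ imageI] by (simp add: i(2)[symmetric] algebra_simps)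
    ultimately have "\<bar>\<Sum>k\<in>{l..<l + int (Suc n)}. b (cube_at (k + int u) x)\<bar> \<le> chain_const * (\<Sum>Q\<in>cur l x ` {..n}. L Q)"
      using bd by linarith
    then show ?thesis
      using self_notin_stop[OF cube_at_dyadic, of "l + int (Suc n)" x]
      unfolding C[symmetric] by (intro exI[of _ "Suc n"]) (simp only: e le_antisym order_refl, auto)
  qed
qed

lemma chain_bound:
  "\<bar>\<Sum>k\<in>{l..l + int n}. b (cube_at (k + int u) x)\<bar> \<le> chain_const * (\<Sum>Q\<in>cur l x ` {..n}. L Q)"
proof -
  obtain i where i: "i \<le> n" "cur l x n = cube_at (l + int i) x" "cur l x i = cur l x n"
    and free: "\<And>j. i \<le> j \<Longrightarrow> j \<le> n \<Longrightarrow> cube_at (l + int j) x \<notin> stop (cur l x n)"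
    and bd: "\<bar>\<Sum>k\<in>{l..<l + int i}. b (cube_at (k + int u) x)\<bar> \<le> chain_const * (\<Sum>Q\<in>cur l x ` {..n} - {cur l x n}. L Q)"
    using cur_start[of n l x] by blast
  have "{l..l + int n} = {l..<l + int i} \<union> {l + int i..l + int n}" using i by auto
  then have "(\<Sum>k\<in>{l..l + int n}. b (cube_at (k + int u) x))
      = (\<Sum>k\<in>{l..<l + int i}. b (cube_at (k + int u) x)) + (\<Sum>k\<in>{l + int i..l + int n}. b (cube_at (k + int u) x))"
    by (simp only:) (rule sum.union_disjoint, auto)
  moreover have "\<bar>\<Sum>k\<in>{l + int i..l + int n}. b (cube_at (k + int u) x)\<bar> \<le> chain_const * L (cube_at (l + int i) x)"
  proof (rule local_sum[folded chain_const_def])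
    fix j assume j: "l + int i \<le> j" "j \<le> l + int n"
    then show "cube_at j x \<notin> stop (cube_at (l + int i) x)"
      using free[of "nat (j - l)"] i(2) by (auto simp: le_nat_iff nat_le_iff)
  qed (use i in simp)
  moreover have "chain_const * (\<Sum>Q\<in>cur l x ` {..n} - {cur l x n}. L Q) + chain_const * L (cube_at (l + int i) x)
      = chain_const * (\<Sum>Q\<in>cur l x ` {..n}. L Q)"
    using sum.remove[of "cur l x ` {..n}" "cur l x n" L, OF _ imageI] by (simp add: i(2)[symmetric] algebra_simps)
  ultimately show ?thesis using bd by linarith
qed

section \<open>The family and its sparseness\<close>

text \<open>The first change after step \<open>i\<close> is made while the current cube is still the
  one of step \<open>i\<close>.\<close>

lemma cur_change:
  assumes "i \<le> j" "cur l y j \<noteq> cur l y i"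
  shows "\<exists>k. i < k \<and> k \<le> j \<and> cube_at (l + int k) y \<in> stop (cur l y i)"
  using assms
proof (induction j rule: dec_induct)
  case (step j)
  show ?case
  proof (cases "cur l y j = cur l y i")
    case True
    then have "cube_at (l + int (Suc j)) y \<in> stop (cur l y i)"
      using step.prems by (metis cur.simps(2))
    then show ?thesis using step.hyps by (intro exI[of _ "Suc j"]) simp
  next
    case False
    then obtain k where "i < k" "k \<le> j" "cube_at (l + int k) y \<in> stop (cur l y i)" using step.IH by blast
    then show ?thesis by (intro exI[of _ k]) simp
  qed
qed simp

text \<open>The strict ancestors of the corner cubes pay for the terms at coarser scales, where
  averages need not vanish; the other part collects the stopping cubes of all branches through the
  corner.\<close>

definition sparse_family :: "int \<Rightarrow> (real^'n) set set" where
  "sparse_family l = {cube_at k y | k y. k < l \<and> y \<in> corner l} \<union> {cur l y n | y n. y \<in> corner l}"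

lemma sparse_familyE:
  assumes "Q \<in> sparse_family l"
  obtains (top) k y where "Q = cube_at k y" "k < l" "y \<in> corner l"
    | (chain) y n where "Q = cur l y n" "y \<in> corner l"
  using assms unfolding sparse_family_def by auto

lemma sparse_family_cube_at:
  assumes "Q \<in> sparse_family l"
  obtains k y where "Q = cube_at k y" "y \<in> corner l"
  using assms
proof (cases rule: sparse_familyE)
  case (chain y n)
  then show ?thesis using that cur_cube_at[of n l y] by metis
qed (use that in blast)

lemma sparse_family_dyadic: "sparse_family l \<subseteq> dyadic"
  using sparse_family_cube_at cube_at_dyadic by (metis subsetI)

text \<open>By its level, \<open>Q'\<close> cannot be one of the large cubes, so it ends a chain.
  That chain passes through \<open>Q\<close> as current cube and must leave it through a cube of
  \<open>stop Q\<close>.\<close>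

lemma sparse_family_below_cur:
  assumes Q: "Q = cur l x n" and Q': "Q' \<in> sparse_family l" "Q' \<subset> Q"
  shows "Q' \<subseteq> \<Union>(stop Q)"
proof -
  obtain i where i: "Q = cube_at (l + int i) x" "cur l x i = Q" using cur_start[of n l x] Q by metis
  have "\<not> (\<exists>k y. k < l \<and> Q' = cube_at k y)"
  proof
    assume "\<exists>k y. k < l \<and> Q' = cube_at k y"
    then obtain k y where ky: "k < l" "Q' = cube_at k y" by blast
    then have "cube_at k y \<subseteq> cube_at (l + int i) x" using Q' i by auto
    then have "l + int i \<le> k" by (rule cube_at_subset_level)
    then show False using ky by simp
  qed
  then obtain y m where "Q' = cur l y m" using sparse_familyE[OF Q'(1)] by metis
  then obtain j where j: "Q' = cube_at (l + int j) y" "cur l y j = Q'" using cur_start[of m l y] by metis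
  have y: "y \<in> Q'" using j mem_cube_at by blast
  then have ci: "cur l y i = Q" using Q' i cur_cong by (metis psubsetD)
  have "cube_at (l + int j) y \<subseteq> cube_at (l + int i) x" using Q' i j by auto
  then have "l + int i \<le> l + int j" by (rule cube_at_subset_level)
  then obtain k where k: "k \<le> j" "cube_at (l + int k) y \<in> stop Q"
    using cur_change[of i j l y] ci j Q' by auto
  then have "Q' \<subseteq> cube_at (l + int k) y" unfolding j(1) by (intro cube_at_mono) simp
  then show ?thesis using k by blast
qed

lemma measure_sparse_family_below:
  assumes Q: "Q \<in> sparse_family l"
  shows "measure lborel (\<Union>{Q'\<in>sparse_family l. Q' \<subset> Q}) \<le> measure lborel Q / 2"
proof -
  have Qd: "Q \<in> dyadic" using Q sparse_family_dyadic by blast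
  have bor: "\<Union>{Q'\<in>sparse_family l. Q' \<subset> Q} \<in> sets lborel"
    unfolding sets_lborel by (rule Union_dyadic_borel) (use sparse_family_dyadic in blast)
  from Q show ?thesis
  proof (cases rule: sparse_familyE)
    case (chain x n)
    have sbor: "\<Union>(stop Q) \<in> sets lborel"
      unfolding sets_lborel by (rule Union_dyadic_borel) (use stop_subset in blast)
    have fm: "\<Union>(stop Q) \<in> fmeasurable lborel"
      by (rule fmeasurableI2[OF dyadic_fmeasurable[OF Qd] _ sbor]) (use stop_subset in blast)
    have "measure lborel (\<Union>{Q'\<in>sparse_family l. Q' \<subset> Q}) \<le> measure lborel (\<Union>(stop Q))"
      using sparse_family_below_cur[OF chain(1)] by (intro measure_mono_fmeasurable[OF _ bor fm]) blast
    then show ?thesis using measure_stop[OF Qd] by simp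
  next
    case (top k y)
    let ?R = "cube_at (k + 1) y"
    \<comment> \<open>By \<open>corner_rigid\<close>, \<open>Q\<close> contains only one corner
      cube. All smaller members of the family inside \<open>Q\<close> lie in the one child of
      \<open>Q\<close> that contains it.\<close>
    have sub: "\<Union>{Q'\<in>sparse_family l. Q' \<subset> Q} \<subseteq> ?R"
    proof
      fix x assume "x \<in> \<Union>{Q'\<in>sparse_family l. Q' \<subset> Q}"
      then obtain Q' where Q': "Q' \<in> sparse_family l" "Q' \<subset> Q" "x \<in> Q'" by blast
      then obtain k' z where z: "Q' = cube_at k' z" "z \<in> corner l" using sparse_family_cube_at by metis
      then have zQ: "z \<in> cube_at k y" using Q' mem_cube_at[of z k'] top by blast
      then have "cube_at l z = cube_at l y" using corner_rigid z top by blast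
      then have "z \<in> ?R" using mem_cube_at[of z l] cube_at_mono[of "k + 1" l y] top by auto
      then have e: "cube_at (k + 1) z = ?R" by (rule cube_at_eqI)
      have "cube_at k' z \<subseteq> cube_at k y" using Q' z top by auto
      then have "k \<le> k'" by (rule cube_at_subset_level)
      moreover have "k' \<noteq> k" using Q' z top cube_at_eqI[OF zQ] by auto
      ultimately show "x \<in> ?R" using cube_at_mono[of "k + 1" k' z] Q' z e by auto
    qed
    have "measure lborel (\<Union>{Q'\<in>sparse_family l. Q' \<subset> Q}) \<le> measure lborel ?R"
      by (rule measure_mono_fmeasurable[OF sub bor dyadic_fmeasurable[OF cube_at_dyadic]])
    also have "\<dots> \<le> measure lborel Q / 2"
    proof -
      have "?R \<in> dsub 1 Q" using cube_at_dsub[of k 1 y] top by simp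
      then have "measure lborel Q = 2 ^ CARD('n) * measure lborel ?R" using measure_dsub[OF Qd] by simp
      moreover have "2 ^ 1 * measure lborel ?R \<le> 2 ^ CARD('n) * measure lborel ?R"
        by (intro mult_right_mono power_increasing) (auto simp: Suc_leI)
      ultimately show ?thesis by simp
    qed
    finally show ?thesis .
  qed
qed

text \<open>\<open>E Q\<close> removes all strictly smaller members of the family. Two members that
  meet are nested, and the larger one has lost the smaller.\<close>

lemma sparse_sparse_family: "sparse (1 / 2) (sparse_family l)"
proof -
  define E where "E Q = Q - \<Union>{Q'\<in>sparse_family l. Q' \<subset> Q}" for Q
  have "E Q \<subseteq> Q \<and> E Q \<in> sets lborel \<and> 1 / 2 * measure lborel Q \<le> measure lborel (E Q)" if Q: "Q \<in> sparse_family l" for Q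
  proof -
    have Qd: "Q \<in> dyadic" using Q sparse_family_dyadic by blast
    have bor: "\<Union>{Q'\<in>sparse_family l. Q' \<subset> Q} \<in> sets lborel"
      unfolding sets_lborel by (rule Union_dyadic_borel) (use sparse_family_dyadic in blast)
    have "measure lborel (E Q) = measure lborel Q - measure lborel (\<Union>{Q'\<in>sparse_family l. Q' \<subset> Q})"
      unfolding E_def using bor dyadic_fmeasurable[OF Qd]
      by (intro measure_Diff) (auto simp: fmeasurable_def)
    then show ?thesis using measure_sparse_family_below[OF Q] bor dyadic_borel[OF Qd] by (auto simp: E_def)
  qed
  moreover have "disjoint_family_on E (sparse_family l)"
    unfolding disjoint_family_on_def
  proof (intro ballI impI)
    fix Q Q' assume Q: "Q \<in> sparse_family l" "Q' \<in> sparse_family l" "Q \<noteq> Q'"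
    show "E Q \<inter> E Q' = {}"
    proof (rule ccontr)
      assume "E Q \<inter> E Q' \<noteq> {}"
      then obtain x where x: "x \<in> E Q" "x \<in> E Q'" by blast
      then have xQ: "x \<in> Q" "x \<in> Q'" by (auto simp: E_def)
      obtain k k' where "Q \<in> dlevel k" "Q' \<in> dlevel k'" using Q sparse_family_dyadic dyadic_iff by (metis subsetD)
      then have "Q \<subseteq> Q' \<or> Q' \<subseteq> Q" using dyadic_nested xQ by (metis linear)
      then show False using x Q xQ by (auto simp: E_def)
    qed
  qed
  ultimately show ?thesis unfolding sparse_def by (auto intro!: exI[of _ E])
qed

end

section \<open>Sparse domination\<close>

context dyadic_operator
begin

lemma b_le_L: "\<bar>b (cube_at (k + int u) x)\<bar> \<le> jump_const * L (cube_at k x)"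
  by (rule b_bound[OF cube_at_dyadic F_le_L[OF cube_at_dyadic] cube_at_dsub])

text \<open>\<open>M\<close> bounds finite subfamilies only, which keeps the argument in the reals.
  Levels from \<open>l\<close> on are paid for by the chain; each coarser term either vanishes or is
  paid for by its own cube, and there the absolute values stand inside the sum to give absolute
  convergence.\<close>

lemma pointwise_bounds:
  assumes supp: "\<And>R. R \<in> dyadic \<Longrightarrow> R \<inter> corner l = {} \<Longrightarrow> F R = 0"
    and M: "\<And>\<F>. finite \<F> \<Longrightarrow> \<F> \<subseteq> sparse_family l \<Longrightarrow> (\<And>Q. Q \<in> \<F> \<Longrightarrow> x \<in> Q) \<Longrightarrow> (\<Sum>Q\<in>\<F>. L Q) \<le> M"
  shows sum_above: "\<bar>\<Sum>k\<in>{l..l + int n}. b (cube_at (k + int u) x)\<bar> \<le> chain_const * M"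
    and sum_below: "(\<Sum>j<n. \<bar>b (cube_at (l - 1 - int j + int u) x)\<bar>) \<le> jump_const * M"
    and F_bound: "\<bar>F (cube_at k x)\<bar> \<le> M"
proof -
  have M0: "0 \<le> M" using M[of "{}"] by simp
  \<comment> \<open>All averages inside a cube that misses the corner vanish, so
    \<open>b_bound\<close> applies with bound 0.\<close>
  have zero: "b (cube_at (k + int u) x) = 0" if "cube_at k x \<inter> corner l = {}" for k
  proof -
    have "\<bar>b (cube_at (k + int u) x)\<bar> \<le> jump_const * 0"
    proof (rule b_bound[OF cube_at_dyadic _ cube_at_dsub])
      fix i R assume "R \<in> dsub i (cube_at k x)"
      then have "F R = 0" using supp[of R] that dsub_dyadic dsub_subset by blast
      then show "\<bar>F R\<bar> \<le> 0" by simp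
    qed
    then show ?thesis by simp
  qed
  have top: "cube_at k x \<in> sparse_family l" if "cube_at k x \<inter> corner l \<noteq> {}" "k < l" for k
  proof -
    obtain y where y: "y \<in> cube_at k x" "y \<in> corner l" using \<open>cube_at k x \<inter> corner l \<noteq> {}\<close> by blast
    then have "cube_at k x = cube_at k y" using cube_at_eqI by metis
    then show ?thesis using y \<open>k < l\<close> unfolding sparse_family_def by blast
  qed
  have out: "cube_at k x \<inter> corner l = {}" if "x \<notin> corner l" "l \<le> k" for k
    using that corner_cube_at cube_at_mono[OF that(2), of x] by blast
  show "\<bar>\<Sum>k\<in>{l..l + int n}. b (cube_at (k + int u) x)\<bar> \<le> chain_const * M"
  proof (cases "x \<in> corner l")
    case True
    have "(\<Sum>Q\<in>cur l x ` {..n}. L Q) \<le> M"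
    proof (rule M)
      show "cur l x ` {..n} \<subseteq> sparse_family l" using True unfolding sparse_family_def by blast
      fix Q assume "Q \<in> cur l x ` {..n}"
      then obtain i where "Q = cube_at (l + int i) x" using cur_cube_at by blast
      then show "x \<in> Q" using mem_cube_at by blast
    qed simp
    then have "chain_const * (\<Sum>Q\<in>cur l x ` {..n}. L Q) \<le> chain_const * M" using chain_const_pos by simp
    then show ?thesis using chain_bound[where l = l and n = n and x = x] by linarith
  next
    case False
    then have "(\<Sum>k\<in>{l..l + int n}. b (cube_at (k + int u) x)) = 0"
      by (intro sum.neutral ballI zero out) auto
    then show ?thesis using M0 chain_const_pos by simp
  qed
  show "(\<Sum>j<n. \<bar>b (cube_at (l - 1 - int j + int u) x)\<bar>) \<le> jump_const * M"
  proof -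
    define J where "J = {j\<in>{..<n}. cube_at (l - 1 - int j) x \<inter> corner l \<noteq> {}}"
    have "(\<Sum>j<n. \<bar>b (cube_at (l - 1 - int j + int u) x)\<bar>) = (\<Sum>j\<in>J. \<bar>b (cube_at (l - 1 - int j + int u) x)\<bar>)"
      by (rule sum.mono_neutral_right) (use zero in \<open>auto simp: J_def\<close>)
    also have "\<dots> \<le> (\<Sum>j\<in>J. jump_const * L (cube_at (l - 1 - int j) x))"
      by (intro sum_mono b_le_L)
    also have "\<dots> = jump_const * (\<Sum>Q\<in>(\<lambda>j. cube_at (l - 1 - int j) x) ` J. L Q)"
    proof (subst sum.reindex)
      show "inj_on (\<lambda>j. cube_at (l - 1 - int j) x) J"
      proof (rule inj_onI)
        fix i j assume "cube_at (l - 1 - int i) x = cube_at (l - 1 - int j) x"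
        then have "lev (cube_at (l - 1 - int i) x) = lev (cube_at (l - 1 - int j) x)" by simp
        then show "i = j" by (simp add: lev_cube_at)
      qed
    qed (simp add: sum_distrib_left)
    also have "\<dots> \<le> jump_const * M"
    proof (intro mult_left_mono M jump_const_nonneg)
      show "(\<lambda>j. cube_at (l - 1 - int j) x) ` J \<subseteq> sparse_family l"
        unfolding J_def by (intro image_subsetI top) auto
    qed (auto simp: J_def mem_cube_at)
    finally show ?thesis .
  qed
  show "\<bar>F (cube_at k x)\<bar> \<le> M"
  proof -
    have single: "\<bar>F (cube_at k x)\<bar> \<le> M" if "Q \<in> sparse_family l" "x \<in> Q" "\<bar>F (cube_at k x)\<bar> \<le> L Q" for Q
      using M[of "{Q}"] that by auto
    consider "cube_at k x \<inter> corner l = {}" | "cube_at k x \<inter> corner l \<noteq> {}" "k < l" | "x \<in> corner l" "l \<le> k"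
      using out[of k] by (meson not_less)
    then show ?thesis
    proof cases
      case 1
      then show ?thesis using supp[OF cube_at_dyadic] M0 by simp
    next
      case 2
      then show ?thesis using single[OF top mem_cube_at] F_le_L[OF cube_at_dyadic, of "cube_at k x" 0 k x] dsub_0[OF cube_at_dyadic, of k x] by simp
    next
      case 3
      define n where "n = nat (k - l)"
      have k: "k = l + int n" using 3 by (simp add: n_def)
      obtain i where i: "i \<le> n" "cur l x n = cube_at (l + int i) x"
        and free: "cube_at (l + int n) x \<notin> stop (cur l x n)"
        using cur_start[of n l x] by blast
      show ?thesis
      proof (rule single)
        show "cur l x n \<in> sparse_family l" using 3 unfolding sparse_family_def by blast
        show "x \<in> cur l x n" using i mem_cube_at by simp
        show "\<bar>F (cube_at k x)\<bar> \<le> L (cur l x n)"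
          using F_le_L_free[of "l + int i" "l + int n" x] i free k by simp
      qed
    qed
  qed
qed

text \<open>The window of levels is cut at \<open>l\<close>. The coarse half converges absolutely,
  the fine half by \<open>conv\<close>, so the limit exists for every offset \<delta> and splits
  into two bounded parts.\<close>

lemma lim_bound:
  fixes \<delta> :: int
  assumes supp: "\<And>R. R \<in> dyadic \<Longrightarrow> R \<inter> corner l = {} \<Longrightarrow> F R = 0"
    and M: "\<And>\<F>. finite \<F> \<Longrightarrow> \<F> \<subseteq> sparse_family l \<Longrightarrow> (\<And>Q. Q \<in> \<F> \<Longrightarrow> x \<in> Q) \<Longrightarrow> (\<Sum>Q\<in>\<F>. L Q) \<le> M"
    and conv: "convergent (\<lambda>n. \<Sum>k\<in>{l..l + int n}. b (cube_at (k + int u) x))"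
  shows "\<bar>lim (\<lambda>N::nat. \<Sum>k\<in>{- int N - \<delta>..int N - \<delta>}. b (cube_at (k + int u) x))\<bar> \<le> (jump_const + chain_const) * M"
proof -
  let ?b = "\<lambda>k. b (cube_at (k + int u) x)"
  define X where "X N = (\<Sum>k\<in>{- int N - \<delta>..int N - \<delta>}. ?b k)" for N :: nat
  define Y where "Y n = (\<Sum>k\<in>{l..l + int n}. ?b k)" for n :: nat
  define Z where "Z n = (\<Sum>j<n. ?b (l - 1 - int j))" for n :: nat
  have Zb: "(\<Sum>j<n. \<bar>?b (l - 1 - int j)\<bar>) \<le> jump_const * M" for n using sum_below[OF supp M] .
  have "summable (\<lambda>j. \<bar>?b (l - 1 - int j)\<bar>)"
    by (rule summableI_nonneg_bounded[OF _ Zb]) simp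
  then have "summable (\<lambda>j. ?b (l - 1 - int j))" by (rule summable_rabs_cancel)
  then obtain z where z: "Z \<longlonglongrightarrow> z" unfolding Z_def by (metis summable_LIMSEQ)
  obtain y where y: "Y \<longlonglongrightarrow> y" using conv unfolding Y_def convergent_def by blast
  have Zle: "\<bar>Z n\<bar> \<le> jump_const * M" for n unfolding Z_def by (rule order_trans[OF sum_abs Zb])
  have Yle: "\<bar>Y n\<bar> \<le> chain_const * M" for n unfolding Y_def by (rule sum_above[OF supp M])
  have to_inf: "filterlim (\<lambda>N. nat (int N + c)) at_top sequentially" for c
    unfolding filterlim_at_top
  proof
    fix m :: nat
    show "\<forall>\<^sub>F N in sequentially. m \<le> nat (int N + c)"
      by (rule eventually_sequentiallyI[of "nat (int m - c)"]) linarith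
  qed
  have ev: "\<forall>\<^sub>F N in sequentially. X N = Z (nat (int N + (l + \<delta>))) + Y (nat (int N + (- l - \<delta>)))"
  proof (rule eventually_sequentiallyI[of "nat (\<bar>l\<bar> + \<bar>\<delta>\<bar>)"])
    fix N :: nat assume N: "nat (\<bar>l\<bar> + \<bar>\<delta>\<bar>) \<le> N"
    define m where "m = nat (int N + (l + \<delta>))"
    have m: "int m = int N + (l + \<delta>)" using N by (simp add: m_def)
    have "{- int N - \<delta>..int N - \<delta>} = {l - int m..<l} \<union> {l..l + int (nat (int N + (- l - \<delta>)))}"
      using N m by auto
    then have "X N = (\<Sum>k\<in>{l - int m..<l}. ?b k) + Y (nat (int N + (- l - \<delta>)))"
      unfolding X_def Y_def by (simp only:) (rule sum.union_disjoint, auto)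
    also have "(\<Sum>k\<in>{l - int m..<l}. ?b k) = Z m"
      unfolding Z_def
      by (rule sum.reindex_bij_witness[of _ "\<lambda>j. l - 1 - int j" "\<lambda>k. nat (l - 1 - k)"]) auto
    finally show "X N = Z (nat (int N + (l + \<delta>))) + Y (nat (int N + (- l - \<delta>)))" unfolding m_def .
  qed
  have "(\<lambda>N. Z (nat (int N + (l + \<delta>))) + Y (nat (int N + (- l - \<delta>)))) \<longlonglongrightarrow> z + y"
    by (intro tendsto_add filterlim_compose[OF z to_inf] filterlim_compose[OF y to_inf])
  then have "X \<longlonglongrightarrow> z + y" using ev by (simp add: tendsto_cong)
  then have "lim X = z + y" by (rule limI)
  moreover have "\<bar>z\<bar> \<le> jump_const * M"
    using tendsto_rabs[OF z] Zle by (intro LIMSEQ_le_const2[of "\<lambda>n. \<bar>Z n\<bar>"]) auto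
  moreover have "\<bar>y\<bar> \<le> chain_const * M"
    using tendsto_rabs[OF y] Yle by (intro LIMSEQ_le_const2[of "\<lambda>n. \<bar>Y n\<bar>"]) auto
  ultimately have "\<bar>lim X\<bar> \<le> (jump_const + chain_const) * M" unfolding distrib_right by linarith
  then show ?thesis by (simp add: X_def[abs_def])
qed

lemma sum_le_infsum_sparse_family:
  assumes fin: "(\<Sum>\<^sub>\<infinity>Q\<in>sparse_family l. ennreal (L Q) * indicator Q x) \<noteq> \<infinity>"
    and \<F>: "finite \<F>" "\<F> \<subseteq> sparse_family l" "\<And>Q. Q \<in> \<F> \<Longrightarrow> x \<in> Q"
  shows "(\<Sum>Q\<in>\<F>. L Q) \<le> enn2real (\<Sum>\<^sub>\<infinity>Q\<in>sparse_family l. ennreal (L Q) * indicator Q x)"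
proof -
  have L0: "0 \<le> L Q" if "Q \<in> \<F>" for Q using that \<F> sparse_family_dyadic L_nonneg by blast
  have "ennreal (\<Sum>Q\<in>\<F>. L Q) = (\<Sum>Q\<in>\<F>. ennreal (L Q) * indicator Q x)"
    using L0 \<F>(3) by (subst sum_ennreal[symmetric]) auto
  also have "\<dots> \<le> (\<Sum>\<^sub>\<infinity>Q\<in>sparse_family l. ennreal (L Q) * indicator Q x)"
    by (subst nonneg_infsum_complete, simp, rule SUP_upper) (use \<F> in simp)
  finally have "ennreal (\<Sum>Q\<in>\<F>. L Q) \<le> (\<Sum>\<^sub>\<infinity>Q\<in>sparse_family l. ennreal (L Q) * indicator Q x)" .
  then have "enn2real (ennreal (\<Sum>Q\<in>\<F>. L Q)) \<le> enn2real (\<Sum>\<^sub>\<infinity>Q\<in>sparse_family l. ennreal (L Q) * indicator Q x)"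
    by (rule enn2real_mono) (use fin in \<open>simp add: less_top\<close>)
  then show ?thesis using L0 by (simp add: sum_nonneg)
qed

text \<open>Where the sparse sum is infinite nothing is to be shown, as the constant is positive;
  elsewhere its real value serves as \<open>M\<close>. The exceptional set comes from convergence at
  level \<open>l\<close> alone, hence is common to all \<delta>.\<close>

lemma domination:
  assumes supp: "\<And>R. R \<in> dyadic \<Longrightarrow> R \<inter> corner l = {} \<Longrightarrow> F R = 0"
  shows "AE x in lborel. \<forall>\<delta>::int. ennreal \<bar>lim (\<lambda>N::nat. \<Sum>k\<in>{- int N - \<delta>..int N - \<delta>}. b (cube_at (k + int u) x))\<bar>
      \<le> ennreal (jump_const + chain_const) * (\<Sum>\<^sub>\<infinity>Q\<in>sparse_family l. ennreal (L Q) * indicator Q x)"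
    and "ennreal \<bar>F (cube_at k x)\<bar> \<le> (\<Sum>\<^sub>\<infinity>Q\<in>sparse_family l. ennreal (L Q) * indicator Q x)"
proof -
  define s where "s x = (\<Sum>\<^sub>\<infinity>Q\<in>sparse_family l. ennreal (L Q) * indicator Q x)" for x
  have c: "0 < jump_const + chain_const" using jump_const_nonneg chain_const_pos by simp
  have M: "(\<Sum>Q\<in>\<F>. L Q) \<le> enn2real (s x)"
    if "s x \<noteq> \<infinity>" "finite \<F>" "\<F> \<subseteq> sparse_family l" "\<And>Q. Q \<in> \<F> \<Longrightarrow> x \<in> Q" for x \<F>
    using sum_le_infsum_sparse_family that unfolding s_def by blast
  have "countable (dlevel l :: (real^'n) set set)"
    by (rule countable_subset[OF _ countable_dyadic]) (auto simp: dyadic_def)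
  then have "AE x in lborel. \<forall>Q\<in>dlevel l. x \<in> Q \<longrightarrow> convergent (\<lambda>n. \<Sum>j\<in>{l..l + int n}. b (cube_at (j + int u) x))"
    using AE_convergent by (subst AE_ball_countable) auto
  then show "AE x in lborel. \<forall>\<delta>::int. ennreal \<bar>lim (\<lambda>N::nat. \<Sum>k\<in>{- int N - \<delta>..int N - \<delta>}. b (cube_at (k + int u) x))\<bar>
      \<le> ennreal (jump_const + chain_const) * (\<Sum>\<^sub>\<infinity>Q\<in>sparse_family l. ennreal (L Q) * indicator Q x)"
    unfolding s_def[symmetric]
  proof eventually_elim
    case (elim x)
    then have conv: "convergent (\<lambda>n. \<Sum>j\<in>{l..l + int n}. b (cube_at (j + int u) x))"
      using cube_at_dlevel mem_cube_at by blast
    show ?case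
    proof
      fix \<delta> :: int
      let ?T = "\<bar>lim (\<lambda>N::nat. \<Sum>k\<in>{- int N - \<delta>..int N - \<delta>}. b (cube_at (k + int u) x))\<bar>"
      show "ennreal ?T \<le> ennreal (jump_const + chain_const) * s x"
      proof (cases "s x = \<infinity>")
        case True
        then show ?thesis using c by (simp add: ennreal_mult_top)
      next
        case False
        have "?T \<le> (jump_const + chain_const) * enn2real (s x)"
          by (rule lim_bound[OF supp M[OF False] conv])
        then have "ennreal ?T \<le> ennreal (jump_const + chain_const) * ennreal (enn2real (s x))"
          using c by (simp add: ennreal_mult[symmetric] ennreal_leI)
        then show ?thesis using False by (simp add: less_top)
      qed
    qed
  qed
  show "ennreal \<bar>F (cube_at k x)\<bar> \<le> (\<Sum>\<^sub>\<infinity>Q\<in>sparse_family l. ennreal (L Q) * indicator Q x)"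
    unfolding s_def[symmetric]
  proof (cases "s x = \<infinity>")
    case False
    have "\<bar>F (cube_at k x)\<bar> \<le> enn2real (s x)" by (rule F_bound[OF supp M[OF False]])
    then have "ennreal \<bar>F (cube_at k x)\<bar> \<le> ennreal (enn2real (s x))" by (rule ennreal_leI)
    also have "\<dots> = s x" using False by (simp add: less_top)
    finally show "ennreal \<bar>F (cube_at k x)\<bar> \<le> s x" .
  qed simp
qed

end

text \<open>The locale instance depends on \<open>f\<close>, so the constants are written out to
  show that they do not. In \<open>K\<close>, the factor \<open>real (u + 1)\<close> counts
  \<open>u\<close> single terms at the end of a link and one more contribution from the scales above
  the corner.\<close>

lemma sparse_domination:
  fixes f :: "real^'n::finite \<Rightarrow> real" and u w :: nat and C :: real
  defines "r \<equiv> 1 / (4 * (2 ^ CARD('n)) ^ (w + 1))"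
    and "K \<equiv> 2 * sqrt C + 1 + real (u + 1) * (2 * sqrt (C * (2 ^ CARD('n)) ^ u))"
  assumes f: "Linf_c f" and u: "1 \<le> u" and C: "0 \<le> C"
    and cancel: "\<And>Q. Q \<in> dyadic \<Longrightarrow> (\<Sum>R\<in>dsub 1 Q. b R) = 0"
    and b_energy: "\<And>Q. Q \<in> dyadic \<Longrightarrow>
      (\<Sum>R\<in>dsub u Q. measure lborel R * (b R)\<^sup>2) \<le> C * (\<Sum>T\<in>dsub w Q. energy (avg f) T)"
  shows "\<exists>S\<subseteq>dyadic. sparse (1 / 2) S
      \<and> (AE x in lborel. \<forall>\<delta>::int. ennreal \<bar>lim (\<lambda>N::nat. \<Sum>k\<in>{- int N - \<delta>..int N - \<delta>}. b (cube_at (k + int u) x))\<bar>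
           \<le> ennreal K * sparse_sum r S f x)
      \<and> (\<forall>k x. ennreal \<bar>avg f (cube_at k x)\<bar> \<le> sparse_sum r S f x)"
proof -
  obtain B where B: "\<And>Q. Q \<in> dyadic \<Longrightarrow> \<bar>avg f Q\<bar> \<le> B" using Linf_c_avg_bounded[OF f] by blast
  have "(1::real) \<le> (2 ^ CARD('n)) ^ (w + 1)" unfolding power_mult[symmetric] by (rule one_le_power) simp
  then have "1 < 4 * (2 ^ CARD('n) :: real) ^ (w + 1)" by linarith
  then have r: "0 < r" "r < 1" unfolding r_def by (auto simp: divide_less_eq)
  interpret dyadic_operator "avg f" b "\<lambda>Q. Pr r Q (local_max Q f)" u w C B
  proof
    show "cmart (avg f)" by (rule cmart_avg[OF Linf_c_set_integrable[OF f]])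
    show "measure lborel (\<Union>{R\<in>dyadic. \<bar>avg f R\<bar> > Pr r Q (local_max Q f) \<and> R \<subseteq> Q})
        \<le> measure lborel Q / (4 * (2 ^ CARD('n)) ^ (w + 1))" if "Q \<in> dyadic" for Q
      using measure_superlevel_Pr[OF B that r] by (simp add: r_def)
  qed (use B u C cancel b_energy in auto)
  obtain A where A: "compact A" "AE x in lborel. x \<notin> A \<longrightarrow> f x = 0" using f by (auto simp: Linf_c_def)
  obtain l where l: "A \<subseteq> corner l" using compact_subset_corner[OF A(1)] by blast
  have supp: "avg f R = 0" if "R \<in> dyadic" "R \<inter> corner l = {}" for R
    by (rule avg_eq_0[OF A(2)]) (use that l in blast)
  have K: "K = jump_const + chain_const" unfolding K_def chain_const_def jump_const_def max_const_def by (simp add: algebra_simps)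
  have S: "sparse_sum r (sparse_family l) f x = (\<Sum>\<^sub>\<infinity>Q\<in>sparse_family l. ennreal (Pr r Q (local_max Q f)) * indicator Q x)" for x
    by (simp add: sparse_sum_def)
  show ?thesis
    unfolding K by (intro exI[of _ "sparse_family l"] conjI allI sparse_family_dyadic sparse_sparse_family)
      (unfold S, rule domination(1)[OF supp], assumption+, rule domination(2)[OF supp])
qed

section \<open>Martingale transforms, Haar shifts and the maximal operator\<close>

text \<open>With \<open>b = 0\<close> only the bound on single averages is used. No limit is
  involved, so it holds at every point.\<close>

lemma sparse_domination_maximal:
  "\<exists>r \<eta> C. 0 < r \<and> r < 1 \<and> 0 < \<eta> \<and> \<eta> < 1 \<and> 0 < C \<and>
     (\<forall>f :: real^'n::finite \<Rightarrow> real. Linf_c f \<longrightarrow> (\<exists>S \<subseteq> dyadic. sparse \<eta> S \<and>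
        (\<forall>x. ennreal (dyadic_max f x) \<le> ennreal C * sparse_sum r S f x)))"
proof -
  define r :: real where "r = 1 / (4 * (2 ^ CARD('n)) ^ (0 + 1))"
  have "(1::real) \<le> 2 ^ CARD('n)" by simp
  then have "1 < 4 * (2 ^ CARD('n) :: real) ^ (0 + 1)" unfolding add_0 power_one_right by linarith
  then have r: "0 < r" "r < 1" unfolding r_def by (auto simp: divide_less_eq)
  have main: "\<exists>S\<subseteq>dyadic. sparse (1 / 2) S \<and> (\<forall>x. ennreal (dyadic_max f x) \<le> ennreal 1 * sparse_sum r S f x)"
    if f: "Linf_c f" for f :: "real^'n \<Rightarrow> real"
  proof -
    obtain S where S: "S \<subseteq> dyadic" "sparse (1 / 2) S"
      and le: "\<And>k x. ennreal \<bar>avg f (cube_at k x)\<bar> \<le> sparse_sum r S f x"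
      using sparse_domination[OF f, of 1 0 "\<lambda>Q. 0" 0] unfolding r_def by auto
    have "ennreal (dyadic_max f x) \<le> sparse_sum r S f x" for x
    proof (cases "sparse_sum r S f x = \<infinity>")
      case False
      have "dyadic_max f x \<le> enn2real (sparse_sum r S f x)"
        unfolding dyadic_max_def
      proof (rule cSUP_least)
        show "{Q \<in> dyadic. x \<in> Q} \<noteq> {}" using cube_at_dyadic mem_cube_at by blast
        fix Q assume "Q \<in> {Q \<in> dyadic. x \<in> Q}"
        then obtain k where "Q = cube_at k x" using dyadic_iff dlevel_cube_at by blast
        then have "enn2real (ennreal \<bar>avg f Q\<bar>) \<le> enn2real (sparse_sum r S f x)"
          using le False by (intro enn2real_mono) (auto simp: less_top)
        then show "\<bar>avg f Q\<bar> \<le> enn2real (sparse_sum r S f x)" by simp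
      qed
      then have "ennreal (dyadic_max f x) \<le> ennreal (enn2real (sparse_sum r S f x))" by (rule ennreal_leI)
      also have "\<dots> = sparse_sum r S f x" using False by (simp add: less_top)
      finally show ?thesis .
    qed simp
    then show ?thesis using S by auto
  qed
  show ?thesis
    by (intro exI[of _ r] exI[of _ "1 / 2"] exI[of _ 1] conjI allI impI r main) simp_all
qed

text \<open>The offset \<open>\<delta>\<close> reconciles the index of the partial sums with the level of the cube to which
  a term is attached: the increment \<open>E\<^sub>k f - E\<^sub>k\<^sub>-\<^sub>1 f\<close> is attached to a cube of level \<open>k - 1\<close>.\<close>

lemma AE_sparse_domination:
  fixes T :: "(real^'n::finite \<Rightarrow> real) \<Rightarrow> real^'n \<Rightarrow> real" and \<delta> :: int
  assumes u: "1 \<le> u" and C: "0 \<le> C"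
    and T: "\<And>f x. Linf_c f \<Longrightarrow> T f x = lim (\<lambda>N::nat. \<Sum>k\<in>{- int N - \<delta>..int N - \<delta>}. b f (cube_at (k + int u) x))"
    and cancel: "\<And>f Q. Linf_c f \<Longrightarrow> Q \<in> dyadic \<Longrightarrow> (\<Sum>R\<in>dsub 1 Q. b f R) = 0"
    and b_energy: "\<And>f Q. Linf_c f \<Longrightarrow> Q \<in> dyadic \<Longrightarrow>
      (\<Sum>R\<in>dsub u Q. measure lborel R * (b f R)\<^sup>2) \<le> C * (\<Sum>T\<in>dsub w Q. energy (avg f) T)"
  shows "\<exists>r \<eta> C. 0 < r \<and> r < 1 \<and> 0 < \<eta> \<and> \<eta> < 1 \<and> 0 < C \<and>
     (\<forall>f. Linf_c f \<longrightarrow> (\<exists>S \<subseteq> dyadic. sparse \<eta> S \<and>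
        (AE x in lborel. ennreal (T f x) \<le> ennreal C * sparse_sum r S f x)))"
proof -
  define r :: real where "r = 1 / (4 * (2 ^ CARD('n)) ^ (w + 1))"
  define K where "K = 2 * sqrt C + 1 + real (u + 1) * (2 * sqrt (C * (2 ^ CARD('n)) ^ u))"
  have "(1::real) \<le> (2 ^ CARD('n)) ^ (w + 1)" unfolding power_mult[symmetric] by (rule one_le_power) simp
  then have "1 < 4 * (2 ^ CARD('n) :: real) ^ (w + 1)" by linarith
  then have r: "0 < r" "r < 1" unfolding r_def by (auto simp: divide_less_eq)
  have K: "0 < K" unfolding K_def using C by (intro add_pos_nonneg add_nonneg_pos) auto
  have main: "\<exists>S\<subseteq>dyadic. sparse (1 / 2) S \<and> (AE x in lborel. ennreal (T f x) \<le> ennreal K * sparse_sum r S f x)"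
    if f: "Linf_c f" for f
  proof -
    obtain S where S: "S \<subseteq> dyadic" "sparse (1 / 2) S"
      and ae: "AE x in lborel. \<forall>\<delta>::int. ennreal \<bar>lim (\<lambda>N::nat. \<Sum>k\<in>{- int N - \<delta>..int N - \<delta>}. b f (cube_at (k + int u) x))\<bar>
           \<le> ennreal K * sparse_sum r S f x"
      using sparse_domination[OF f u C cancel[OF f] b_energy[OF f]] unfolding r_def K_def by blast
    from ae have "AE x in lborel. ennreal (T f x) \<le> ennreal K * sparse_sum r S f x"
    proof eventually_elim
      case (elim x)
      have "ennreal (T f x) \<le> ennreal \<bar>T f x\<bar>" by (rule ennreal_leI) simp
      then show ?case using elim[rule_format, of \<delta>] unfolding T[OF f, symmetric] by (rule order_trans)
    qed
    then show ?thesis using S by blast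
  qed
  show ?thesis
    by (intro exI[of _ r] exI[of _ "1 / 2"] exI[of _ K] conjI allI impI r K main) simp_all
qed

text \<open>The value on \<open>R\<close> of the term with \<open>k = lev R\<close>; it is attached
  to the parent of \<open>R\<close>, whence \<open>u = 1\<close>.\<close>

definition mt_coeff :: "(int \<Rightarrow> real^'n::finite \<Rightarrow> real) \<Rightarrow> (real^'n \<Rightarrow> real) \<Rightarrow> (real^'n) set \<Rightarrow> real" where
  "mt_coeff \<sigma> f R = \<sigma> (lev R) (pt R) * (avg f R - avg f (cube_at (lev R - 1) (pt R)))"

lemma mt_coeff_child:
  assumes \<sigma>: "mt_multiplier \<sigma>" and Q: "Q \<in> dlevel n" and x: "x \<in> Q" and R: "R \<in> dsub 1 Q"
  shows "mt_coeff \<sigma> f R = \<sigma> (n + 1) x * (avg f R - avg f Q)"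
proof -
  have Rl: "R \<in> dlevel (n + 1)" "R \<subseteq> Q" using R Q by (auto simp: dsub_iff)
  then have p: "pt R \<in> Q" using pt_in by blast
  \<comment> \<open>The multiplier with index \<open>n + 1\<close> is constant on cubes of level
    \<open>n\<close>, hence on the parent.\<close>
  have "\<sigma> (n + 1) (pt R) = \<sigma> (n + 1) x"
    using \<sigma> Q p x unfolding mt_multiplier_def by (metis add_diff_cancel_right')
  then show ?thesis using dlevel_cube_at[OF Q p] by (simp add: mt_coeff_def lev_eq[OF Rl(1)])
qed

lemma sparse_domination_mart:
  fixes \<sigma> :: "int \<Rightarrow> real^'n::finite \<Rightarrow> real"
  assumes \<sigma>: "mt_multiplier \<sigma>"
  shows "\<exists>r \<eta> C. 0 < r \<and> r < 1 \<and> 0 < \<eta> \<and> \<eta> < 1 \<and> 0 < C \<and>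
     (\<forall>f. Linf_c f \<longrightarrow> (\<exists>S \<subseteq> dyadic. sparse \<eta> S \<and>
        (AE x in lborel. ennreal (mart_transform \<sigma> f x) \<le> ennreal C * sparse_sum r S f x)))"
proof (rule AE_sparse_domination[where b = "mt_coeff \<sigma>" and u = 1 and w = 0 and C = 1 and \<delta> = 1])
  fix f :: "real^'n \<Rightarrow> real" and x
  have "(\<Sum>k\<in>{- int N..int N}. \<sigma> k x * (cond_exp k f x - cond_exp (k - 1) f x))
      = (\<Sum>k\<in>{- int N - 1..int N - 1}. mt_coeff \<sigma> f (cube_at (k + int 1) x))" for N
  proof (rule sum.reindex_bij_witness[of _ "\<lambda>k. k + 1" "\<lambda>k. k - 1"])
    fix k
    show "mt_coeff \<sigma> f (cube_at (k - 1 + int 1) x) = \<sigma> k x * (cond_exp k f x - cond_exp (k - 1) f x)"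
      using mt_coeff_child[OF \<sigma> cube_at_dlevel mem_cube_at cube_at_dsub[of "k - 1" 1 x], of f]
      by (simp add: cond_exp_def)
  qed auto
  then show "mart_transform \<sigma> f x = lim (\<lambda>N. \<Sum>k\<in>{- int N - 1..int N - 1}. mt_coeff \<sigma> f (cube_at (k + int 1) x))"
    unfolding mart_transform_def by simp
next
  fix f :: "real^'n \<Rightarrow> real" and Q :: "(real^'n) set"
  assume f: "Linf_c f" and Q: "Q \<in> dyadic"
  then obtain n where n: "Q \<in> dlevel n" by (auto simp: dyadic_iff)
  obtain x where x: "x \<in> Q" using dlevel_nonempty[OF n] by blast
  have c: "mt_coeff \<sigma> f R = \<sigma> (n + 1) x * (avg f R - avg f Q)" if "R \<in> dsub 1 Q" for R
    by (rule mt_coeff_child[OF \<sigma> n x that])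
  show "(\<Sum>R\<in>dsub 1 Q. mt_coeff \<sigma> f R) = 0"
    using cmart_avg[OF Linf_c_set_integrable[OF f]] Q c by (simp add: sum_distrib_left[symmetric] cmart_def)
  have "(\<Sum>R\<in>dsub 1 Q. measure lborel R * (mt_coeff \<sigma> f R)\<^sup>2) \<le> energy (avg f) Q"
    unfolding energy_def
  proof (intro sum_mono mult_left_mono)
    fix R assume R: "R \<in> dsub 1 Q"
    have "\<bar>\<sigma> (n + 1) x\<bar> \<le> 1" using \<sigma> by (simp add: mt_multiplier_def)
    then have "(\<sigma> (n + 1) x)\<^sup>2 \<le> 1" by (simp add: abs_square_le_1)
    then have "(\<sigma> (n + 1) x)\<^sup>2 * (avg f R - avg f Q)\<^sup>2 \<le> 1 * (avg f R - avg f Q)\<^sup>2" by (rule mult_right_mono) simp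
    then show "(mt_coeff \<sigma> f R)\<^sup>2 \<le> (avg f R - avg f Q)\<^sup>2" by (simp add: c[OF R] power_mult_distrib)
  qed simp
  then show "(\<Sum>R\<in>dsub 1 Q. measure lborel R * (mt_coeff \<sigma> f R)\<^sup>2) \<le> 1 * (\<Sum>T\<in>dsub 0 Q. energy (avg f) T)"
    by (simp add: dsub_0[OF Q])
qed auto

section \<open>Haar functions and Haar shifts\<close>

lemma integral_mult_step:
  fixes g \<phi> :: "real^'n::finite \<Rightarrow> real"
  assumes S: "S \<in> dyadic" and supp: "\<And>x. x \<notin> S \<Longrightarrow> \<phi> x = 0"
    and const: "\<And>R x y. R \<in> dsub 1 S \<Longrightarrow> x \<in> R \<Longrightarrow> y \<in> R \<Longrightarrow> \<phi> x = \<phi> y"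
    and g: "\<And>R. R \<in> dyadic \<Longrightarrow> set_integrable lborel R g"
  shows "integral\<^sup>L lborel (\<lambda>y. g y * \<phi> y) = (\<Sum>R\<in>dsub 1 S. \<phi> (pt R) * set_lebesgue_integral lborel R g)"
proof -
  have "g y * \<phi> y = (\<Sum>R\<in>dsub 1 S. \<phi> (pt R) * (indicator R y *\<^sub>R g y))" for y
  proof (cases "y \<in> S")
    case True
    then obtain R0 where R0: "R0 \<in> dsub 1 S" "y \<in> R0" using Union_dsub[OF S, of 1] by blast
    have "(\<Sum>R\<in>dsub 1 S. \<phi> (pt R) * (indicator R y *\<^sub>R g y)) = (\<Sum>R\<in>{R0}. \<phi> (pt R) * (indicator R y *\<^sub>R g y))"
    proof (rule sum.mono_neutral_right)
      show "\<forall>R\<in>dsub 1 S - {R0}. \<phi> (pt R) * (indicator R y *\<^sub>R g y) = 0"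
        using dsub_disjoint[OF S _ R0(1) _ R0(2)] by (auto simp: indicator_def)
    qed (use R0 finite_card_dsub[OF S] in auto)
    moreover have "pt R0 \<in> R0" using R0(1) dsub_dyadic[OF R0(1)] pt_in by (auto simp: dyadic_iff)
    ultimately show ?thesis using const[OF R0(1) R0(2)] R0 by simp
  next
    case False
    then have "indicator R y = (0::real)" if "R \<in> dsub 1 S" for R using that dsub_subset by (auto simp: indicator_def)
    then show ?thesis using supp[OF False] by simp
  qed
  then have "integral\<^sup>L lborel (\<lambda>y. g y * \<phi> y) = (\<integral>y. (\<Sum>R\<in>dsub 1 S. \<phi> (pt R) * (indicator R y *\<^sub>R g y)) \<partial>lborel)"
    by simp
  also have "\<dots> = (\<Sum>R\<in>dsub 1 S. \<integral>y. \<phi> (pt R) * (indicator R y *\<^sub>R g y) \<partial>lborel)"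
    using g dsub_dyadic unfolding set_integrable_def
    by (intro Bochner_Integration.integral_sum integrable_mult_right) blast
  also have "\<dots> = (\<Sum>R\<in>dsub 1 S. \<phi> (pt R) * set_lebesgue_integral lborel R g)"
    unfolding set_lebesgue_integral_def by simp
  finally show ?thesis .
qed

lemma haar_function_sums:
  fixes h :: "real^'n::finite \<Rightarrow> real"
  assumes S: "S \<in> dyadic" and h: "haar_function S h"
  shows "(\<Sum>R\<in>dsub 1 S. h (pt R) * measure lborel R) = 0"
    and "(\<Sum>R\<in>dsub 1 S. (h (pt R))\<^sup>2 * measure lborel R) = 1"
proof -
  have supp: "\<And>x. x \<notin> S \<Longrightarrow> h x = 0"
    and const: "\<And>R x y. R \<in> dsub 1 S \<Longrightarrow> x \<in> R \<Longrightarrow> y \<in> R \<Longrightarrow> h x = h y"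
    and mean: "set_lebesgue_integral lborel S h = 0" and nrm: "integral\<^sup>L lborel (\<lambda>x. (h x)\<^sup>2) = 1"
    using h unfolding haar_function_def by blast+
  have int1: "set_integrable lborel R (\<lambda>_. 1 :: real)" if "R \<in> dyadic" for R :: "(real^'n) set"
    using dyadic_fmeasurable[OF that] by (auto simp: set_integrable_def fmeasurable_def)
  have one: "set_lebesgue_integral lborel R (\<lambda>_. 1 :: real) = measure lborel R" if "R \<in> dsub 1 S" for R
    using dyadic_fmeasurable[OF dsub_dyadic[OF that]] by (auto simp: set_lebesgue_integral_def fmeasurable_def)
  have "indicator S x *\<^sub>R h x = h x" for x using supp[of x] by (auto simp: indicator_def)
  then have "integral\<^sup>L lborel (\<lambda>y. 1 * h y) = 0" using mean unfolding set_lebesgue_integral_def by (simp only: mult_1)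
  then show "(\<Sum>R\<in>dsub 1 S. h (pt R) * measure lborel R) = 0"
    using integral_mult_step[OF S supp const int1] one by simp
  have "integral\<^sup>L lborel (\<lambda>y. 1 * (h y)\<^sup>2) = (\<Sum>R\<in>dsub 1 S. (h (pt R))\<^sup>2 * set_lebesgue_integral lborel R (\<lambda>_. 1 :: real))"
  proof (rule integral_mult_step[OF S _ _ int1])
    show "(h x)\<^sup>2 = 0" if "x \<notin> S" for x using supp[OF that] by simp
    show "(h x)\<^sup>2 = (h y)\<^sup>2" if "R \<in> dsub 1 S" "x \<in> R" "y \<in> R" for R x y using const[OF that] by simp
  qed
  then show "(\<Sum>R\<in>dsub 1 S. (h (pt R))\<^sup>2 * measure lborel R) = 1" using nrm one by simp
qed

text \<open>As \<open>h\<close> has mean zero, \<open>avg f S\<close> may be subtracted from the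
  averages before Cauchy-Schwarz is applied, so the energy appears instead of the square norm of
  \<open>f\<close>.\<close>

lemma haar_coeff_sq_le:
  fixes f h :: "real^'n::finite \<Rightarrow> real"
  assumes f: "Linf_c f" and S: "S \<in> dyadic" and h: "haar_function S h"
  shows "(integral\<^sup>L lborel (\<lambda>y. f y * h y))\<^sup>2 \<le> energy (avg f) S"
proof -
  have supp: "\<And>x. x \<notin> S \<Longrightarrow> h x = 0"
    and const: "\<And>R x y. R \<in> dsub 1 S \<Longrightarrow> x \<in> R \<Longrightarrow> y \<in> R \<Longrightarrow> h x = h y"
    using h unfolding haar_function_def by blast+
  note hs = haar_function_sums[OF S h]
  have "integral\<^sup>L lborel (\<lambda>y. f y * h y) = (\<Sum>R\<in>dsub 1 S. h (pt R) * set_lebesgue_integral lborel R f)"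
    by (rule integral_mult_step[OF S supp const Linf_c_set_integrable[OF f]])
  also have "\<dots> = (\<Sum>R\<in>dsub 1 S. h (pt R) * (measure lborel R * avg f R))"
  proof (intro sum.cong refl)
    fix R assume "R \<in> dsub 1 S"
    then have "measure lborel R > 0" using dsub_dyadic measure_dyadic_pos by blast
    then show "h (pt R) * set_lebesgue_integral lborel R f = h (pt R) * (measure lborel R * avg f R)"
      by (simp add: avg_def)
  qed
  also have "\<dots> = (\<Sum>R\<in>dsub 1 S. h (pt R) * (measure lborel R * avg f R)) - avg f S * (\<Sum>R\<in>dsub 1 S. h (pt R) * measure lborel R)"
    unfolding hs(1) by simp
  also have "\<dots> = (\<Sum>R\<in>dsub 1 S. (sqrt (measure lborel R) * h (pt R)) * (sqrt (measure lborel R) * (avg f R - avg f S)))"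
    unfolding sum_distrib_left sum_subtractf[symmetric]
    by (intro sum.cong refl) (simp add: algebra_simps)
  finally have "(integral\<^sup>L lborel (\<lambda>y. f y * h y))\<^sup>2
     = (\<Sum>R\<in>dsub 1 S. (sqrt (measure lborel R) * h (pt R)) * (sqrt (measure lborel R) * (avg f R - avg f S)))\<^sup>2"
    by (rule arg_cong)
  also have "\<dots> \<le> (\<Sum>R\<in>dsub 1 S. (sqrt (measure lborel R) * h (pt R))\<^sup>2) * (\<Sum>R\<in>dsub 1 S. (sqrt (measure lborel R) * (avg f R - avg f S))\<^sup>2)"
    by (rule Cauchy_Schwarz_ineq_sum)
  also have "(\<Sum>R\<in>dsub 1 S. (sqrt (measure lborel R) * h (pt R))\<^sup>2) = 1"
    using hs(2) by (simp add: power_mult_distrib mult.commute)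
  also have "(\<Sum>R\<in>dsub 1 S. (sqrt (measure lborel R) * (avg f R - avg f S))\<^sup>2) = energy (avg f) S"
    by (simp add: power_mult_distrib energy_def)
  finally show ?thesis by simp
qed

definition shift_coeff :: "((real^'n::finite) set \<Rightarrow> real^'n \<Rightarrow> real) \<Rightarrow> nat
    \<Rightarrow> ((real^'n) set \<Rightarrow> (real^'n) set \<Rightarrow> (real^'n) set \<Rightarrow> real) \<Rightarrow> (real^'n \<Rightarrow> real) \<Rightarrow> (real^'n) set \<Rightarrow> (real^'n) set \<Rightarrow> real" where
  "shift_coeff h t \<alpha> f Q S = (\<Sum>T\<in>dsub t Q. \<alpha> Q T S * integral\<^sup>L lborel (\<lambda>y. f y * h T y))"

text \<open>\<open>R\<close> is viewed as a child of \<open>S\<close>, and \<open>S\<close> as an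
  \<open>s\<close>-th generation descendant of \<open>Q\<close>. A term attached to \<open>Q\<close>
  is constant only on such children, whence \<open>u = s + 1\<close>.\<close>

definition shift_value :: "((real^'n::finite) set \<Rightarrow> real^'n \<Rightarrow> real) \<Rightarrow> nat \<Rightarrow> nat
    \<Rightarrow> ((real^'n) set \<Rightarrow> (real^'n) set \<Rightarrow> (real^'n) set \<Rightarrow> real) \<Rightarrow> (real^'n \<Rightarrow> real) \<Rightarrow> (real^'n) set \<Rightarrow> real" where
  "shift_value h t s \<alpha> f R = (let S = cube_at (lev R - 1) (pt R); Q = cube_at (lev R - 1 - int s) (pt R)
     in shift_coeff h t \<alpha> f Q S * h S (pt R))"

lemma shift_value_eq:
  fixes h :: "(real^'n::finite) set \<Rightarrow> real^'n \<Rightarrow> real"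
  assumes h: "haar_system h" and x: "x \<in> R" and R: "R \<in> dlevel (n + 1)"
  shows "shift_value h t s \<alpha> f R
    = shift_coeff h t \<alpha> f (cube_at (n - int s) x) (cube_at n x) * h (cube_at n x) x"
proof -
  have Rx: "R = cube_at (n + 1) x" by (rule dlevel_cube_at[OF R x])
  have p: "pt R \<in> cube_at (n + 1) x" using pt_in[OF R] Rx by simp
  have e: "cube_at k (pt R) = cube_at k x" if "k \<le> n" for k
    unfolding Rx by (rule cube_at_pt) (use that in simp)
  have "R \<in> dsub 1 (cube_at n x)" using cube_at_dsub[of n 1 x] Rx by simp
  then have "h (cube_at n x) (pt R) = h (cube_at n x) x"
    using h cube_at_dyadic[of n x] x pt_in[OF R] unfolding haar_system_def haar_function_def by blast
  then show ?thesis by (simp add: shift_value_def lev_eq[OF R] e Let_def)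
qed

text \<open>Of all \<open>S\<close> in the inner sum only the one that contains \<open>x\<close>
  survives, the other Haar functions being zero at \<open>x\<close>.\<close>

lemma haar_shift_eq:
  fixes h :: "(real^'n::finite) set \<Rightarrow> real^'n \<Rightarrow> real"
  assumes h: "haar_system h"
  shows "(\<Sum>T\<in>dsub t (cube_at k x). \<Sum>S\<in>dsub s (cube_at k x).
        \<alpha> (cube_at k x) T S * integral\<^sup>L lborel (\<lambda>y. f y * h T y) * h S x)
    = shift_value h t s \<alpha> f (cube_at (k + int (s + 1)) x)"
proof -
  let ?Q = "cube_at k x" and ?S = "cube_at (k + int s) x"
  have S: "?S \<in> dsub s ?Q" by (rule cube_at_dsub)
  have "(\<Sum>T\<in>dsub t ?Q. \<Sum>S\<in>dsub s ?Q. \<alpha> ?Q T S * integral\<^sup>L lborel (\<lambda>y. f y * h T y) * h S x)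
      = (\<Sum>T\<in>dsub t ?Q. \<alpha> ?Q T ?S * integral\<^sup>L lborel (\<lambda>y. f y * h T y) * h ?S x)"
  proof (rule sum.cong[OF refl])
    fix T
    have "(\<Sum>S\<in>dsub s ?Q. \<alpha> ?Q T S * integral\<^sup>L lborel (\<lambda>y. f y * h T y) * h S x)
       = (\<Sum>S\<in>{?S}. \<alpha> ?Q T S * integral\<^sup>L lborel (\<lambda>y. f y * h T y) * h S x)"
    proof (rule sum.mono_neutral_right)
      show "\<forall>S\<in>dsub s ?Q - {?S}. \<alpha> ?Q T S * integral\<^sup>L lborel (\<lambda>y. f y * h T y) * h S x = 0"
      proof
        fix S assume S': "S \<in> dsub s ?Q - {?S}"
        then have "x \<notin> S" using dsub_disjoint[OF cube_at_dyadic _ S _ mem_cube_at] by blast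
        moreover have "S \<in> dyadic" using S' dsub_dyadic by blast
        ultimately have "h S x = 0" using h by (simp add: haar_system_def haar_function_def)
        then show "\<alpha> ?Q T S * integral\<^sup>L lborel (\<lambda>y. f y * h T y) * h S x = 0" by simp
      qed
    qed (use S finite_card_dsub[OF cube_at_dyadic] in auto)
    then show "(\<Sum>S\<in>dsub s ?Q. \<alpha> ?Q T S * integral\<^sup>L lborel (\<lambda>y. f y * h T y) * h S x)
       = \<alpha> ?Q T ?S * integral\<^sup>L lborel (\<lambda>y. f y * h T y) * h ?S x" by simp
  qed
  also have "\<dots> = shift_coeff h t \<alpha> f ?Q ?S * h ?S x"
    by (simp add: shift_coeff_def sum_distrib_right)
  also have "\<dots> = shift_value h t s \<alpha> f (cube_at (k + int (s + 1)) x)"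
    using shift_value_eq[OF h mem_cube_at, of "k + int s + 1" x "k + int s" t s \<alpha> f] cube_at_dlevel[of "k + int s + 1" x]
    by (simp add: ac_simps)
  finally show ?thesis .
qed

lemma shift_value_child:
  fixes h :: "(real^'n::finite) set \<Rightarrow> real^'n \<Rightarrow> real"
  assumes h: "haar_system h" and S: "S \<in> dlevel n" and y: "y \<in> S" and R: "R \<in> dsub 1 S"
  shows "shift_value h t s \<alpha> f R = shift_coeff h t \<alpha> f (cube_at (n - int s) y) S * h S (pt R)"
proof -
  have Rl: "R \<in> dlevel (n + 1)" "R \<subseteq> S" using R S by (auto simp: dsub_iff)
  have p: "pt R \<in> R" by (rule pt_in[OF Rl(1)])
  then have "S = cube_at n (pt R)" "S = cube_at n y" using Rl dlevel_cube_at[OF S] y by blast+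
  moreover from this have "cube_at (n - int s) (pt R) = cube_at (n - int s) y"
    using mem_cube_at[of "pt R" n] cube_at_mono[of "n - int s" n y] by (intro cube_at_eqI) auto
  ultimately show ?thesis using shift_value_eq[OF h p Rl(1), of t s \<alpha> f] by metis
qed

text \<open>In the constant, \<open>(2 ^ CARD('n)) ^ t\<close> comes from Cauchy-Schwarz over the
  cubes \<open>T\<close> and \<open>(2 ^ CARD('n)) ^ s\<close> from adding up one bound for each
  \<open>S\<close>. The depth \<open>w = t\<close> is that of the Haar coefficients of
  \<open>f\<close>.\<close>

lemma sparse_domination_shift:
  fixes h :: "(real^'n::finite) set \<Rightarrow> real^'n \<Rightarrow> real"
  assumes h: "haar_system h" and A: "\<And>Q T S. \<bar>\<alpha> Q T S\<bar> \<le> A"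
  shows "\<exists>r \<eta> C. 0 < r \<and> r < 1 \<and> 0 < \<eta> \<and> \<eta> < 1 \<and> 0 < C \<and>
     (\<forall>f. Linf_c f \<longrightarrow> (\<exists>S \<subseteq> dyadic. sparse \<eta> S \<and>
        (AE x in lborel. ennreal (haar_shift h t s \<alpha> f x) \<le> ennreal C * sparse_sum r S f x)))"
proof (rule AE_sparse_domination[where b = "shift_value h t s \<alpha>" and u = "s + 1" and w = t and \<delta> = 0
      and C = "(2 ^ CARD('n)) ^ s * ((2 ^ CARD('n)) ^ t * A\<^sup>2)"])
  fix f :: "real^'n \<Rightarrow> real" and x
  show "haar_shift h t s \<alpha> f x = lim (\<lambda>N. \<Sum>k\<in>{- int N - 0..int N - 0}. shift_value h t s \<alpha> f (cube_at (k + int (s + 1)) x))"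
    unfolding haar_shift_def haar_shift_eq[OF h] by simp
next
  fix f :: "real^'n \<Rightarrow> real" and S :: "(real^'n) set"
  assume f: "Linf_c f" and S: "S \<in> dyadic"
  then obtain n where n: "S \<in> dlevel n" by (auto simp: dyadic_iff)
  obtain y where y: "y \<in> S" using dlevel_nonempty[OF n] by blast
  have hS: "haar_function S (h S)" using h S by (simp add: haar_system_def)
  define c where "c = shift_coeff h t \<alpha> f (cube_at (n - int s) y) S"
  define m where "m = measure lborel S / 2 ^ CARD('n)"
  have m: "m > 0" "\<And>R. R \<in> dsub 1 S \<Longrightarrow> measure lborel R = m"
    using measure_dsub[OF S, of _ 1] measure_dyadic_pos[OF S] by (auto simp: m_def)
  \<comment> \<open>Siblings share the volume \<open>m\<close>; multiplying by it produces the mean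
    of the Haar function.\<close>
  have "(\<Sum>R\<in>dsub 1 S. shift_value h t s \<alpha> f R) * m = c * (\<Sum>R\<in>dsub 1 S. h S (pt R) * measure lborel R)"
    unfolding sum_distrib_right sum_distrib_left
    using shift_value_child[OF h n y] m by (intro sum.cong) (auto simp: c_def)
  then show "(\<Sum>R\<in>dsub 1 S. shift_value h t s \<alpha> f R) = 0"
    using haar_function_sums(1)[OF S hS] m by simp
next
  fix f :: "real^'n \<Rightarrow> real" and Q :: "(real^'n) set"
  assume f: "Linf_c f" and Q: "Q \<in> dyadic"
  then obtain k where k: "Q \<in> dlevel k" by (auto simp: dyadic_iff)
  let ?I = "\<lambda>T. integral\<^sup>L lborel (\<lambda>y. f y * h T y)"
  define E where "E = (\<Sum>T\<in>dsub t Q. energy (avg f) T)"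
  have coeff: "(shift_coeff h t \<alpha> f Q S)\<^sup>2 \<le> (2 ^ CARD('n)) ^ t * A\<^sup>2 * E" for S
  proof -
    have "(shift_coeff h t \<alpha> f Q S)\<^sup>2 \<le> (\<Sum>T\<in>dsub t Q. (\<alpha> Q T S * ?I T)\<^sup>2) * card (dsub t Q)"
      unfolding shift_coeff_def by (rule sum_squared_le_sum_of_squares)
    also have "\<dots> \<le> (\<Sum>T\<in>dsub t Q. A\<^sup>2 * energy (avg f) T) * card (dsub t Q)"
    proof (intro mult_right_mono sum_mono)
      fix T assume "T \<in> dsub t Q"
      then have T: "T \<in> dyadic" using dsub_dyadic by blast
      have "(\<alpha> Q T S)\<^sup>2 \<le> A\<^sup>2" using A[of Q T S] power_mono[of "\<bar>\<alpha> Q T S\<bar>" A 2] by simp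
      moreover have "(?I T)\<^sup>2 \<le> energy (avg f) T"
        using haar_coeff_sq_le[OF f T] h T by (simp add: haar_system_def)
      ultimately show "(\<alpha> Q T S * ?I T)\<^sup>2 \<le> A\<^sup>2 * energy (avg f) T"
        unfolding power_mult_distrib by (intro mult_mono) auto
    qed simp
    finally show ?thesis
      unfolding finite_card_dsub(2)[OF Q] E_def sum_distrib_left[symmetric] by (simp add: mult_ac)
  qed
  have "(\<Sum>R\<in>dsub (s + 1) Q. measure lborel R * (shift_value h t s \<alpha> f R)\<^sup>2)
      = (\<Sum>S\<in>dsub s Q. \<Sum>R\<in>dsub 1 S. measure lborel R * (shift_value h t s \<alpha> f R)\<^sup>2)"
    by (rule sum_dsub_add[OF Q])
  also have "\<dots> \<le> (\<Sum>S\<in>dsub s Q. (2 ^ CARD('n)) ^ t * A\<^sup>2 * E)"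
  proof (rule sum_mono)
    fix S assume S: "S \<in> dsub s Q"
    then have Sd: "S \<in> dyadic" "S \<in> dlevel (k + int s)" "S \<subseteq> Q" using dsub_dyadic dsub_iff[OF k] by blast+
    obtain y where y: "y \<in> S" using dlevel_nonempty[OF Sd(2)] by blast
    then have Qy: "cube_at k y = Q" using dlevel_cube_at[OF k] Sd by blast
    have "(\<Sum>R\<in>dsub 1 S. measure lborel R * (shift_value h t s \<alpha> f R)\<^sup>2)
       = (\<Sum>R\<in>dsub 1 S. (shift_coeff h t \<alpha> f Q S)\<^sup>2 * ((h S (pt R))\<^sup>2 * measure lborel R))"
      using shift_value_child[OF h Sd(2) y] Qy by (intro sum.cong) (auto simp: power_mult_distrib)
    also have "\<dots> = (shift_coeff h t \<alpha> f Q S)\<^sup>2"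
      unfolding sum_distrib_left[symmetric]
      using haar_function_sums(2)[OF Sd(1)] h Sd(1) by (simp add: haar_system_def)
    finally show "(\<Sum>R\<in>dsub 1 S. measure lborel R * (shift_value h t s \<alpha> f R)\<^sup>2) \<le> (2 ^ CARD('n)) ^ t * A\<^sup>2 * E"
      using coeff by simp
  qed
  also have "\<dots> = (2 ^ CARD('n)) ^ s * ((2 ^ CARD('n)) ^ t * A\<^sup>2) * E"
    by (simp add: finite_card_dsub(2)[OF Q])
  finally show "(\<Sum>R\<in>dsub (s + 1) Q. measure lborel R * (shift_value h t s \<alpha> f R)\<^sup>2)
      \<le> (2 ^ CARD('n)) ^ s * ((2 ^ CARD('n)) ^ t * A\<^sup>2) * (\<Sum>T\<in>dsub t Q. energy (avg f) T)"
    unfolding E_def .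
qed auto

theorem theoremA:
  shows "(\<forall>\<sigma> :: int \<Rightarrow> real^'n::finite \<Rightarrow> real. mt_multiplier \<sigma> \<longrightarrow>
            (\<exists>r \<eta> C. 0 < r \<and> r < 1 \<and> 0 < \<eta> \<and> \<eta> < 1 \<and> 0 < C \<and>
               (\<forall>f. Linf_c f \<longrightarrow> (\<exists>S \<subseteq> dyadic. sparse \<eta> S \<and>
                  (AE x in lborel. ennreal (mart_transform \<sigma> f x) \<le> ennreal C * sparse_sum r S f x)))))
       \<and> (\<forall>(h :: (real^'n) set \<Rightarrow> real^'n \<Rightarrow> real) t s \<alpha>.
            haar_system h \<and> (\<exists>A. \<forall>Q T S. \<bar>\<alpha> Q T S\<bar> \<le> A) \<longrightarrow>
            (\<exists>r \<eta> C. 0 < r \<and> r < 1 \<and> 0 < \<eta> \<and> \<eta> < 1 \<and> 0 < C \<and>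
               (\<forall>f. Linf_c f \<longrightarrow> (\<exists>S \<subseteq> dyadic. sparse \<eta> S \<and>
                  (AE x in lborel. ennreal (haar_shift h t s \<alpha> f x) \<le> ennreal C * sparse_sum r S f x)))))
       \<and> (\<exists>r \<eta> C. 0 < r \<and> r < 1 \<and> 0 < \<eta> \<and> \<eta> < 1 \<and> 0 < C \<and>
            (\<forall>f :: real^'n \<Rightarrow> real. Linf_c f \<longrightarrow> (\<exists>S \<subseteq> dyadic. sparse \<eta> S \<and>
               (\<forall>x. ennreal (dyadic_max f x) \<le> ennreal C * sparse_sum r S f x))))"
proof (intro conjI allI impI)
  fix \<sigma> :: "int \<Rightarrow> real^'n \<Rightarrow> real"
  assume "mt_multiplier \<sigma>"
  then show "\<exists>r \<eta> C. 0 < r \<and> r < 1 \<and> 0 < \<eta> \<and> \<eta> < 1 \<and> 0 < C \<and>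
      (\<forall>f. Linf_c f \<longrightarrow> (\<exists>S \<subseteq> dyadic. sparse \<eta> S \<and>
        (AE x in lborel. ennreal (mart_transform \<sigma> f x) \<le> ennreal C * sparse_sum r S f x)))"
    by (rule sparse_domination_mart)
next
  fix h :: "(real^'n) set \<Rightarrow> real^'n \<Rightarrow> real" and t s :: nat
    and \<alpha> :: "(real^'n) set \<Rightarrow> (real^'n) set \<Rightarrow> (real^'n) set \<Rightarrow> real"
  assume "haar_system h \<and> (\<exists>A. \<forall>Q T S. \<bar>\<alpha> Q T S\<bar> \<le> A)"
  then obtain A where "haar_system h" "\<And>Q T S. \<bar>\<alpha> Q T S\<bar> \<le> A" by blast
  then show "\<exists>r \<eta> C. 0 < r \<and> r < 1 \<and> 0 < \<eta> \<and> \<eta> < 1 \<and> 0 < C \<and>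
      (\<forall>f. Linf_c f \<longrightarrow> (\<exists>S \<subseteq> dyadic. sparse \<eta> S \<and>
        (AE x in lborel. ennreal (haar_shift h t s \<alpha> f x) \<le> ennreal C * sparse_sum r S f x)))"
    by (rule sparse_domination_shift)
qed (rule sparse_domination_maximal)

end
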